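(* For the (budgeted) \textsc{Maximum Betweenness Centrality} problem there exist (a) an algorithm running in $O(n^{3})$ time that always returns a feasible set $C$ with $\operatorname{GBC}(C)\ge (1-1/\sqrt{e})\cdot \mathrm{OPT}$, and (b) an algorithm running in $O(n^{6})$ time that always returns a feasible set $C$ with $\operatorname{GBC}(C)\ge (1-1/e)\cdot \mathrm{OPT}$, where $n=|V|$ and $\mathrm{OPT}$ is the optimum value of the instance.
   Context: An instance of \textsc{Maximum Betweenness Centrality} (MBC) consists of an undirected connected graph $G=(V,E)$, node costs $c\colon V\to\mathbb{R}_{\ge 0}$ and a budget $b\ge 0$. For distinct $s,t\in V$ let $\sigma_{s,t}$ be the number of shortest $s$--$t$ paths, and for $C\subseteq V$ let $\sigma_{s,t}(C)$ be the number of shortest $s$--$t$ paths containing at least one node of $C$. The group betweenness centrality is $\operatorname{GBC}(C)=\sum_{s,t\in V,\ s\neq t}\sigma_{s,t}(C)/\sigma_{s,t}$. A set $C\subseteq V$ is feasible if $c(C)=\sum_{v\in C}c(v)\le b$, and the goal is to find a feasible $C$ maximizing $\operatorname{GBC}(C)$. *)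

theory Defs
  imports
    "Graph_Theory.Pair_Digraph"
    "Graph_Theory.Digraph_Component"
    "Graph_Theory.Vertex_Walk"
    "HOL-Library.Landau_Symbols"
begin

section \<open>Maximum betweenness centrality\<close>

text \<open>
  A finite simple undirected graph is a symmetric, loop-free digraph whose arcs are pairs
  of vertices, i.e. a \<open>pair_graph\<close>. The qualified name \<open>Digraph_Component.connected\<close>
  distinguishes graph connectedness from topological connectedness.
\<close>

locale mbc_instance = pair_graph G
  for G :: "'a pair_pre_digraph" +
  fixes c :: "'a \<Rightarrow> real"
    and b :: real
  assumes connected: "Digraph_Component.connected (with_proj G)"
    and cost_nonneg: "\<And>v. v \<in> pverts G \<Longrightarrow> 0 \<le> c v"
    and budget_nonneg: "0 \<le> b"

definition shortest_paths :: "'a pair_pre_digraph \<Rightarrow> 'a \<Rightarrow> 'a \<Rightarrow> 'a vwalk set" where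
  "shortest_paths G s t =
     {p. is_arg_min vwalk_length (\<lambda>q. vpath q (with_proj G) \<and> hd q = s \<and> last q = t) p}"

definition num_paths :: "'a pair_pre_digraph \<Rightarrow> 'a \<Rightarrow> 'a \<Rightarrow> nat" where
  "num_paths G s t = card (shortest_paths G s t)"

text \<open>The end nodes of a path belong to it, so paths starting or ending in \<open>C\<close> count.\<close>

definition num_paths_through :: "'a pair_pre_digraph \<Rightarrow> 'a set \<Rightarrow> 'a \<Rightarrow> 'a \<Rightarrow> nat" where
  "num_paths_through G C s t = card {p \<in> shortest_paths G s t. set p \<inter> C \<noteq> {}}"

definition gbc :: "'a pair_pre_digraph \<Rightarrow> 'a set \<Rightarrow> real" where
  "gbc G C = (\<Sum>(s, t) \<in> {(s, t). s \<in> pverts G \<and> t \<in> pverts G \<and> s \<noteq> t}.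
     real (num_paths_through G C s t) / real (num_paths G s t))"

definition feasible :: "'a pair_pre_digraph \<Rightarrow> ('a \<Rightarrow> real) \<Rightarrow> real \<Rightarrow> 'a set \<Rightarrow> bool" where
  "feasible G c b C \<longleftrightarrow> C \<subseteq> pverts G \<and> (\<Sum>v\<in>C. c v) \<le> b"

definition opt :: "'a pair_pre_digraph \<Rightarrow> ('a \<Rightarrow> real) \<Rightarrow> real \<Rightarrow> real" where
  "opt G c b = Max (gbc G ` {C. feasible G c b C})"


section \<open>The machine model: a unit-cost real RAM\<close>

text \<open>
  Programs are structured while programs over two separate memories, one of natural numbers
  (used for indices, flags and control) and one of real numbers. Each memory consists of
  arrays addressed by a name and a natural-number index, where the index may itself be
  computed from memory (indirect addressing); a scalar variable is an array of which only cell
  0 is used. A program mentions only finitely many array names, so the named arrays amount to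
  a fixed number of interleaved arrays in one memory.

  The primitive operations are those of the usual real RAM: addition, truncated subtraction
  and multiplication of naturals; the four arithmetic operations on reals; comparisons. There
  is no rounding and no other transfer from reals to naturals. Literals are natural numbers
  only: arbitrary real literals could carry an infinite amount of advice. Division by
  zero follows the HOL convention of yielding 0.
\<close>

type_synonym name = string

record state =
  imem :: "name \<Rightarrow> nat \<Rightarrow> nat"
  rmem :: "name \<Rightarrow> nat \<Rightarrow> real"

datatype iexp =
    ILit nat
  | ICell name iexp
  | IAdd iexp iexp
  | ISub iexp iexp
  | IMul iexp iexp

datatype rexp =
    RLit nat
  | RCell name iexp
  | RAdd rexp rexp
  | RSub rexp rexp
  | RMul rexp rexp
  | RDiv rexp rexp

datatype bexp =
    ILess iexp iexp
  | RLess rexp rexp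
  | BNot bexp
  | BAnd bexp bexp

datatype com =
    Skip
  | IAssign name iexp iexp
  | RAssign name iexp rexp
  | Seq com com
  | Cond bexp com com
  | While bexp com

primrec ival :: "iexp \<Rightarrow> state \<Rightarrow> nat" where
  "ival (ILit k) s = k"
| "ival (ICell a e) s = imem s a (ival e s)"
| "ival (IAdd e f) s = ival e s + ival f s"
| "ival (ISub e f) s = ival e s - ival f s"
| "ival (IMul e f) s = ival e s * ival f s"

primrec rval :: "rexp \<Rightarrow> state \<Rightarrow> real" where
  "rval (RLit k) s = real k"
| "rval (RCell a e) s = rmem s a (ival e s)"
| "rval (RAdd e f) s = rval e s + rval f s"
| "rval (RSub e f) s = rval e s - rval f s"
| "rval (RMul e f) s = rval e s * rval f s"
| "rval (RDiv e f) s = rval e s / rval f s"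

primrec bval :: "bexp \<Rightarrow> state \<Rightarrow> bool" where
  "bval (ILess e f) s \<longleftrightarrow> ival e s < ival f s"
| "bval (RLess e f) s \<longleftrightarrow> rval e s < rval f s"
| "bval (BNot g) s \<longleftrightarrow> \<not> bval g s"
| "bval (BAnd g h) s \<longleftrightarrow> bval g s \<and> bval h s"

text \<open>Every literal, memory access, arithmetic operation, comparison and connective costs 1.\<close>

primrec icost :: "iexp \<Rightarrow> nat" where
  "icost (ILit k) = 1"
| "icost (ICell a e) = icost e + 1"
| "icost (IAdd e f) = icost e + icost f + 1"
| "icost (ISub e f) = icost e + icost f + 1"
| "icost (IMul e f) = icost e + icost f + 1"

primrec rcost :: "rexp \<Rightarrow> nat" where
  "rcost (RLit k) = 1"
| "rcost (RCell a e) = icost e + 1"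
| "rcost (RAdd e f) = rcost e + rcost f + 1"
| "rcost (RSub e f) = rcost e + rcost f + 1"
| "rcost (RMul e f) = rcost e + rcost f + 1"
| "rcost (RDiv e f) = rcost e + rcost f + 1"

primrec bcost :: "bexp \<Rightarrow> nat" where
  "bcost (ILess e f) = icost e + icost f + 1"
| "bcost (RLess e f) = rcost e + rcost f + 1"
| "bcost (BNot g) = bcost g + 1"
| "bcost (BAnd g h) = bcost g + bcost h + 1"

text \<open>
  \<open>exec P s t s'\<close>: started in \<open>s\<close>, program \<open>P\<close> terminates in \<open>s'\<close> after exactly \<open>t\<close> steps.
\<close>

inductive exec :: "com \<Rightarrow> state \<Rightarrow> nat \<Rightarrow> state \<Rightarrow> bool" where
  Skip: "exec Skip s 1 s"
| IAssign: "exec (IAssign a e f) s (icost e + icost f + 1)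
    (s\<lparr>imem := (imem s)(a := (imem s a)(ival e s := ival f s))\<rparr>)"
| RAssign: "exec (RAssign a e f) s (icost e + rcost f + 1)
    (s\<lparr>rmem := (rmem s)(a := (rmem s a)(ival e s := rval f s))\<rparr>)"
| Seq: "exec P s t s' \<Longrightarrow> exec Q s' t' s'' \<Longrightarrow> exec (Seq P Q) s (t + t') s''"
| CondTrue: "bval g s \<Longrightarrow> exec P s t s' \<Longrightarrow> exec (Cond g P Q) s (bcost g + 1 + t) s'"
| CondFalse: "\<not> bval g s \<Longrightarrow> exec Q s t s' \<Longrightarrow> exec (Cond g P Q) s (bcost g + 1 + t) s'"
| WhileFalse: "\<not> bval g s \<Longrightarrow> exec (While g P) s (bcost g + 1) s"
| WhileTrue: "bval g s \<Longrightarrow> exec P s t s' \<Longrightarrow> exec (While g P) s' t' s'' \<Longrightarrow>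
    exec (While g P) s (bcost g + 1 + t + t') s''"

inductive_cases SkipE: "exec Skip s t s'"
inductive_cases IAssignE: "exec (IAssign a e f) s t s'"
inductive_cases RAssignE: "exec (RAssign a e f) s t s'"
inductive_cases SeqE: "exec (Seq P Q) s t s'"
inductive_cases CondE: "exec (Cond g P Q) s t s'"
inductive_cases WhileE: "exec (While g P) s t s'"

text \<open>
  Programs are deterministic: result and running time are unique. Hence nothing is lost by
  quantifying existentially over them below.
\<close>

lemma exec_deterministic:
  assumes "exec P s t s'" and "exec P s u s''"
  shows "u = t \<and> s'' = s'"
  using assms
proof (induction arbitrary: u s'' rule: exec.induct)
  case (Skip s)
  then show ?case by (rule SkipE) simp
next
  case (IAssign a e f s)
  then show ?case by (rule IAssignE) simp
next
  case (RAssign a e f s)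
  then show ?case by (rule RAssignE) simp
next
  case (Seq P s t s' Q t' r)
  from Seq.prems obtain t1 t2 r1 where
    "u = t1 + t2" "exec P s t1 r1" "exec Q r1 t2 s''" by (rule SeqE)
  with Seq.IH show ?case by metis
next
  case (CondTrue g s P t s' Q)
  from CondTrue.prems CondTrue.hyps(1) obtain t1 where
    "u = bcost g + 1 + t1" "exec P s t1 s''" by (auto elim: CondE)
  with CondTrue.IH show ?case by metis
next
  case (CondFalse g s Q t s' P)
  from CondFalse.prems CondFalse.hyps(1) obtain t1 where
    "u = bcost g + 1 + t1" "exec Q s t1 s''" by (auto elim: CondE)
  with CondFalse.IH show ?case by metis
next
  case (WhileFalse g s P)
  from WhileFalse.prems show ?case
    by (rule WhileE) (simp_all add: WhileFalse.hyps)
next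
  case (WhileTrue g s P t s' t' r)
  have "\<exists>t1 t2 r1. u = bcost g + 1 + t1 + t2 \<and> exec P s t1 r1 \<and> exec (While g P) r1 t2 s''"
    using WhileTrue.prems
  proof (rule WhileE)
    assume "\<not> bval g s"
    with WhileTrue.hyps(1) show ?thesis by contradiction
  next
    fix t1 r1 t2
    assume "u = Suc (bcost g + t1 + t2)" "exec P s t1 r1" "exec (While g P) r1 t2 s''"
    then show ?thesis by auto
  qed
  then obtain t1 t2 r1 where
    "u = bcost g + 1 + t1 + t2" "exec P s t1 r1" "exec (While g P) r1 t2 s''" by (elim exE conjE)
  with WhileTrue.IH show ?case by metis
qed


section \<open>Algorithms for maximum betweenness centrality\<close>

text \<open>
  An instance whose nodes are numbered \<open>0, \<dots>, n - 1\<close> is given by the number \<open>n\<close>, the adjacency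
  matrix in row-major order, the node costs and the budget. All other cells are 0.
\<close>

definition encode :: "nat \<Rightarrow> nat pair_pre_digraph \<Rightarrow> (nat \<Rightarrow> real) \<Rightarrow> real \<Rightarrow> state" where
  "encode n G c b =
     \<lparr>imem = (\<lambda>_ _. 0)
        (''n'' := (\<lambda>i. if i = 0 then n else 0),
         ''adj'' := (\<lambda>i. if i < n * n \<and> (i div n, i mod n) \<in> parcs G then 1 else 0)),
      rmem = (\<lambda>_ _. 0)
        (''cost'' := (\<lambda>i. if i < n then c i else 0),
         ''budget'' := (\<lambda>i. if i = 0 then b else 0))\<rparr>"

text \<open>The returned set is given by its characteristic vector.\<close>

definition output_set :: "nat \<Rightarrow> state \<Rightarrow> nat set" where
  "output_set n s = {v. v < n \<and> imem s ''out'' v \<noteq> 0}"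

definition approximation_algorithm :: "com \<Rightarrow> real \<Rightarrow> bool" where
  "approximation_algorithm P \<alpha> \<longleftrightarrow>
     (\<forall>n G c b. mbc_instance G c b \<longrightarrow> pverts G = {..<n} \<longrightarrow>
        (\<exists>t s. exec P (encode n G c b) t s \<and>
               feasible G c b (output_set n s) \<and>
               gbc G (output_set n s) \<ge> \<alpha> * opt G c b))"

text \<open>\<open>T n\<close> bounds the worst-case number of steps over all instances with \<open>n\<close> nodes.\<close>

definition runs_in_time :: "com \<Rightarrow> (nat \<Rightarrow> real) \<Rightarrow> bool" where
  "runs_in_time P T \<longleftrightarrow>
     (\<forall>n G c b. mbc_instance G c b \<longrightarrow> pverts G = {..<n} \<longrightarrow>
        (\<exists>t s. exec P (encode n G c b) t s \<and> real t \<le> T n))"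

end

theory Submission
  imports Defs
begin

text \<open>
  Group betweenness is monotone and submodular. Greedy by density, which after every step also
  considers adding each single item that still fits, reaches half of the optimum: until its cost
  exceeds the budget minus the cost of the most expensive optimal item \<open>q\<close>, every optimal item
  fits, and if adding \<open>q\<close> never yields half of the optimum, the remaining optimal items force a large
  gain per unit of cost. Since \<open>1 / 2 \<ge> 1 - 1 / sqrt e\<close>, this gives the first algorithm. Started from
  all triples of nodes, the same greedy procedure gives \<open>1 - 1 / e\<close> (the argument of Sviridenko).

  For the running time, let \<open>N s t\<close> be the number of shortest paths from \<open>s\<close> to \<open>t\<close> avoiding the
  current set, and \<open>W x y\<close> the sum over all pairs \<open>(s, t)\<close> for which \<open>x, y\<close> lie in this order on a
  shortest path of \<open>N s x * N y t / \<sigma> s t\<close>. The gain of \<open>v\<close> is \<open>W v v\<close>, and adding \<open>v\<close> to the set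
  changes each entry of both matrices by an expression in the rows and columns of \<open>v\<close>. Hence a
  greedy step costs \<open>O(n^2)\<close>, and the initial matrices are computed in \<open>O(n^3)\<close>.
\<close>


section \<open>Greedy maximization of a submodular function under a budget\<close>

text \<open>Neither approximation argument locates the step at which greedy goes wrong. Both assume
  that the best recorded value \<open>M\<close> is too small and maintain an invariant that forces
  every step to add an item; after \<open>card V\<close> steps all of \<open>V\<close> has been
  recorded, so \<open>f V \<le> M\<close>, although \<open>M < f S \<le> f V\<close>. Three
  obstacles shape the rest. Items of cost 0 have no density, and cross-multiplied comparison is not
  transitive through them. Gains use only the diagonal of \<open>weight\<close>, but updating the
  diagonal calls for the other entries; the updates work because paths stay shortest in
  \<open>G\<close> itself, so distances are fixed once and only counts change. Finally, running
  times are read off the nesting depth of loops of length \<open>n\<close>, which is too coarse for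
  breadth-first search: its four nested loops would give \<open>n^4\<close>. Since each pair of a
  source and a node is expanded on one level only, its time is bounded by a separate sum.\<close>

lemma finite_argmax:
  fixes h :: "'a \<Rightarrow> real"
  assumes "finite X" "X \<noteq> {}"
  shows "\<exists>y\<in>X. \<forall>x\<in>X. h x \<le> h y"
proof -
  have "Max (h ` X) \<in> h ` X" using assms by (intro Max_in) auto
  then obtain y where "y \<in> X" "Max (h ` X) = h y" by auto
  then show ?thesis using assms(1) by (metis Max_ge finite_imageI imageI)
qed

locale submodular =
  fixes V :: "'a set" and f :: "'a set \<Rightarrow> real" and c :: "'a \<Rightarrow> real" and b :: real
  assumes finite_V: "finite V"
    and V_nonempty: "V \<noteq> {}"
    and empty: "f {} = 0"
    and mono: "A \<subseteq> B \<Longrightarrow> B \<subseteq> V \<Longrightarrow> f A \<le> f B"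
    and diminishing: "A \<subseteq> B \<Longrightarrow> B \<subseteq> V \<Longrightarrow> x \<in> V \<Longrightarrow> f (insert x B) - f B \<le> f (insert x A) - f A"
    and c_nonneg: "x \<in> V \<Longrightarrow> 0 \<le> c x"
begin

section \<open>Gains, densities and the trace of a greedy run\<close>

definition addable :: "'a set \<Rightarrow> 'a \<Rightarrow> bool" where
  "addable A x \<longleftrightarrow> x \<in> V \<and> x \<notin> A \<and> sum c A + c x \<le> b"

definition gain :: "'a set \<Rightarrow> 'a \<Rightarrow> real" where
  "gain A x = f (insert x A) - f A"

text \<open>Densities are compared by cross-multiplication, which also covers items of cost 0.\<close>

definition densest :: "'a set \<Rightarrow> 'a \<Rightarrow> bool" where
  "densest A p \<longleftrightarrow> addable A p \<and> (\<forall>x. addable A x \<longrightarrow> gain A x * c p \<le> gain A p * c x)"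

definition greedy_step :: "'a set \<Rightarrow> 'a set \<Rightarrow> bool" where
  "greedy_step A B \<longleftrightarrow> (\<exists>p. densest A p \<and> B = insert p A) \<or> ((\<forall>x. \<not> addable A x) \<and> B = A)"

text \<open>Members of \<open>A\<close> are included so that a run also records \<open>f A\<close>
  itself, since \<open>insert x A = A\<close> for them.\<close>

definition candidate :: "'a set \<Rightarrow> 'a \<Rightarrow> bool" where
  "candidate A x \<longleftrightarrow> x \<in> A \<or> addable A x"

definition greedy_run :: "(nat \<Rightarrow> 'a set) \<Rightarrow> nat \<Rightarrow> real \<Rightarrow> bool" where
  "greedy_run G n M \<longleftrightarrow> (\<forall>j<n. greedy_step (G j) (G (Suc j)) \<and> (\<forall>x. candidate (G j) x \<longrightarrow> f (insert x (G j)) \<le> M))"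

lemma gain_nonneg: "A \<subseteq> V \<Longrightarrow> x \<in> V \<Longrightarrow> 0 \<le> gain A x"
  unfolding gain_def using mono[of A "insert x A"] by auto

lemma gain_antimono: "A \<subseteq> B \<Longrightarrow> B \<subseteq> V \<Longrightarrow> x \<in> V \<Longrightarrow> gain B x \<le> gain A x"
  unfolding gain_def by (rule diminishing)

lemma f_Un_le:
  assumes "A \<subseteq> V" "X \<subseteq> V"
  shows "f (A \<union> X) \<le> f A + (\<Sum>x\<in>X. gain A x)"
proof -
  have "finite X" using assms finite_V finite_subset by blast
  then show ?thesis using assms(2)
  proof (induction X)
    case (insert x X)
    have "f (A \<union> insert x X) = f (A \<union> X) + gain (A \<union> X) x" by (simp add: gain_def)
    also have "\<dots> \<le> f A + sum (gain A) X + gain A x"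
      using insert assms(1) by (intro add_mono gain_antimono) auto
    finally show ?case using insert.hyps by simp
  qed simp
qed

lemma greedy_step_subset: "A \<subseteq> V \<Longrightarrow> greedy_step A B \<Longrightarrow> A \<subseteq> B \<and> B \<subseteq> V"
  unfolding greedy_step_def densest_def addable_def by auto

lemma greedy_run_subset:
  "greedy_run G n M \<Longrightarrow> G 0 \<subseteq> V \<Longrightarrow> j \<le> n \<Longrightarrow> G j \<subseteq> V"
proof (induction j)
  case (Suc j)
  then show ?case using greedy_step_subset[of "G j" "G (Suc j)"] by (auto simp: greedy_run_def)
qed auto

text \<open>A run that never stalls grows by one item per step, so it ends with all of
  \<open>V\<close>; the item added last was a candidate, so \<open>f V\<close> itself is among the
  values bounded by \<open>M\<close>.\<close>

lemma greedy_run_complete: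
  assumes run: "greedy_run G (card V) M" and G0: "G 0 \<subseteq> V"
    and add: "\<And>j. j < card V \<Longrightarrow> \<exists>p. densest (G j) p \<and> G (Suc j) = insert p (G j)"
  shows "f V \<le> M"
proof -
  have card: "j \<le> card V \<Longrightarrow> j \<le> card (G j)" for j
  proof (induction j)
    case (Suc j)
    then obtain p where "densest (G j) p" "G (Suc j) = insert p (G j)" using add[of j] by auto
    moreover have "finite (G j)"
      using greedy_run_subset[OF run G0, of j] Suc finite_V finite_subset by auto
    ultimately show ?case using Suc by (simp add: densest_def addable_def)
  qed simp
  have "G (card V) \<subseteq> V" by (rule greedy_run_subset[OF run G0]) simp
  then have eq: "G (card V) = V" using card[of "card V"] finite_V by (simp add: card_seteq)
  have "0 < card V" using finite_V V_nonempty by (simp add: card_gt_0_iff)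
  then obtain k where k: "card V = Suc k" by (cases "card V") auto
  then obtain p where p: "densest (G k) p" "G (Suc k) = insert p (G k)" using add[of k] by auto
  then have "f (insert p (G k)) \<le> M"
    using run k by (auto simp: greedy_run_def candidate_def densest_def)
  then show ?thesis using p eq k by simp
qed

text \<open>If \<open>M\<close> were below half of \<open>f S\<close>, then beyond any greedy set
  extended by \<open>q\<close> the rest of \<open>S\<close> would have to contribute at least
  \<open>d = f S - M\<close>, at cost at most \<open>B\<close>. So greedy collects value at density
  at least \<open>d / B\<close>; as its value stays at most \<open>M < d\<close>, its cost stays at
  most \<open>B\<close>, where every item of \<open>S\<close> still fits. Greedy can then never
  stop.\<close>

theorem greedy_max_half:
  assumes run: "greedy_run G (card V) M" and G0: "G 0 = {}" and M: "0 \<le> M"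
    and S: "S \<subseteq> V" "sum c S \<le> b"
  shows "f S \<le> 2 * M"
proof (cases "S = {}")
  case True
  then show ?thesis using M empty by simp
next
  case False
  show ?thesis
  proof (rule ccontr)
    assume "\<not> f S \<le> 2 * M"
    then have big: "2 * M < f S" by simp
    have finS: "finite S" using S finite_V finite_subset by blast
    obtain q where q: "q \<in> S" "\<And>x. x \<in> S \<Longrightarrow> c x \<le> c q"
      using finite_argmax[OF finS False, of c] by blast
    define d where "d = f S - M"
    define B where "B = b - c q"
    have d: "M < d" using big by (simp add: d_def)
    have costS: "sum c (S - {q}) \<le> B" using S q finS by (simp add: B_def sum_diff1)
    have "0 \<le> sum c (S - {q})" using S c_nonneg by (intro sum_nonneg) auto
    then have B: "0 \<le> B" using costS by simp
    have sub: "j \<le> card V \<Longrightarrow> G j \<subseteq> V" for j using greedy_run_subset[OF run, of j] G0 by simp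
    have step: "\<exists>p. densest (G j) p \<and> G (Suc j) = insert p (G j) \<and>
        sum c (G (Suc j)) \<le> B \<and> sum c (G (Suc j)) * d \<le> f (G (Suc j)) * B"
      if j: "j < card V" and IH: "sum c (G j) \<le> B" "sum c (G j) * d \<le> f (G j) * B" for j
    proof -
      note subj = sub[of j]
      have finG: "finite (G j)" using subj j finite_V finite_subset by auto
      have cand: "f (insert x (G j)) \<le> M" if "candidate (G j) x" for x
        using that run j by (auto simp: greedy_run_def)
      have fits: "candidate (G j) x" if "x \<in> S" for x
        using that q(2)[OF that] S IH(1) by (auto simp: candidate_def addable_def B_def)
      have fq: "f (insert q (G j)) \<le> M" using cand fits q by blast
      have "\<not> S \<subseteq> G j"
      proof
        assume "S \<subseteq> G j"
        then have "f S \<le> f (insert q (G j))" using mono[of S "insert q (G j)"] subj j S q by auto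
        then show False using fq big M by simp
      qed
      then obtain x0 where "addable (G j) x0" using fits by (auto simp: candidate_def)
      then obtain p where p: "densest (G j) p" "G (Suc j) = insert p (G j)"
        using run j by (auto simp: greedy_run_def greedy_step_def)
      have pV: "p \<in> V" "p \<notin> G j" using p by (auto simp: densest_def addable_def)
      define R where "R = S - {q} - G j"
      have "f S \<le> f (insert q (G j) \<union> R)"
        using subj j S q unfolding R_def by (intro mono) auto
      also have "\<dots> \<le> f (insert q (G j)) + (\<Sum>x\<in>R. gain (insert q (G j)) x)"
        using subj j S q unfolding R_def by (intro f_Un_le) auto
      also have "\<dots> \<le> M + (\<Sum>x\<in>R. gain (G j) x)"
        using subj j S q unfolding R_def by (intro add_mono fq sum_mono gain_antimono) auto
      finally have "d \<le> (\<Sum>x\<in>R. gain (G j) x)" by (simp add: d_def)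
      then have "d * c p \<le> (\<Sum>x\<in>R. gain (G j) x) * c p" using c_nonneg pV by (intro mult_right_mono) auto
      also have "\<dots> = (\<Sum>x\<in>R. gain (G j) x * c p)" by (simp add: sum_distrib_right)
      also have "\<dots> \<le> (\<Sum>x\<in>R. gain (G j) p * c x)"
        using p fits unfolding R_def densest_def candidate_def by (intro sum_mono) auto
      also have "\<dots> = gain (G j) p * sum c R" by (simp add: sum_distrib_left)
      also have "\<dots> \<le> gain (G j) p * B"
      proof (rule mult_left_mono)
        have "sum c R \<le> sum c (S - {q})" unfolding R_def using finS S c_nonneg by (intro sum_mono2) auto
        then show "sum c R \<le> B" using costS by simp
        show "0 \<le> gain (G j) p" using gain_nonneg subj j pV by auto
      qed
      finally have prog: "d * c p \<le> gain (G j) p * B" .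
      have cost: "sum c (G (Suc j)) = sum c (G j) + c p" using p pV finG by simp
      have val: "f (G (Suc j)) = f (G j) + gain (G j) p" using p by (simp add: gain_def)
      \<comment> \<open>The product form of \<open>cost / B \<le> value / d\<close> stays meaningful
        when \<open>B = 0\<close>.\<close>
      have main: "sum c (G (Suc j)) * d \<le> f (G (Suc j)) * B"
        unfolding cost val using prog IH(2) by (simp add: algebra_simps)
      have "f (G (Suc j)) \<le> M" using cand p by (auto simp: candidate_def densest_def)
      \<comment> \<open>The recorded bound restores the cost invariant: with value at most
        \<open>M < d\<close>, the previous inequality gives \<open>cost * d \<le> d * B\<close>, and
        \<open>d\<close> is positive.\<close>
      then have "sum c (G (Suc j)) * d \<le> d * B"
        using main d B mult_right_mono[of "f (G (Suc j))" d B] by linarith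
      then have "sum c (G (Suc j)) \<le> B" using d M by (simp add: mult.commute)
      then show ?thesis using p main by blast
    qed
    have "j \<le> card V \<Longrightarrow> sum c (G j) \<le> B \<and> sum c (G j) * d \<le> f (G j) * B" for j
    proof (induction j)
      case 0
      show ?case using G0 empty B by simp
    next
      case (Suc j)
      then show ?case using step[of j] by auto
    qed
    then have "\<exists>p. densest (G j) p \<and> G (Suc j) = insert p (G j)" if "j < card V" for j
      using step[of j] that by auto
    then have "f V \<le> M" using greedy_run_complete[OF run] G0 by simp
    then show False using mono[of S V] S big M by simp
  qed
qed

text \<open>
  The three items are chosen greedily within \<open>S\<close>; the gain of any other item of \<open>S\<close> is at most that
  of each of the three choices, hence at most a third of their total value.
\<close>

lemma seed_exists:
  assumes S: "S \<subseteq> V" "S \<noteq> {}"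
  obtains y1 y2 y3 where "y1 \<in> S" "y2 \<in> S" "y3 \<in> S"
    "\<And>A x. x \<in> S \<Longrightarrow> {y1, y2, y3} \<subseteq> A \<Longrightarrow> A \<subseteq> V \<Longrightarrow> 3 * gain A x \<le> f {y1, y2, y3}"
proof -
  have finS: "finite S" using S finite_V finite_subset by blast
  have arg: "\<exists>y\<in>S. \<forall>x\<in>S. gain A x \<le> gain A y" for A
    using finite_argmax[OF finS S(2), of "gain A"] by blast
  \<comment> \<open>The choices may coincide: when \<open>S\<close> has fewer than three items, an
    item is chosen again with gain 0, so small sets fall under the same argument.\<close>
  obtain y1 where y1: "y1 \<in> S" "\<And>x. x \<in> S \<Longrightarrow> gain {} x \<le> gain {} y1" using arg by blast
  obtain y2 where y2: "y2 \<in> S" "\<And>x. x \<in> S \<Longrightarrow> gain {y1} x \<le> gain {y1} y2" using arg by blast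
  obtain y3 where y3: "y3 \<in> S" "\<And>x. x \<in> S \<Longrightarrow> gain {y1, y2} x \<le> gain {y1, y2} y3" using arg by blast
  have total: "f {y1, y2, y3} = gain {} y1 + gain {y1} y2 + gain {y1, y2} y3"
    using empty by (simp add: gain_def insert_commute)
  show thesis
  proof (rule that[OF y1(1) y2(1) y3(1)])
    fix A x assume x: "x \<in> S" and A: "{y1, y2, y3} \<subseteq> A" "A \<subseteq> V"
    have "gain A x \<le> gain {} x" "gain A x \<le> gain {y1} x" "gain A x \<le> gain {y1, y2} x"
      using x A S by (auto intro!: gain_antimono)
    then show "3 * gain A x \<le> f {y1, y2, y3}"
      using y1(2)[OF x] y2(2)[OF x] y3(2)[OF x] total by simp
  qed
qed

lemma densest_among:
  assumes "finite X" "X \<noteq> {}" "\<And>x. x \<in> X \<Longrightarrow> 0 < c x"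
  shows "\<exists>p\<in>X. \<forall>x\<in>X. gain A x * c p \<le> gain A p * c x"
proof -
  obtain p where p: "p \<in> X" "\<And>x. x \<in> X \<Longrightarrow> gain A x / c x \<le> gain A p / c p"
    using finite_argmax[OF assms(1,2), of "\<lambda>x. gain A x / c x"] by blast
  have "gain A x * c p \<le> gain A p * c x" if "x \<in> X" for x
    using p(2)[OF that] assms(3)[OF that] assms(3)[OF p(1)] by (simp add: field_simps)
  then show ?thesis using p by blast
qed

text \<open>
  Cross-multiplied comparison is transitive only through an item of positive cost, so an item that
  does not fit (whose cost is positive) serves as the comparison point.
\<close>

lemma blocked_exists:
  assumes A: "A \<subseteq> V" "sum c A \<le> b" and S: "S \<subseteq> V" "\<not> S \<subseteq> A"
    and bad: "(\<exists>p. densest A p \<and> (\<exists>x\<in>S - A. gain A p * c x < gain A x * c p)) \<or> (\<forall>x. \<not> addable A x)"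
  obtains q where "q \<in> S - A" "b < sum c A + c q" "\<And>x. x \<in> S - A \<Longrightarrow> gain A x * c q \<le> gain A q * c x"
proof -
  note found = that
  define N where "N = {x \<in> S - A. b < sum c A + c x}"
  have finN: "finite N" using S finite_V by (auto simp: N_def intro: finite_subset[of _ V])
  have posN: "0 < c x" if "x \<in> N" for x using that A by (auto simp: N_def)
  have fit: "addable A x" if "x \<in> S - A" "x \<notin> N" for x
    using that S by (auto simp: N_def addable_def)
  \<comment> \<open>The densest item of \<open>N\<close> is the witness. It dominates the rest of
    \<open>N\<close> by choice, so only the items that fit remain to be compared with it; that is
    \<open>dom\<close>.\<close>
  have blocked: thesis if N: "N \<noteq> {}"
    and dom: "\<And>q x. q \<in> N \<Longrightarrow> (\<And>z. z \<in> N \<Longrightarrow> gain A z * c q \<le> gain A q * c z) \<Longrightarrow>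
      addable A x \<Longrightarrow> gain A x * c q \<le> gain A q * c x"
  proof -
    obtain q where q: "q \<in> N" "\<And>z. z \<in> N \<Longrightarrow> gain A z * c q \<le> gain A q * c z"
      using densest_among[OF finN N posN] by blast
    show thesis
    proof (rule found[of q])
      show "q \<in> S - A" "b < sum c A + c q" using q by (auto simp: N_def)
      show "gain A x * c q \<le> gain A q * c x" if "x \<in> S - A" for x
        using q dom[OF q] fit[OF that] by blast
    qed
  qed
  show thesis
    using bad
  proof (elim disjE exE bexE conjE)
    assume "\<forall>x. \<not> addable A x"
    moreover from this have "N \<noteq> {}" using S fit by blast
    ultimately show thesis using blocked by blast
  next
    fix p z assume p: "densest A p" and z: "z \<in> S - A" "gain A p * c z < gain A z * c p"
    have cp: "0 \<le> c p" using p c_nonneg by (auto simp: densest_def addable_def)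
    have zN: "z \<in> N" using fit p z by (force simp: densest_def)
    have cp0: "0 < c p"
    proof (rule ccontr)
      assume "\<not> 0 < c p"
      then have "c p = 0" using cp by simp
      moreover have "0 \<le> gain A p" using gain_nonneg A p by (auto simp: densest_def addable_def)
      ultimately show False using z(2) posN[OF zN] by (simp add: mult_less_0_iff)
    qed
    show thesis
    proof (rule blocked)
      show "N \<noteq> {}" using zN by auto
      fix q x assume q: "q \<in> N" "\<And>z. z \<in> N \<Longrightarrow> gain A z * c q \<le> gain A q * c z"
        and x: "addable A x"
      have cx: "0 \<le> c x" using x c_nonneg by (auto simp: addable_def)
      have cq: "0 < c q" and cz: "0 < c z" using posN q zN by auto
      \<comment> \<open>Density is passed along \<open>x\<close>, \<open>p\<close>,
        \<open>z\<close>, \<open>q\<close>. The last three have positive cost, while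
        \<open>x\<close> may have cost 0.\<close>
      have "gain A x * c p \<le> gain A p * c x" using p x by (simp add: densest_def)
      then have "gain A x \<le> (gain A p / c p) * c x" using cp0 by (simp add: field_simps)
      also have "\<dots> \<le> (gain A z / c z) * c x"
        using z(2) cp0 cz cx by (intro mult_right_mono) (simp_all add: field_simps)
      also have "\<dots> \<le> (gain A q / c q) * c x"
        using q(2)[OF zN] cq cz cx by (intro mult_right_mono) (simp_all add: field_simps)
      finally show "gain A x * c q \<le> gain A q * c x" using cq by (simp add: field_simps)
    qed
  qed
qed

text \<open>\<open>\<Phi>\<close> is the value still missing. While the added item is at least as
  dense as everything left in \<open>S\<close>, \<open>\<Phi>\<close> shrinks at least by the factor
  \<open>exp (- c p / B)\<close>. At the first failure \<open>blocked_exists\<close> supplies an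
  item \<open>q\<close> of \<open>S\<close> that overruns the budget but is as dense as anything
  left in \<open>S\<close>. Adding it on paper exhausts \<open>B\<close> and leaves at most the
  fraction \<open>1 / e\<close> of the gap; the seed keeps the gain of \<open>q\<close> small enough
  to be given back.\<close>

theorem greedy_seeded:
  assumes run: "greedy_run G (card V) M" and G0: "G 0 = {y1, y2, y3}"
    and S: "S \<subseteq> V" "sum c S \<le> b" and y: "y1 \<in> S" "y2 \<in> S" "y3 \<in> S"
    and seed: "\<And>A x. x \<in> S \<Longrightarrow> {y1, y2, y3} \<subseteq> A \<Longrightarrow> A \<subseteq> V \<Longrightarrow> 3 * gain A x \<le> f {y1, y2, y3}"
  shows "(1 - 1 / exp 1) * f S \<le> M"
proof (rule ccontr)
  let ?Y = "{y1, y2, y3}"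
  assume "\<not> (1 - 1 / exp 1) * f S \<le> M"
  then have big: "M < (1 - 1 / exp 1) * f S" by simp
  have YV: "?Y \<subseteq> V" using S y by auto
  have finS: "finite S" using S finite_V finite_subset by blast
  have fS: "0 \<le> f S" using mono[of "{}" S] S empty by simp
  then have "(1 - 1 / exp 1) * f S \<le> f S" by (simp add: algebra_simps)
  then have MS: "M < f S" using big by simp
  define B where "B = b - sum c ?Y"
  define \<Phi> where "\<Phi> A = f S - f A" for A
  have costS: "sum c (S - ?Y) \<le> B"
    using S y finS by (subst sum_diff) (auto simp: B_def)
  have sub: "j \<le> card V \<Longrightarrow> G j \<subseteq> V" for j using greedy_run_subset[OF run, of j] G0 YV by simp
  text \<open>Dividing by \<open>B = 0\<close> yields the exponent 0, so the invariant stays meaningful then.\<close>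
  let ?inv = "\<lambda>A. ?Y \<subseteq> A \<and> sum c A \<le> b \<and>
    \<Phi> A \<le> \<Phi> ?Y * exp (- ((sum c A - sum c ?Y) / B))"
  \<comment> \<open>Stated for any \<open>p\<close> outside \<open>A\<close>, whether or not it
    fits: it serves both the item that greedy adds and the item that overruns the budget.\<close>
  have gap: "\<Phi> (insert p A) \<le> \<Phi> ?Y * exp (- ((sum c (insert p A) - sum c ?Y) / B))"
    if A: "A \<subseteq> V" "?inv A" and p: "p \<in> V" "p \<notin> A"
      and dom: "\<And>x. x \<in> S - A \<Longrightarrow> gain A x * c p \<le> gain A p * c x" and pos: "0 < \<Phi> A" for A p
  proof -
    have finA: "finite A" using A finite_V finite_subset by auto
    have gp: "0 \<le> gain A p" using gain_nonneg A p by auto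
    have "f S \<le> f (A \<union> (S - A))" using S A by (intro mono) auto
    also have "\<dots> \<le> f A + (\<Sum>x\<in>S - A. gain A x)" using S A by (intro f_Un_le) auto
    finally have "\<Phi> A \<le> (\<Sum>x\<in>S - A. gain A x)" by (simp add: \<Phi>_def)
    then have "\<Phi> A * c p \<le> (\<Sum>x\<in>S - A. gain A x) * c p" using c_nonneg p by (intro mult_right_mono) auto
    also have "\<dots> = (\<Sum>x\<in>S - A. gain A x * c p)" by (simp add: sum_distrib_right)
    also have "\<dots> \<le> (\<Sum>x\<in>S - A. gain A p * c x)" using dom by (intro sum_mono) auto
    also have "\<dots> = gain A p * sum c (S - A)" by (simp add: sum_distrib_left)
    also have "\<dots> \<le> gain A p * B"
    proof (rule mult_left_mono[OF _ gp])
      have "sum c (S - A) \<le> sum c (S - ?Y)" using A finS S c_nonneg by (intro sum_mono2) auto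
      then show "sum c (S - A) \<le> B" using costS by simp
    qed
    finally have prog: "\<Phi> A * c p \<le> gain A p * B" .
    have "0 \<le> sum c (S - ?Y)" using S c_nonneg by (intro sum_nonneg) auto
    then have B: "0 \<le> B" using costS by simp
    have \<Phi>': "\<Phi> (insert p A) = \<Phi> A - gain A p" by (simp add: \<Phi>_def gain_def)
    have cost: "sum c (insert p A) = sum c A + c p" using p finA by simp
    have "\<Phi> (insert p A) \<le> \<Phi> A * (1 - c p / B)"
    proof (cases "B = 0")
      case True
      then show ?thesis using gp \<Phi>' by simp
    next
      case False
      then have "\<Phi> A * (c p / B) \<le> gain A p" using prog B by (simp add: pos_divide_le_eq)
      then show ?thesis using \<Phi>' by (simp add: right_diff_distrib)
    qed
    also have "\<dots> \<le> \<Phi> A * exp (- (c p / B))"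
      using exp_ge_add_one_self[of "- (c p / B)"] pos by (intro mult_left_mono) auto
    also have "\<dots> \<le> (\<Phi> ?Y * exp (- ((sum c A - sum c ?Y) / B))) * exp (- (c p / B))"
      using A by (intro mult_right_mono) auto
    also have "\<dots> = \<Phi> ?Y * exp (- ((sum c (insert p A) - sum c ?Y) / B))"
      unfolding cost by (simp add: exp_add[symmetric] add_divide_distrib diff_divide_distrib)
    finally show ?thesis .
  qed
  have step: "\<exists>p. densest (G j) p \<and> G (Suc j) = insert p (G j) \<and> ?inv (G (Suc j))"
    if j: "j < card V" and IH: "?inv (G j)" for j
  proof -
    have subj: "G j \<subseteq> V" using sub j by simp
    have finG: "finite (G j)" using subj finite_V finite_subset by auto
    \<comment> \<open>A seed is already a member, so the value recorded here is that of
      \<open>G j\<close> itself.\<close>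
    have "candidate (G j) y1" using IH by (auto simp: candidate_def)
    then have "f (insert y1 (G j)) \<le> M" using run j by (auto simp: greedy_run_def)
    moreover have "insert y1 (G j) = G j" using IH by auto
    ultimately have fG: "f (G j) \<le> M" by simp
    then have pos: "0 < \<Phi> (G j)" using MS by (simp add: \<Phi>_def)
    have nsub: "\<not> S \<subseteq> G j" using mono[of S "G j"] subj fG MS by auto
    show ?thesis
    proof (cases "\<exists>p. densest (G j) p \<and> G (Suc j) = insert p (G j) \<and>
        (\<forall>x\<in>S - G j. gain (G j) x * c p \<le> gain (G j) p * c x)")
      case True
      then obtain p where p: "densest (G j) p" "G (Suc j) = insert p (G j)"
        and dom: "\<And>x. x \<in> S - G j \<Longrightarrow> gain (G j) x * c p \<le> gain (G j) p * c x" by blast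
      have pV: "p \<in> V" "p \<notin> G j" "sum c (G j) + c p \<le> b" using p by (auto simp: densest_def addable_def)
      have "?inv (G (Suc j))" unfolding p(2) using gap[OF subj IH pV(1,2) dom pos] pV IH finG by auto
      then show ?thesis using p by blast
    next
      case False
      then have "(\<exists>p. densest (G j) p \<and> (\<exists>x\<in>S - G j. gain (G j) p * c x < gain (G j) x * c p)) \<or>
          (\<forall>x. \<not> addable (G j) x)"
        using run j unfolding greedy_run_def greedy_step_def by (meson not_le_imp_less)
      then obtain q where q: "q \<in> S - G j" "b < sum c (G j) + c q"
        "\<And>x. x \<in> S - G j \<Longrightarrow> gain (G j) x * c q \<le> gain (G j) q * c x"
        using blocked_exists[OF subj _ S(1) nsub] IH by blast
      have qV: "q \<in> V" "q \<notin> G j" using q S by auto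
      have "\<Phi> (insert q (G j)) \<le> \<Phi> ?Y * exp (- ((sum c (insert q (G j)) - sum c ?Y) / B))"
        using gap[OF subj IH qV q(3) pos] .
      \<comment> \<open>Since \<open>q\<close> overruns the budget, the cost beyond the seed is at
        least \<open>B\<close>, and the exponent at most -1.\<close>
      also have "\<dots> \<le> \<Phi> ?Y * exp (- 1)"
      proof (rule mult_left_mono)
        have "sum c {q} \<le> sum c (S - ?Y)"
          using q IH finS S c_nonneg by (intro sum_mono2) auto
        then have "0 < B" using costS q(2) IH by simp
        moreover have "B \<le> sum c (insert q (G j)) - sum c ?Y" using q finG by (simp add: B_def)
        ultimately show "exp (- ((sum c (insert q (G j)) - sum c ?Y) / B)) \<le> exp (- 1)" by simp
        show "0 \<le> \<Phi> ?Y" unfolding \<Phi>_def using mono[of ?Y S] y S by auto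
      qed
      finally have "f S - f (insert q (G j)) \<le> (f S - f ?Y) / exp 1"
        by (simp add: \<Phi>_def exp_minus field_simps)
      moreover have "3 * gain (G j) q \<le> f ?Y" using seed[of q "G j"] q subj IH by auto
      then have "f (insert q (G j)) \<le> f (G j) + f ?Y / 3" by (simp add: gain_def)
      \<comment> \<open>Three seeds suffice because \<open>e \<le> 3\<close>: giving back
        \<open>q\<close> costs at most a third of the seed value, and the gap bound is better by the
        share \<open>f ?Y / e\<close>.\<close>
      moreover have "f ?Y / 3 \<le> f ?Y / exp 1"
        using exp_le mono[of "{}" ?Y] YV empty by (intro divide_left_mono) auto
      ultimately have "f S - f S / exp 1 \<le> f (G j)" by (simp add: diff_divide_distrib)
      then have False using fG big by (simp add: algebra_simps)
      then show ?thesis ..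
    qed
  qed
  have "j \<le> card V \<Longrightarrow> ?inv (G j)" for j
  proof (induction j)
    case 0
    have "sum c ?Y \<le> sum c S" using y finS S c_nonneg by (intro sum_mono2) auto
    then show ?case using G0 S by simp
  next
    case (Suc j)
    then show ?case using step[of j] by auto
  qed
  then have "\<exists>p. densest (G j) p \<and> G (Suc j) = insert p (G j)" if "j < card V" for j
    using step[OF that] that by auto
  then have "f V \<le> M" using greedy_run_complete[OF run] G0 YV by simp
  then show False using mono[of S V] S MS by simp
qed

end


section \<open>Shortest paths avoiding a set of nodes\<close>

context mbc_instance
begin

section \<open>Distances and walks of minimal length\<close>

definition walk :: "'a \<Rightarrow> 'a \<Rightarrow> 'a list \<Rightarrow> bool" where
  "walk s t p \<longleftrightarrow> vwalk p (with_proj G) \<and> hd p = s \<and> last p = t"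

definition dist :: "'a \<Rightarrow> 'a \<Rightarrow> nat" where
  "dist s t = (LEAST k. \<exists>p. walk s t p \<and> length p = Suc k)"

text \<open>The paths are shortest in \<open>G\<close>, not in \<open>G\<close> with
  \<open>C\<close> deleted; hence \<open>dist\<close> does not depend on the chosen set.\<close>

definition avoiding :: "'a set \<Rightarrow> 'a \<Rightarrow> 'a \<Rightarrow> nat" where
  "avoiding C s t = card {p \<in> shortest_paths G s t. set p \<inter> C = {}}"

lemma arc_in_verts: "(u, v) \<in> parcs G \<Longrightarrow> u \<in> pverts G \<and> v \<in> pverts G"
  using arc_fst_in_verts arc_snd_in_verts by force

lemma walk_nonempty: "walk s t p \<Longrightarrow> p \<noteq> []"
  by (auto simp: walk_def vwalk_def)

lemma walk_verts: "walk s t p \<Longrightarrow> set p \<subseteq> pverts G"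
  by (auto simp: walk_def vwalk_def)

lemma walk_singleton: "walk s t [v] \<longleftrightarrow> s = v \<and> t = v \<and> v \<in> pverts G"
  by (auto simp: walk_def vwalk_def)

lemma walk_snoc:
  assumes "p \<noteq> []"
  shows "walk s t (p @ [v]) \<longleftrightarrow> t = v \<and> (\<exists>u. walk s u p \<and> (u, v) \<in> parcs G)"
  using assms arc_in_verts
  by (auto simp: walk_def vwalk_def set_vwalk_arcs_snoc arcs_ends_conv hd_append)

lemma walk_exists:
  assumes "s \<in> pverts G" "t \<in> pverts G"
  shows "\<exists>p. walk s t p"
proof -
  have "strongly_connected (with_proj G)"
    using symmetric_connected_imp_strongly_connected pair_sym_arcs connected by blast
  then have "s \<rightarrow>\<^sup>*\<^bsub>with_proj G\<^esub> t"
    using assms by (auto simp: strongly_connected_def)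
  then show ?thesis
  proof (induction rule: reachable_induct)
    case base
    then show ?case using walk_singleton[of s s s] by auto
  next
    case (step x y)
    then obtain p where "walk s x p" by blast
    then have "walk s y (p @ [y])" using step walk_nonempty walk_snoc[of p s y y] by auto
    then show ?case ..
  qed
qed

lemma dist_walk:
  assumes "s \<in> pverts G" "t \<in> pverts G"
  shows "\<exists>p. walk s t p \<and> length p = Suc (dist s t)"
proof -
  obtain p where p: "walk s t p" using walk_exists assms by blast
  then have "length p = Suc (length p - 1)" using walk_nonempty by force
  then show ?thesis unfolding dist_def using p
    by (intro LeastI[of "\<lambda>k. \<exists>p. walk s t p \<and> length p = Suc k"]) blast
qed

lemma dist_le: "walk s t p \<Longrightarrow> length p = Suc k \<Longrightarrow> dist s t \<le> k"
  unfolding dist_def by (rule Least_le) blast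

lemma length_vwalk_to_vpath:
  "length (vwalk_to_vpath p) \<le> length p \<and> (length (vwalk_to_vpath p) = length p \<longrightarrow> distinct p)"
proof (induction p rule: vwalk_to_vpath_induct3)
  case (in_set x xs)
  then have "length (vwalk_to_vpath (x # xs)) \<le> length xs"
    using length_dropWhile_le[of "\<lambda>y. y \<noteq> x" xs] by auto
  then show ?case by auto
qed auto

text \<open>A walk of minimal length is automatically a path, because cutting out a cycle would
  shorten it. Without the distinctness condition the count decomposes along the last arc.\<close>

lemma shortest_paths_eq:
  assumes "s \<in> pverts G" "t \<in> pverts G"
  shows "shortest_paths G s t = {p. walk s t p \<and> length p = Suc (dist s t)}"
proof -
  have path: "vpath p (with_proj G)" if "walk s t p" "length p = Suc (dist s t)" for p
  proof -
    have w: "walk s t (vwalk_to_vpath p)"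
      using that by (auto simp: walk_def vwalk_to_vpath_hd vwalk_to_vpath_last
          intro: vwalk_to_vpath_vpath[THEN vpathE])
    then have "length p \<le> length (vwalk_to_vpath p)"
      using dist_le[OF w, of "length (vwalk_to_vpath p) - 1"] walk_nonempty[OF w] that by (cases "vwalk_to_vpath p") auto
    then show ?thesis using length_vwalk_to_vpath[of p] that by (auto simp: walk_def vpath_def)
  qed
  obtain q where q: "walk s t q" "length q = Suc (dist s t)" using dist_walk assms by blast
  have le: "dist s t \<le> length p - 1" if "walk s t p" for p
    using dist_le[OF that, of "length p - 1"] walk_nonempty[OF that] by (cases p) auto
  have "is_arg_min vwalk_length (\<lambda>q. vpath q (with_proj G) \<and> hd q = s \<and> last q = t) p \<longleftrightarrow>
      walk s t p \<and> length p = Suc (dist s t)" (is "?l = ?r") for p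
  proof
    assume l: ?l
    then have w: "walk s t p" by (auto simp: is_arg_min_def walk_def vpath_def)
    have "\<not> vwalk_length q < vwalk_length p"
      using l path[OF q] q by (auto simp: is_arg_min_def walk_def)
    then show ?r using w le[OF w] q walk_nonempty[OF w] by (cases p) auto
  next
    assume r: ?r
    then show ?l using path[of p] le
      by (auto simp: is_arg_min_def walk_def vpath_def not_less)
  qed
  then show ?thesis by (simp add: shortest_paths_def)
qed

lemma finite_shortest_paths:
  assumes "s \<in> pverts G" "t \<in> pverts G"
  shows "finite (shortest_paths G s t)"
proof (rule finite_subset)
  show "shortest_paths G s t \<subseteq> {p. set p \<subseteq> pverts G \<and> length p = Suc (dist s t)}"
    using walk_verts by (auto simp: shortest_paths_eq[OF assms])
  show "finite {p. set p \<subseteq> pverts G \<and> length p = Suc (dist s t)}"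
    by (rule finite_lists_length_eq[OF pair_finite_verts])
qed

lemma dist_less_card:
  assumes "s \<in> pverts G" "t \<in> pverts G"
  shows "dist s t < card (pverts G)"
proof -
  obtain p where p: "walk s t p" "length p = Suc (dist s t)" using dist_walk assms by blast
  then have "p \<in> shortest_paths G s t" using shortest_paths_eq assms by simp
  then have "distinct p" by (auto simp: shortest_paths_def is_arg_min_def vpath_def)
  then have "length p = card (set p)" by (simp add: distinct_card)
  also have "\<dots> \<le> card (pverts G)" using walk_verts[OF p(1)] pair_finite_verts by (rule card_mono[rotated])
  finally show ?thesis using p by simp
qed

lemma dist_self: "s \<in> pverts G \<Longrightarrow> dist s s = 0"
  using dist_le[of s s "[s]" 0] walk_singleton[of s s s] by simp

lemma dist_eq_0_iff:
  assumes "s \<in> pverts G" "t \<in> pverts G"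
  shows "dist s t = 0 \<longleftrightarrow> s = t"
proof
  assume "dist s t = 0"
  then obtain p where "walk s t p" "length p = Suc 0" using dist_walk assms by metis
  then show "s = t" by (auto simp: length_Suc_conv walk_singleton)
qed (use assms dist_self in simp)

lemma dist_arc_le:
  assumes "s \<in> pverts G" "(u, t) \<in> parcs G"
  shows "dist s t \<le> Suc (dist s u)"
proof -
  obtain p where p: "walk s u p" "length p = Suc (dist s u)" using dist_walk assms arc_in_verts by blast
  then show ?thesis using dist_le[of s t "p @ [t]" "Suc (dist s u)"] walk_snoc[of p s t t] assms walk_nonempty
    by auto
qed

lemma walk_split_last:
  assumes "walk s t p" "length p = Suc (Suc k)"
  obtains q u where "p = q @ [t]" "walk s u q" "length q = Suc k" "(u, t) \<in> parcs G"
proof -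
  obtain q v where qv: "p = q @ [v]" using walk_nonempty[OF assms(1)] by (cases p rule: rev_cases) auto
  then have "q \<noteq> []" using assms by auto
  then show thesis using that walk_snoc[of q s t v] qv assms by auto
qed

lemma dist_triangle:
  assumes "s \<in> pverts G" "u \<in> pverts G" "t \<in> pverts G"
  shows "dist s t \<le> dist s u + dist u t"
proof -
  have "walk u t p \<Longrightarrow> length p = Suc k \<Longrightarrow> dist s t \<le> dist s u + k" for p k
  proof (induction k arbitrary: p t)
    case 0
    then show ?case by (auto simp: length_Suc_conv walk_singleton)
  next
    case (Suc k)
    then obtain q v where qv: "walk u v q" "length q = Suc k" "(v, t) \<in> parcs G"
      by (metis walk_split_last)
    then show ?case using Suc.IH[OF qv(1,2)] dist_arc_le[OF assms(1) qv(3)] by simp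
  qed
  then show ?thesis using dist_walk assms by blast
qed

lemma dist_predecessor:
  assumes "s \<in> pverts G" "t \<in> pverts G" "s \<noteq> t"
  obtains u where "(u, t) \<in> parcs G" "dist s t = Suc (dist s u)"
proof -
  obtain k where k: "dist s t = Suc k" using dist_eq_0_iff assms by (cases "dist s t") auto
  obtain p where "walk s t p" "length p = Suc (dist s t)" using dist_walk assms by blast
  then obtain q u where "walk s u q" "length q = Suc k" "(u, t) \<in> parcs G"
    using k by (metis walk_split_last)
  then show thesis using that dist_le[of s u q k] dist_arc_le[of s u t] assms k by force
qed

text \<open>The rule by which breadth-first search recognizes level \<open>k + 1\<close>: not
  reached up to level \<open>k\<close>, but adjacent to a node on it.\<close>

lemma dist_eq_Suc_iff:
  assumes "s \<in> pverts G" "t \<in> pverts G"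
  shows "dist s t = Suc k \<longleftrightarrow> k < dist s t \<and> (\<exists>u. (u, t) \<in> parcs G \<and> dist s u = k)"
proof
  assume k: "dist s t = Suc k"
  then have "s \<noteq> t" using dist_self assms by auto
  then obtain u where "(u, t) \<in> parcs G" "dist s t = Suc (dist s u)" using dist_predecessor assms by metis
  then show "k < dist s t \<and> (\<exists>u. (u, t) \<in> parcs G \<and> dist s u = k)" using k by auto
next
  assume "k < dist s t \<and> (\<exists>u. (u, t) \<in> parcs G \<and> dist s u = k)"
  then show "dist s t = Suc k" using dist_arc_le[OF assms(1)] by (metis Suc_leI le_antisym)
qed

section \<open>Counting shortest paths that avoid a set\<close>

lemma avoiding_self:
  assumes "s \<in> pverts G"
  shows "avoiding C s s = (if s \<in> C then 0 else 1)"
proof -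
  have "shortest_paths G s s = {[s]}"
    using assms by (auto simp: shortest_paths_eq dist_self length_Suc_conv walk_singleton)
  then show ?thesis by (simp add: avoiding_def card_eq_0_iff cong: conj_cong)
qed

text \<open>Deleting the last node is injective on the paths to \<open>t\<close> and leads to the
  predecessors one level closer; the classes are disjoint because a path determines its last node.
  The sum runs over all nodes with a test, so that recurrences for different sources can be compared
  summand by summand.\<close>

lemma avoiding_rec:
  assumes "s \<in> pverts G" "t \<in> pverts G" "s \<noteq> t"
  shows "avoiding C s t = (if t \<in> C then 0 else
    \<Sum>u\<in>pverts G. if (u, t) \<in> parcs G \<and> dist s t = Suc (dist s u) then avoiding C s u else 0)"
proof (cases "t \<in> C")
  case True
  then have "{p \<in> shortest_paths G s t. set p \<inter> C = {}} = {}"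
    using walk_nonempty last_in_set by (fastforce simp: shortest_paths_eq[OF assms(1,2)] walk_def)
  then show ?thesis using True by (simp only: avoiding_def) simp
next
  case False
  let ?U = "{u \<in> pverts G. (u, t) \<in> parcs G \<and> dist s t = Suc (dist s u)}"
  let ?P = "\<lambda>u. {p \<in> shortest_paths G s u. set p \<inter> C = {}}"
  obtain k where k: "dist s t = Suc k" using dist_eq_0_iff assms by (cases "dist s t") auto
  have eq: "?P t = (\<Union>u\<in>?U. (\<lambda>p. p @ [t]) ` ?P u)"
  proof (intro equalityI subsetI)
    fix p assume p: "p \<in> ?P t"
    then have pw: "walk s t p" "length p = Suc (Suc k)" using shortest_paths_eq assms k by auto
    then obtain q u where q: "p = q @ [t]" "walk s u q" "length q = Suc k" "(u, t) \<in> parcs G"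
      by (metis walk_split_last)
    have u: "u \<in> pverts G" using q arc_in_verts by blast
    have "dist s u = k" using dist_le[OF q(2,3)] dist_arc_le[OF assms(1) q(4)] k by simp
    then have "u \<in> ?U" "q \<in> ?P u" using q u k p shortest_paths_eq assms by auto
    then show "p \<in> (\<Union>u\<in>?U. (\<lambda>p. p @ [t]) ` ?P u)" using q by blast
  next
    fix p assume "p \<in> (\<Union>u\<in>?U. (\<lambda>p. p @ [t]) ` ?P u)"
    then obtain u q where u: "u \<in> ?U" and q: "q \<in> ?P u" and p: "p = q @ [t]" by blast
    then have "walk s u q" "length q = Suc (dist s u)" using shortest_paths_eq assms by auto
    then have "walk s t p" "length p = Suc (dist s t)" using u p walk_snoc[of q s t t] walk_nonempty by auto
    then show "p \<in> ?P t" using p q False shortest_paths_eq assms by auto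
  qed
  have finP: "finite (?P u)" if "u \<in> pverts G" for u using finite_shortest_paths assms that by simp
  have "avoiding C s t = card (\<Union>u\<in>?U. (\<lambda>p. p @ [t]) ` ?P u)" by (simp only: avoiding_def eq)
  also have "\<dots> = (\<Sum>u\<in>?U. card ((\<lambda>p. p @ [t]) ` ?P u))"
  proof (rule card_UN_disjoint)
    show "finite ?U" using pair_finite_verts by simp
    show "\<forall>u\<in>?U. finite ((\<lambda>p. p @ [t]) ` ?P u)" using finP by blast
    have "u = v" if "u \<in> pverts G" "v \<in> pverts G" "q \<in> shortest_paths G s u" "q \<in> shortest_paths G s v" for u v q
      using that shortest_paths_eq assms by (auto simp: walk_def)
    then show "\<forall>u\<in>?U. \<forall>v\<in>?U. u \<noteq> v \<longrightarrow> (\<lambda>p. p @ [t]) ` ?P u \<inter> (\<lambda>p. p @ [t]) ` ?P v = {}"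
      by blast
  qed
  also have "\<dots> = (\<Sum>u\<in>?U. avoiding C s u)"
    by (intro sum.cong refl) (simp add: avoiding_def card_image inj_on_def)
  also have "\<dots> = (\<Sum>u\<in>pverts G. if (u, t) \<in> parcs G \<and> dist s t = Suc (dist s u) then avoiding C s u else 0)"
    using pair_finite_verts by (simp add: sum.inter_filter)
  finally show ?thesis using False by simp
qed

lemma num_paths_avoiding: "num_paths G s t = avoiding {} s t"
  by (simp add: num_paths_def avoiding_def)

lemma num_paths_pos:
  assumes "s \<in> pverts G" "t \<in> pverts G"
  shows "0 < num_paths G s t"
proof -
  have "shortest_paths G s t \<noteq> {}" using dist_walk[OF assms] shortest_paths_eq[OF assms] by auto
  then show ?thesis using finite_shortest_paths[OF assms] by (simp add: num_paths_def card_gt_0_iff)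
qed

lemma avoiding_blocked_target:
  assumes "s \<in> pverts G" "t \<in> pverts G" "t \<in> C"
  shows "avoiding C s t = 0"
proof (cases "s = t")
  case True
  then show ?thesis using avoiding_self assms by simp
next
  case False
  then show ?thesis using avoiding_rec[OF assms(1,2)] assms(3) by simp
qed

lemma avoiding_blocked_source:
  assumes "s \<in> pverts G" "t \<in> pverts G" "s \<in> C"
  shows "avoiding C s t = 0"
proof -
  have "{p \<in> shortest_paths G s t. set p \<inter> C = {}} = {}"
    using walk_nonempty hd_in_set assms by (fastforce simp: shortest_paths_eq[OF assms(1,2)] walk_def)
  then show ?thesis by (simp only: avoiding_def) simp
qed

text \<open>Splitting at \<open>v\<close>, by induction on the distance via the last arc.\<close>

lemma avoiding_insert:
  assumes "s \<in> pverts G" "t \<in> pverts G" "v \<in> pverts G" "v \<notin> C"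
  shows "avoiding C s t = avoiding (insert v C) s t +
    (if dist s v + dist v t = dist s t then avoiding C s v * avoiding C v t else 0)"
  using assms(2)
proof (induction "dist s t" arbitrary: t rule: less_induct)
  case less
  note s = assms(1) and v = assms(3,4) and t = less.prems
  consider "t = v" | "t \<noteq> v" "s = t" | "t \<noteq> v" "s \<noteq> t" by blast
  then show ?case
  proof cases
    case 1
    then show ?thesis using avoiding_blocked_target[of s v "insert v C"] avoiding_self[of v C] s v
      by (simp add: dist_self)
  next
    case 2
    then have "dist s v + dist v t \<noteq> dist s t" using s v(1) t dist_self[of s] dist_eq_0_iff[of s v] by auto
    then show ?thesis using 2 s v by (auto simp: avoiding_self)
  next
    case 3
    show ?thesis
    proof (cases "t \<in> C")
      case True
      then show ?thesis using avoiding_blocked_target s t v by auto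
    next
      case False
      let ?A = "\<lambda>u. (u, t) \<in> parcs G \<and> dist s t = Suc (dist s u)"
      have summand: "(if ?A u then avoiding C s u else 0) = (if ?A u then avoiding (insert v C) s u else 0) +
          (if dist s v + dist v t = dist s t then avoiding C s v *
            (if (u, t) \<in> parcs G \<and> dist v t = Suc (dist v u) then avoiding C v u else 0) else 0)"
        if u: "u \<in> pverts G" for u
      proof (cases "(u, t) \<in> parcs G")
        case arc: True
        note tri = dist_triangle[OF s v(1) u] dist_triangle[OF s v(1) t]
          dist_arc_le[OF s arc] dist_arc_le[OF v(1) arc]
        show ?thesis
        proof (cases "dist s t = Suc (dist s u)")
          case True
          have IH: "avoiding C s u = avoiding (insert v C) s u +
              (if dist s v + dist v u = dist s u then avoiding C s v * avoiding C v u else 0)"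
            using less.hyps[of u] True u by simp
          \<comment> \<open>For a predecessor \<open>u\<close> of \<open>t\<close> seen from
            \<open>s\<close>, \<open>v\<close> lies on a shortest path to \<open>u\<close> exactly
            if it lies on one to \<open>t\<close> and \<open>u\<close> is also a predecessor of
            \<open>t\<close> seen from \<open>v\<close>. The corrections thus add up to the
            recurrence for \<open>avoiding C v t\<close>.\<close>
          have split: "dist s v + dist v u = dist s u \<longleftrightarrow>
              dist s v + dist v t = dist s t \<and> dist v t = Suc (dist v u)"
            by (rule iffI, intro conjI) (use True tri in linarith)+
          have step: "(u, t) \<in> parcs G \<and> dist s t = Suc (dist s u)" using arc True by simp
          show ?thesis unfolding IH split using arc by (simp only: step if_True simp_thms) simp
        next
          case False
          then have "\<not> (dist s v + dist v t = dist s t \<and> dist v t = Suc (dist v u))"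
            using tri by auto
          then show ?thesis using False arc by auto
        qed
      qed auto
      have "avoiding C s t = (\<Sum>u\<in>pverts G. if ?A u then avoiding C s u else 0)"
        using avoiding_rec[OF s t] 3 False by simp
      also have "\<dots> = (\<Sum>u\<in>pverts G. if ?A u then avoiding (insert v C) s u else 0) +
          (if dist s v + dist v t = dist s t then avoiding C s v *
            (\<Sum>u\<in>pverts G. if (u, t) \<in> parcs G \<and> dist v t = Suc (dist v u) then avoiding C v u else 0) else 0)"
        by (simp add: summand sum.distrib sum_distrib_left cong: sum.cong)
      also have "(\<Sum>u\<in>pverts G. if ?A u then avoiding (insert v C) s u else 0) = avoiding (insert v C) s t"
        using avoiding_rec[OF s t, of "insert v C"] 3 False by simp
      also have "(\<Sum>u\<in>pverts G. if (u, t) \<in> parcs G \<and> dist v t = Suc (dist v u) then avoiding C v u else 0) =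
          avoiding C v t"
        using avoiding_rec[OF v(1) t, of C] 3 False by auto
      finally show ?thesis .
    qed
  qed
qed

text \<open>The stretch from \<open>x\<close> to \<open>y\<close> carries no factor; only the two
  outer stretches have to avoid \<open>C\<close>. For \<open>x = y = v\<close> this is the share of
  shortest paths that \<open>v\<close> would newly meet. The other entries are kept because updating
  a diagonal entry calls for them.\<close>

definition weight :: "'a set \<Rightarrow> 'a \<Rightarrow> 'a \<Rightarrow> real" where
  "weight C x y = (\<Sum>s\<in>pverts G. \<Sum>t\<in>pverts G.
     if s \<noteq> t \<and> dist s x + dist x y + dist y t = dist s t
     then real (avoiding C s x) * real (avoiding C y t) / real (num_paths G s t) else 0)"

lemma through_eq:
  assumes "s \<in> pverts G" "t \<in> pverts G"
  shows "real (num_paths_through G C s t) = real (num_paths G s t) - real (avoiding C s t)"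
proof -
  let ?T = "{p \<in> shortest_paths G s t. set p \<inter> C \<noteq> {}}"
  let ?A = "{p \<in> shortest_paths G s t. set p \<inter> C = {}}"
  have "card (?T \<union> ?A) = card ?T + card ?A"
    using finite_shortest_paths[OF assms] by (intro card_Un_disjoint) auto
  also have "?T \<union> ?A = shortest_paths G s t" by blast
  finally have "card (shortest_paths G s t) = card ?T + card ?A" .
  then show ?thesis by (simp add: num_paths_through_def num_paths_def avoiding_def)
qed

lemma gbc_eq:
  "gbc G C = (\<Sum>s\<in>pverts G. \<Sum>t\<in>pverts G.
     if s \<noteq> t then 1 - real (avoiding C s t) / real (num_paths G s t) else 0)"
proof -
  have "gbc G C = (\<Sum>(s, t) \<in> pverts G \<times> pverts G.
      if s \<noteq> t then real (num_paths_through G C s t) / real (num_paths G s t) else 0)"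
    unfolding gbc_def using pair_finite_verts
    by (intro sum.mono_neutral_cong_left) auto
  also have "\<dots> = (\<Sum>s\<in>pverts G. \<Sum>t\<in>pverts G.
      if s \<noteq> t then real (num_paths_through G C s t) / real (num_paths G s t) else 0)"
    by (simp add: sum.cartesian_product)
  also have "\<dots> = (\<Sum>s\<in>pverts G. \<Sum>t\<in>pverts G.
      if s \<noteq> t then 1 - real (avoiding C s t) / real (num_paths G s t) else 0)"
    by (intro sum.cong refl) (simp add: through_eq diff_divide_distrib num_paths_pos[THEN gr_implies_not0])
  finally show ?thesis .
qed

lemma weight_blocked:
  assumes "x \<in> pverts G" "y \<in> pverts G" "x \<in> C \<or> y \<in> C"
  shows "weight C x y = 0"
  unfolding weight_def using assms avoiding_blocked_source avoiding_blocked_target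
  by (intro sum.neutral ballI) auto

lemma gbc_insert:
  assumes v: "v \<in> pverts G"
  shows "gbc G (insert v C) = gbc G C + weight C v v"
proof (cases "v \<in> C")
  case True
  then show ?thesis using weight_blocked[OF v v] by (simp add: insert_absorb)
next
  case False
  have "(if s \<noteq> t then 1 - real (avoiding (insert v C) s t) / real (num_paths G s t) else 0) =
      (if s \<noteq> t then 1 - real (avoiding C s t) / real (num_paths G s t) else 0) +
      (if s \<noteq> t \<and> dist s v + dist v v + dist v t = dist s t
       then real (avoiding C s v) * real (avoiding C v t) / real (num_paths G s t) else 0)"
    if st: "s \<in> pverts G" "t \<in> pverts G" for s t
    using avoiding_insert[OF st v False] dist_self[OF v]
    by (simp add: add_divide_distrib)
  then show ?thesis unfolding gbc_eq weight_def
    by (simp add: sum.distrib[symmetric] cong: sum.cong)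
qed

text \<open>Splitting \<open>avoiding (insert v C) s x\<close> and
  \<open>avoiding (insert v C) y t\<close> at \<open>v\<close> and multiplying out leaves one
  correction per outer stretch; their product vanishes, since a shortest path cannot visit
  \<open>v\<close> both before \<open>x\<close> and after \<open>y\<close>. For
  \<open>x = y = v\<close> both distance tests succeed and the entry would be subtracted twice,
  which \<open>x \<noteq> v\<close> prevents.\<close>

lemma weight_insert:
  assumes v: "v \<in> pverts G" "v \<notin> C" and xy: "x \<in> pverts G" "y \<in> pverts G"
  shows "weight (insert v C) x y = weight C x y
    - (if dist v x + dist x y = dist v y then real (avoiding C v x) * weight C v y else 0)
    - (if x \<noteq> v \<and> dist x y + dist y v = dist x v then real (avoiding C y v) * weight C x v else 0)"
proof (cases "x = v")
  case True
  then show ?thesis using weight_blocked[of v y "insert v C"] v xy avoiding_self[of v C] dist_self[of v] by simp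
next
  case xv: False
  have [simp]: "dist v v = 0" using dist_self v by simp
  have nz: "dist x v \<noteq> 0" "dist v x \<noteq> 0" using dist_eq_0_iff v xy xv by auto
  let ?N = "\<lambda>s t. real (avoiding C s t)"
  let ?P = "\<lambda>s t. real (num_paths G s t)"
  have "(if s \<noteq> t \<and> dist s x + dist x y + dist y t = dist s t
       then real (avoiding (insert v C) s x) * real (avoiding (insert v C) y t) / ?P s t else 0) =
      (if s \<noteq> t \<and> dist s x + dist x y + dist y t = dist s t then ?N s x * ?N y t / ?P s t else 0)
    - (if dist v x + dist x y = dist v y then ?N v x *
        (if s \<noteq> t \<and> dist s v + dist v y + dist y t = dist s t then ?N s v * ?N y t / ?P s t else 0) else 0)
    - (if dist x y + dist y v = dist x v then ?N y v *
        (if s \<noteq> t \<and> dist s x + dist x v + dist v t = dist s t then ?N s x * ?N v t / ?P s t else 0) else 0)"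
    if st: "s \<in> pverts G" "t \<in> pverts G" for s t
  proof -
    note tri = dist_triangle[OF st(1) xy(1) st(2)] dist_triangle[OF st(1) xy(2) st(2)]
      dist_triangle[OF st(1) v(1) st(2)] dist_triangle[OF st(1) xy(1) xy(2)] dist_triangle[OF xy(1) xy(2) st(2)]
      dist_triangle[OF st(1) v(1) xy(1)] dist_triangle[OF xy(2) v(1) st(2)]
      dist_triangle[OF v(1) xy(1) xy(2)] dist_triangle[OF xy(1) xy(2) v(1)]
      dist_triangle[OF v(1) xy(2) st(2)] dist_triangle[OF st(1) xy(1) v(1)]
      dist_triangle[OF st(1) v(1) xy(2)] dist_triangle[OF xy(1) v(1) st(2)]
    have Nsx: "real (avoiding (insert v C) s x) =
        ?N s x - (if dist s v + dist v x = dist s x then ?N s v * ?N v x else 0)"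
      using avoiding_insert[OF st(1) xy(1) v] by simp
    have Nyt: "real (avoiding (insert v C) y t) =
        ?N y t - (if dist y v + dist v t = dist y t then ?N y v * ?N v t else 0)"
      using avoiding_insert[OF xy(2) st(2) v] by simp
    show ?thesis
    proof (cases "dist s x + dist x y + dist y t = dist s t")
      case al: True
      \<comment> \<open>The condition is regrouped: its first part is free of \<open>s\<close> and
        \<open>t\<close> and can be pulled out of the double sum, its second part is the alignment
        in \<open>weight C v y\<close>. The next fact does the same for
        \<open>weight C x v\<close>.\<close>
      have 1: "dist s v + dist v x = dist s x \<longleftrightarrow>
          dist v x + dist x y = dist v y \<and> dist s v + dist v y + dist y t = dist s t"
        by (rule iffI, intro conjI) (use al tri in linarith)+
      have 2: "dist y v + dist v t = dist y t \<longleftrightarrow>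
          dist x y + dist y v = dist x v \<and> dist s x + dist x v + dist v t = dist s t"
        by (rule iffI, intro conjI) (use al tri in linarith)+
      have 3: "\<not> (dist s v + dist v x = dist s x \<and> dist y v + dist v t = dist y t)"
        using al tri nz by linarith
      show ?thesis unfolding Nsx Nyt using al 1 2 3
        by (auto simp: algebra_simps diff_divide_distrib)
    next
      case False
      then have "\<not> (dist v x + dist x y = dist v y \<and> dist s v + dist v y + dist y t = dist s t)"
        "\<not> (dist x y + dist y v = dist x v \<and> dist s x + dist x v + dist v t = dist s t)"
        using tri by linarith+
      then show ?thesis using False by auto
    qed
  qed
  then show ?thesis unfolding weight_def using xv
    by (simp add: sum_subtractf sum_distrib_left cong: sum.cong if_cong)
qed

text \<open>Multiplied by \<open>num_paths G s y\<close> this is Brandes' dependency of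
  \<open>s\<close> on \<open>y\<close>, with end nodes counted. Summing over \<open>t\<close> once
  in advance turns an \<open>n^4\<close> computation of the initial weights into two passes of
  \<open>n^3\<close>.\<close>

definition dependency :: "'a \<Rightarrow> 'a \<Rightarrow> real" where
  "dependency s y = (\<Sum>t\<in>pverts G.
     if s \<noteq> t \<and> dist s y + dist y t = dist s t then real (num_paths G y t) / real (num_paths G s t) else 0)"

lemma weight_empty:
  assumes xy: "x \<in> pverts G" "y \<in> pverts G"
  shows "weight {} x y = (\<Sum>s\<in>pverts G.
    if dist s x + dist x y = dist s y then real (num_paths G s x) * dependency s y else 0)"
  unfolding weight_def
proof (rule sum.cong[OF refl])
  fix s assume s: "s \<in> pverts G"
  have "(if s \<noteq> t \<and> dist s x + dist x y + dist y t = dist s t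
      then real (avoiding {} s x) * real (avoiding {} y t) / real (num_paths G s t) else 0) =
    (if dist s x + dist x y = dist s y then real (num_paths G s x) *
      (if s \<noteq> t \<and> dist s y + dist y t = dist s t then real (num_paths G y t) / real (num_paths G s t) else 0) else 0)"
    if t: "t \<in> pverts G" for t
  proof -
    have "dist s x + dist x y + dist y t = dist s t \<longleftrightarrow>
        dist s x + dist x y = dist s y \<and> dist s y + dist y t = dist s t"
      by (rule iffI, intro conjI) (use dist_triangle[OF s xy] dist_triangle[OF s xy(2) t] in linarith)+
    then show ?thesis by (auto simp: num_paths_avoiding)
  qed
  then show "(\<Sum>t\<in>pverts G. if s \<noteq> t \<and> dist s x + dist x y + dist y t = dist s t
      then real (avoiding {} s x) * real (avoiding {} y t) / real (num_paths G s t) else 0) =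
    (if dist s x + dist x y = dist s y then real (num_paths G s x) * dependency s y else 0)"
    by (simp add: dependency_def sum_distrib_left cong: sum.cong)
qed

section \<open>Betweenness as a monotone submodular function\<close>

lemma gbc_empty: "gbc G {} = 0"
  by (simp add: gbc_def num_paths_through_def)

lemma pverts_nonempty: "pverts G \<noteq> {}"
  using connected by (auto simp: Digraph_Component.connected_def strongly_connected_def)

lemma avoiding_antimono:
  assumes "A \<subseteq> B" "s \<in> pverts G" "t \<in> pverts G"
  shows "avoiding B s t \<le> avoiding A s t"
  unfolding avoiding_def using finite_shortest_paths[OF assms(2,3)] assms(1) by (intro card_mono) auto

text \<open>The gain of \<open>x\<close> is \<open>weight C x x\<close>, and every path count in it
  can only drop as \<open>C\<close> grows.\<close>

lemma submodular_gbc: "submodular (pverts G) (gbc G) c"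
proof
  show "finite (pverts G)" by (rule pair_finite_verts)
  show "pverts G \<noteq> {}" by (rule pverts_nonempty)
  show "gbc G {} = 0" by (rule gbc_empty)
  show "0 \<le> c x" if "x \<in> pverts G" for x using cost_nonneg that by simp
  show "gbc G A \<le> gbc G B" if "A \<subseteq> B" for A B
    unfolding gbc_eq using avoiding_antimono[OF that] by (intro sum_mono) (auto intro!: divide_right_mono)
  show "gbc G (insert x B) - gbc G B \<le> gbc G (insert x A) - gbc G A"
    if AB: "A \<subseteq> B" and x: "x \<in> pverts G" for A B x
  proof -
    have "weight B x x \<le> weight A x x"
      unfolding weight_def using avoiding_antimono[OF AB] x
      by (intro sum_mono) (auto intro!: divide_right_mono mult_mono)
    then show ?thesis using gbc_insert[OF x] by simp
  qed
qed

end


section \<open>Programs built from bounded loops\<close>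

text \<open>The only loop runs its counter from 0 to \<open>n - 1\<close>. Termination is thus built
  in, the final state is a function of the initial one, and the time can be bounded from the program
  text.\<close>

datatype prog =
    PSkip
  | PIAssign name iexp iexp
  | PRAssign name iexp rexp
  | PSeq prog prog
  | PIf bexp prog prog
  | PFor name prog

abbreviation var :: "name \<Rightarrow> iexp" where
  "var x \<equiv> ICell x (ILit 0)"

abbreviation size_of :: "state \<Rightarrow> nat" where
  "size_of s \<equiv> imem s ''n'' 0"

primrec compile :: "prog \<Rightarrow> com" where
  "compile PSkip = Skip"
| "compile (PIAssign a e f) = IAssign a e f"
| "compile (PRAssign a e f) = RAssign a e f"
| "compile (PSeq p q) = Seq (compile p) (compile q)"
| "compile (PIf g p q) = Cond g (compile p) (compile q)"
| "compile (PFor x p) = Seq (IAssign x (ILit 0) (ILit 0))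
     (While (ILess (var x) (var ''n''))
       (Seq (compile p) (IAssign x (ILit 0) (IAdd (var x) (ILit 1)))))"

definition set_imem :: "name \<Rightarrow> nat \<Rightarrow> nat \<Rightarrow> state \<Rightarrow> state" where
  "set_imem a k v s = s\<lparr>imem := (imem s)(a := (imem s a)(k := v))\<rparr>"

definition set_rmem :: "name \<Rightarrow> nat \<Rightarrow> real \<Rightarrow> state \<Rightarrow> state" where
  "set_rmem a k v s = s\<lparr>rmem := (rmem s)(a := (rmem s a)(k := v))\<rparr>"

lemma set_mem_simps [simp]:
  "imem (set_imem a k v s) = (imem s)(a := (imem s a)(k := v))"
  "rmem (set_imem a k v s) = rmem s"
  "imem (set_rmem a k w s) = imem s"
  "rmem (set_rmem a k w s) = (rmem s)(a := (rmem s a)(k := w))"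
  by (simp_all add: set_imem_def set_rmem_def)

text \<open>The state in which the guard is tested after \<open>i\<close> iterations; the counter
  already holds \<open>i\<close>.\<close>

primrec loop :: "name \<Rightarrow> (state \<Rightarrow> state) \<Rightarrow> nat \<Rightarrow> state \<Rightarrow> state" where
  "loop x f 0 s = set_imem x 0 0 s"
| "loop x f (Suc i) s = set_imem x 0 (Suc i) (f (loop x f i s))"

primrec run :: "prog \<Rightarrow> state \<Rightarrow> state" where
  "run PSkip = (\<lambda>s. s)"
| "run (PIAssign a e f) = (\<lambda>s. set_imem a (ival e s) (ival f s) s)"
| "run (PRAssign a e f) = (\<lambda>s. set_rmem a (ival e s) (rval f s) s)"
| "run (PSeq p q) = (\<lambda>s. run q (run p s))"
| "run (PIf g p q) = (\<lambda>s. if bval g s then run p s else run q s)"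
| "run (PFor x p) = (\<lambda>s. loop x (run p) (size_of s) s)"

text \<open>For a loop, 9 is the initialization of the counter (3) plus the final failing test (6),
  and 12 is a successful test (6) plus the increment (6).\<close>

primrec time :: "prog \<Rightarrow> state \<Rightarrow> nat" where
  "time PSkip = (\<lambda>s. 1)"
| "time (PIAssign a e f) = (\<lambda>s. icost e + icost f + 1)"
| "time (PRAssign a e f) = (\<lambda>s. icost e + rcost f + 1)"
| "time (PSeq p q) = (\<lambda>s. time p s + time q (run p s))"
| "time (PIf g p q) = (\<lambda>s. bcost g + 1 + (if bval g s then time p s else time q s))"
| "time (PFor x p) = (\<lambda>s. 9 + (\<Sum>i<size_of s. 12 + time p (loop x (run p) i s)))"

primrec iwrites :: "prog \<Rightarrow> name set" where
  "iwrites PSkip = {}"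
| "iwrites (PIAssign a e f) = {a}"
| "iwrites (PRAssign a e f) = {}"
| "iwrites (PSeq p q) = iwrites p \<union> iwrites q"
| "iwrites (PIf g p q) = iwrites p \<union> iwrites q"
| "iwrites (PFor x p) = insert x (iwrites p)"

primrec rwrites :: "prog \<Rightarrow> name set" where
  "rwrites PSkip = {}"
| "rwrites (PIAssign a e f) = {}"
| "rwrites (PRAssign a e f) = {a}"
| "rwrites (PSeq p q) = rwrites p \<union> rwrites q"
| "rwrites (PIf g p q) = rwrites p \<union> rwrites q"
| "rwrites (PFor x p) = rwrites p"

primrec well_formed :: "prog \<Rightarrow> bool" where
  "well_formed PSkip = True"
| "well_formed (PIAssign a e f) = (a \<noteq> ''n'')"
| "well_formed (PRAssign a e f) = True"
| "well_formed (PSeq p q) = (well_formed p \<and> well_formed q)"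
| "well_formed (PIf g p q) = (well_formed p \<and> well_formed q)"
| "well_formed (PFor x p) = (x \<noteq> ''n'' \<and> x \<notin> iwrites p \<and> well_formed p)"

primrec time_bound :: "prog \<Rightarrow> nat \<Rightarrow> nat" where
  "time_bound PSkip n = 1"
| "time_bound (PIAssign a e f) n = icost e + icost f + 1"
| "time_bound (PRAssign a e f) n = icost e + rcost f + 1"
| "time_bound (PSeq p q) n = time_bound p n + time_bound q n"
| "time_bound (PIf g p q) n = bcost g + 1 + (time_bound p n + time_bound q n)"
| "time_bound (PFor x p) n = 9 + n * (12 + time_bound p n)"

section \<open>Frame conditions and execution of compiled programs\<close>

definition agree :: "name set \<Rightarrow> name set \<Rightarrow> state \<Rightarrow> state \<Rightarrow> bool" where
  "agree X Y s t \<longleftrightarrow> (\<forall>a. a \<notin> X \<longrightarrow> imem t a = imem s a) \<and> (\<forall>a. a \<notin> Y \<longrightarrow> rmem t a = rmem s a)"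

lemma agree_trans: "agree X Y r s \<Longrightarrow> agree X Y s t \<Longrightarrow> agree X Y r t"
  by (simp add: agree_def)

lemma agree_mono: "agree X Y s t \<Longrightarrow> X \<subseteq> X' \<Longrightarrow> Y \<subseteq> Y' \<Longrightarrow> agree X' Y' s t"
  by (auto simp: agree_def)

lemma agree_set_imem: "a \<in> X \<Longrightarrow> agree X Y s (set_imem a k v s)"
  by (simp add: agree_def)

lemma agree_loop:
  assumes "\<And>t. agree X Y t (f t)" "x \<in> X"
  shows "agree X Y s (loop x f i s)"
proof (induction i)
  case 0
  then show ?case using assms by (simp add: agree_set_imem)
next
  case (Suc i)
  then have "agree X Y s (f (loop x f i s))" using assms(1) agree_trans by blast
  then show ?case using agree_trans agree_set_imem[OF assms(2)] by auto
qed

lemma agree_run: "agree (iwrites p) (rwrites p) s (run p s)"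
proof (induction p arbitrary: s)
  case (PSeq p q)
  then show ?case
    by (auto intro: agree_trans[OF agree_mono[OF PSeq.IH(1)] agree_mono[OF PSeq.IH(2)]])
next
  case (PIf g p q)
  then show ?case by (auto intro: agree_mono)
next
  case (PFor x p)
  have "agree (insert x (iwrites p)) (rwrites p) t (run p t)" for t
    using PFor agree_mono by blast
  then show ?case by (auto intro: agree_loop)
qed (auto simp: agree_def)

lemma imem_run: "a \<notin> iwrites p \<Longrightarrow> imem (run p s) a = imem s a"
  using agree_run by (simp add: agree_def)

lemma rmem_run: "a \<notin> rwrites p \<Longrightarrow> rmem (run p s) a = rmem s a"
  using agree_run by (simp add: agree_def)

lemma n_notin_iwrites: "well_formed p \<Longrightarrow> ''n'' \<notin> iwrites p"
  by (induction p) auto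

lemma size_of_run: "well_formed p \<Longrightarrow> size_of (run p s) = size_of s"
  using imem_run n_notin_iwrites by metis

lemma loop_facts:
  assumes "well_formed (PFor x p)"
  shows "imem (loop x (run p) i s) x 0 = i"
    and "agree (insert x (iwrites p)) (rwrites p) s (loop x (run p) i s)"
    and "size_of (loop x (run p) i s) = size_of s"
proof -
  show "imem (loop x (run p) i s) x 0 = i" by (cases i) auto
  have "agree (insert x (iwrites p)) (rwrites p) t (run p t)" for t
    by (rule agree_mono[OF agree_run]) auto
  then show agree: "agree (insert x (iwrites p)) (rwrites p) s (loop x (run p) i s)"
    by (rule agree_loop) simp
  have "''n'' \<notin> insert x (iwrites p)" using assms n_notin_iwrites by auto
  then show "size_of (loop x (run p) i s) = size_of s" using agree by (simp add: agree_def)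
qed

lemma exec_compile: "well_formed p \<Longrightarrow> exec (compile p) s (time p s) (run p s)"
proof (induction p arbitrary: s)
  case PSkip
  then show ?case using exec.Skip by simp
next
  case (PSeq p q)
  then show ?case by (auto intro: exec.Seq)
next
  case (PIAssign a e f)
  then show ?case using exec.IAssign by (simp add: set_imem_def)
next
  case (PRAssign a e f)
  then show ?case using exec.RAssign by (simp add: set_rmem_def)
next
  case (PIf g p q)
  then show ?case using exec.CondTrue[of g s "compile p"] exec.CondFalse[of g s "compile q"]
    by (cases "bval g s") auto
next
  case (PFor x p)
  define n where "n = size_of s"
  let ?g = "ILess (var x) (var ''n'')"
  let ?L = "\<lambda>i. loop x (run p) i s"
  let ?inc = "IAssign x (ILit 0) (IAdd (var x) (ILit 1))"
  let ?body = "Seq (compile p) ?inc"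
  note facts = loop_facts[OF PFor.prems]
  have x: "x \<notin> iwrites p" "well_formed p" using PFor.prems by auto
  \<comment> \<open>\<open>k\<close> counts the iterations still to come, because the rules for
    \<open>While\<close> peel off the first one.\<close>
  have "exec (While ?g ?body) (?L (n - k)) (6 + (\<Sum>i=n - k..<n. 12 + time p (?L i))) (?L n)" if "k \<le> n" for k
    using that
  proof (induction k)
    case 0
    then show ?case using exec.WhileFalse[of ?g "?L n" ?body] facts n_def by (simp add: eval_nat_numeral)
  next
    case (Suc k)
    define i where "i = n - Suc k"
    have i: "i < n" "Suc i = n - k" using Suc.prems i_def by auto
    have "exec ?inc (run p (?L i)) 6 (?L (Suc i))"
      using exec.IAssign[of x "ILit 0" "IAdd (var x) (ILit 1)" "run p (?L i)"] imem_run[OF x(1)] facts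
      by (simp add: set_imem_def eval_nat_numeral)
    then have "exec ?body (?L i) (time p (?L i) + 6) (?L (Suc i))"
      using PFor.IH[OF x(2)] exec.Seq by blast
    moreover have "bval ?g (?L i)" using facts i n_def by simp
    moreover have "exec (While ?g ?body) (?L (Suc i)) (6 + (\<Sum>i=Suc i..<n. 12 + time p (?L i))) (?L n)"
      using Suc i by simp
    ultimately have "exec (While ?g ?body) (?L i)
        (bcost ?g + 1 + (time p (?L i) + 6) + (6 + (\<Sum>i=Suc i..<n. 12 + time p (?L i)))) (?L n)"
      by (intro exec.WhileTrue)
    moreover have "bcost ?g + 1 + (time p (?L i) + 6) + (6 + (\<Sum>i=Suc i..<n. 12 + time p (?L i))) =
        6 + (\<Sum>i=i..<n. 12 + time p (?L i))"
      using i by (simp add: sum.atLeast_Suc_lessThan)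
    ultimately show ?case unfolding i_def[symmetric] by (simp only:)
  qed
  from this[of n] have "exec (While ?g ?body) (?L 0) (6 + (\<Sum>i<n. 12 + time p (?L i))) (?L n)"
    by (simp add: atLeast0LessThan)
  moreover have "exec (IAssign x (ILit 0) (ILit 0)) s 3 (?L 0)"
    using exec.IAssign[of x "ILit 0" "ILit 0" s] by (simp add: set_imem_def eval_nat_numeral)
  ultimately have "exec (Seq (IAssign x (ILit 0) (ILit 0)) (While ?g ?body)) s
      (3 + (6 + (\<Sum>i<n. 12 + time p (?L i)))) (?L n)"
    by (intro exec.Seq)
  then show ?case by (simp add: n_def)
qed

lemma time_le_time_bound: "well_formed p \<Longrightarrow> time p s \<le> time_bound p (size_of s)"
proof (induction p arbitrary: s)
  case (PSeq p q)
  then show ?case using size_of_run[of p s] by (metis add_mono time.simps(4) time_bound.simps(4) well_formed.simps(4))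
next
  case (PIf g p q)
  then show ?case by (auto intro: le_trans trans_le_add1 trans_le_add2)
next
  case (PFor x p)
  have "time p (loop x (run p) i s) \<le> time_bound p (size_of s)" for i
    using PFor.IH[of "loop x (run p) i s"] loop_facts(3)[OF PFor.prems] PFor.prems by simp
  then have "(\<Sum>i<size_of s. 12 + time p (loop x (run p) i s)) \<le> (\<Sum>i<size_of s. 12 + time_bound p (size_of s))"
    by (intro sum_mono) simp
  then show ?case by simp
qed auto

text \<open>\<open>stable\<close> absorbs the writes to the counter, which happen outside
  \<open>p\<close>. The step may also use that only the arrays written by the loop differ from the
  initial state, so facts about all other arrays stay out of the invariant.\<close>

lemma for_invariant:
  assumes wf: "well_formed (PFor x p)" and n: "size_of s = n"
    and stable: "\<And>i k t. I i t \<Longrightarrow> I i (set_imem x 0 k t)"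
    and init: "I 0 s"
    and step: "\<And>i t. i < n \<Longrightarrow> I i t \<Longrightarrow> imem t x 0 = i \<Longrightarrow>
      agree (insert x (iwrites p)) (rwrites p) s t \<Longrightarrow> I (Suc i) (run p t)"
  shows "I n (run (PFor x p) s)"
proof -
  have "i \<le> n \<Longrightarrow> I i (loop x (run p) i s)" for i
    by (induction i) (use init step stable loop_facts[OF wf] in auto)
  then show ?thesis using n by simp
qed

text \<open>Each iteration has its own bound \<open>T i\<close>; this is what lets the search charge
  its inner loop only in the iterations that execute it.\<close>

lemma for_invariant_time:
  assumes wf: "well_formed (PFor x p)" and n: "size_of s = n"
    and stable: "\<And>i k t. I i t \<Longrightarrow> I i (set_imem x 0 k t)"
    and init: "I 0 s"
    and step: "\<And>i t. i < n \<Longrightarrow> I i t \<Longrightarrow> imem t x 0 = i \<Longrightarrow>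
      agree (insert x (iwrites p)) (rwrites p) s t \<Longrightarrow> I (Suc i) (run p t) \<and> time p t \<le> T i"
  shows "I n (run (PFor x p) s)" "time (PFor x p) s \<le> 9 + (\<Sum>i<n. 12 + T i)"
proof -
  have I: "i \<le> n \<Longrightarrow> I i (loop x (run p) i s)" for i
    by (induction i) (use init step stable loop_facts[OF wf] in auto)
  then show "I n (run (PFor x p) s)" using n by simp
  have "time p (loop x (run p) i s) \<le> T i" if "i < n" for i
    using step[OF that I[OF less_imp_le[OF that]]] loop_facts[OF wf] by blast
  then show "time (PFor x p) s \<le> 9 + (\<Sum>i<n. 12 + T i)"
    using n by (auto intro!: sum_mono)
qed

section \<open>Row-major indexing and loops that fill or update arrays\<close>

lemma index_eq_iff: "j < n \<Longrightarrow> j' < n \<Longrightarrow> i * n + j = i' * n + j' \<longleftrightarrow> i = i' \<and> j = j'"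
  for i j n :: nat
  by (metis (no_types) add.commute div_mult_self1 div_less add_0 less_nat_zero_code mod_less mod_mult_self1)

lemma index_less: "i < n \<Longrightarrow> j < n \<Longrightarrow> i * n + j < n * n"
  for i j n :: nat
proof -
  assume "i < n" "j < n"
  then have "i * n + j < Suc i * n" by simp
  also have "\<dots> \<le> n * n" using \<open>i < n\<close> by (intro mult_le_mono1) simp
  finally show ?thesis .
qed

lemma for_fill_imem:
  assumes wf: "well_formed (PFor x p)" and n: "size_of s = n" and a: "a \<noteq> x"
    and step: "\<And>i t. i < n \<Longrightarrow> imem t x 0 = i \<Longrightarrow>
      agree (insert x (iwrites p)) (rwrites p) s t \<Longrightarrow> imem (run p t) a = (imem t a)(i := F i)"
  shows "i < n \<Longrightarrow> imem (run (PFor x p) s) a i = F i"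
proof -
  have "\<forall>i<n. imem (run (PFor x p) s) a i = F i"
    by (rule for_invariant[OF wf n, where I = "\<lambda>k t. \<forall>i<k. imem t a i = F i"])
      (use a step in \<open>auto simp: less_Suc_eq\<close>)
  then show "i < n \<Longrightarrow> imem (run (PFor x p) s) a i = F i" by simp
qed

lemma for_fill_rmem:
  assumes wf: "well_formed (PFor x p)" and n: "size_of s = n"
    and step: "\<And>i t. i < n \<Longrightarrow> imem t x 0 = i \<Longrightarrow>
      agree (insert x (iwrites p)) (rwrites p) s t \<Longrightarrow> rmem (run p t) a = (rmem t a)(i := F i)"
  shows "i < n \<Longrightarrow> rmem (run (PFor x p) s) a i = F i"
proof -
  have "\<forall>i<n. rmem (run (PFor x p) s) a i = F i"
    by (rule for_invariant[OF wf n, where I = "\<lambda>k t. \<forall>i<k. rmem t a i = F i"])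
      (use step in \<open>auto simp: less_Suc_eq\<close>)
  then show "i < n \<Longrightarrow> rmem (run (PFor x p) s) a i = F i" by simp
qed

lemma for_accumulate:
  fixes g :: "nat \<Rightarrow> real"
  assumes wf: "well_formed (PFor x p)" and n: "size_of s = n"
    and step: "\<And>i t. i < n \<Longrightarrow> imem t x 0 = i \<Longrightarrow>
      agree (insert x (iwrites p)) (rwrites p) s t \<Longrightarrow>
      rmem (run p t) a = (rmem t a)(k := rmem t a k + g i)"
  shows "rmem (run (PFor x p) s) a = (rmem s a)(k := rmem s a k + (\<Sum>i<n. g i))"
  by (rule for_invariant[OF wf n, where I = "\<lambda>j t. rmem t a = (rmem s a)(k := rmem s a k + (\<Sum>i<j. g i))"])
    (use step in \<open>auto simp: add.assoc\<close>)

text \<open>The cell about to be written still has its original content, since each cell is written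
  once. This justifies in-place updates in which a new entry depends on its own old value and on
  arrays that the loop leaves alone.\<close>

lemma for_for_update:
  assumes wf: "well_formed (PFor x (PFor y p))" and n: "size_of s = n"
    and step: "\<And>i j t. i < n \<Longrightarrow> j < n \<Longrightarrow> imem t x 0 = i \<Longrightarrow> imem t y 0 = j \<Longrightarrow>
      agree (insert x (insert y (iwrites p))) (rwrites p) s t \<Longrightarrow>
      rmem t a (i * n + j) = rmem s a (i * n + j) \<Longrightarrow>
      rmem (run p t) a = (rmem t a)(i * n + j := F i j)"
  shows "i < n \<Longrightarrow> j < n \<Longrightarrow> rmem (run (PFor x (PFor y p)) s) a (i * n + j) = F i j"
proof -
  define I where "I i j t \<longleftrightarrow> (\<forall>i'<n. \<forall>j'<n. rmem t a (i' * n + j') =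
    (if i' < i \<or> i' = i \<and> j' < j then F i' j' else rmem s a (i' * n + j')))" for i j and t :: state
  have I_set: "I i j (set_imem z k v t) = I i j t" for i j z k v t by (simp add: I_def)
  have "I n 0 (run (PFor x (PFor y p)) s)"
  proof (rule for_invariant[OF wf n, where I = "\<lambda>i. I i 0"])
    show "I 0 0 s" by (simp add: I_def)
    fix i t assume i: "i < n" and t: "I i 0 t" "imem t x 0 = i"
      "agree (insert x (iwrites (PFor y p))) (rwrites (PFor y p)) s t"
    have "I i n (run (PFor y p) t)"
    proof (rule for_invariant)
      show "well_formed (PFor y p)" using wf by simp
      have "''n'' \<notin> insert x (iwrites (PFor y p))" using wf n_notin_iwrites[of "PFor y p"] by auto
      then show "size_of t = n" using t(3) n by (simp add: agree_def)
      show "I i 0 t" by fact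
      fix j r assume j: "j < n" and r: "I i j r" "imem r y 0 = j" "agree (insert y (iwrites p)) (rwrites p) t r"
      have "agree (insert x (insert y (iwrites p))) (rwrites p) s r"
        using t(3) r(3) by (auto simp: agree_def)
      moreover have "imem r x 0 = i" using r(3) t(2) wf by (simp add: agree_def)
      moreover have "rmem r a (i * n + j) = rmem s a (i * n + j)" using r(1) i j by (simp add: I_def)
      ultimately have upd: "rmem (run p r) a = (rmem r a)(i * n + j := F i j)"
        using step i j r(2) by blast
      show "I i (Suc j) (run p r)"
        unfolding I_def
      proof (intro allI impI)
        fix i' j' assume "i' < n" "j' < n"
        then show "rmem (run p r) a (i' * n + j') =
            (if i' < i \<or> i' = i \<and> j' < Suc j then F i' j' else rmem s a (i' * n + j'))"
          using r(1) j by (auto simp: upd index_eq_iff I_def less_Suc_eq)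
      qed
    qed (simp add: I_set)
    then show "I (Suc i) 0 (run (PFor y p) t)" by (auto simp: I_def less_Suc_eq)
  qed (simp add: I_set)
  then show "i < n \<Longrightarrow> j < n \<Longrightarrow> rmem (run (PFor x (PFor y p)) s) a (i * n + j) = F i j"
    by (simp add: I_def)
qed


section \<open>Distances and path counts by breadth-first search\<close>

definition idx :: "name \<Rightarrow> name \<Rightarrow> iexp" where
  "idx x y = IAdd (IMul (var x) (var ''n'')) (var y)"

definition BEq :: "iexp \<Rightarrow> iexp \<Rightarrow> bexp" where
  "BEq e f = BAnd (BNot (ILess e f)) (BNot (ILess f e))"

definition BOr :: "bexp \<Rightarrow> bexp \<Rightarrow> bexp" where
  "BOr g h = BNot (BAnd (BNot g) (BNot h))"

text \<open>
  The array \<open>ds\<close> holds distances increased by 1, so that the initial content 0 means \<open>unreached\<close>.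
\<close>

definition BAligned :: "name \<Rightarrow> name \<Rightarrow> name \<Rightarrow> bexp" where
  "BAligned x y z = BNot (ILess (IAdd (ICell ''ds'' (idx x z)) (ILit 1))
     (IAdd (ICell ''ds'' (idx x y)) (ICell ''ds'' (idx y z))))"

lemma ival_idx [simp]: "ival (idx x y) s = imem s x 0 * size_of s + imem s y 0"
  by (simp add: idx_def)

lemma bval_BEq [simp]: "bval (BEq e f) s \<longleftrightarrow> ival e s = ival f s"
  by (auto simp: BEq_def)

lemma cost_simps [simp]:
  "icost (idx x y) = 8"
  "bcost (BEq e f) = 2 * (icost e + icost f) + 5"
  by (simp_all add: idx_def BEq_def)

lemma bval_BOr [simp]: "bval (BOr g h) s \<longleftrightarrow> bval g s \<or> bval h s"
  by (simp add: BOr_def)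

definition init_prog :: prog where
  "init_prog = PFor ''s'' (PSeq (PIAssign ''ds'' (idx ''s'' ''s'') (ILit 1))
     (PRAssign ''sg0'' (idx ''s'' ''s'') (RLit 1)))"

text \<open>With distances stored plus 1, \<open>l + 2\<close> marks level \<open>l + 1\<close>. The
  second test succeeds both for a node just reached and for one reached earlier from the same level,
  so every predecessor adds its path count.\<close>

definition relax_prog :: prog where
  "relax_prog = PIf (ILess (ILit 0) (ICell ''adj'' (idx ''u'' ''t'')))
     (PSeq
       (PIf (ILess (ICell ''ds'' (idx ''s'' ''t'')) (ILit 1))
         (PIAssign ''ds'' (idx ''s'' ''t'') (IAdd (var ''l'') (ILit 2))) PSkip)
       (PIf (BEq (ICell ''ds'' (idx ''s'' ''t'')) (IAdd (var ''l'') (ILit 2)))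
         (PRAssign ''sg0'' (idx ''s'' ''t'')
           (RAdd (RCell ''sg0'' (idx ''s'' ''t'')) (RCell ''sg0'' (idx ''s'' ''u''))))
         PSkip))
     PSkip"

definition expand_prog :: prog where
  "expand_prog = PIf (BEq (ICell ''ds'' (idx ''s'' ''u'')) (IAdd (var ''l'') (ILit 1)))
     (PFor ''t'' relax_prog) PSkip"

text \<open>Scanning all pairs on every level replaces a queue and keeps all loops of length
  \<open>n\<close>; the test in \<open>expand_prog\<close> lets each pair of source and node pass on
  one level only.\<close>

definition bfs_prog :: prog where
  "bfs_prog = PFor ''l'' (PFor ''s'' (PFor ''u'' expand_prog))"

locale numbered_instance = mbc_instance G c b
  for G :: "nat pair_pre_digraph" and c :: "nat \<Rightarrow> real" and b :: real +
  fixes n :: nat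
  assumes pverts_eq: "pverts G = {..<n}"
begin

lemma n_pos: "0 < n"
  using pverts_nonempty pverts_eq by auto

section \<open>Correctness and cost of the level-by-level search\<close>

definition imat :: "state \<Rightarrow> name \<Rightarrow> (nat \<Rightarrow> nat \<Rightarrow> nat) \<Rightarrow> bool" where
  "imat s a M \<longleftrightarrow> (\<forall>i<n. \<forall>j<n. imem s a (i * n + j) = M i j)"

definition rmat :: "state \<Rightarrow> name \<Rightarrow> (nat \<Rightarrow> nat \<Rightarrow> real) \<Rightarrow> bool" where
  "rmat s a M \<longleftrightarrow> (\<forall>i<n. \<forall>j<n. rmem s a (i * n + j) = M i j)"

definition input_state :: "state \<Rightarrow> bool" where
  "input_state s \<longleftrightarrow> size_of s = n \<and> imat s ''adj'' (\<lambda>i j. if (i, j) \<in> parcs G then 1 else 0)"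

definition relaxed :: "nat \<Rightarrow> nat \<Rightarrow> nat \<Rightarrow> nat \<Rightarrow> nat \<Rightarrow> nat \<Rightarrow> nat \<Rightarrow> bool" where
  "relaxed l s u t s' u' t' \<longleftrightarrow> (s' < s \<or> s' = s \<and> (u' < u \<or> u' = u \<and> t' < t)) \<and>
     (u', t') \<in> parcs G \<and> dist s' u' = l"

text \<open>
  State of the search when level \<open>l\<close> is being expanded and all triples (source, expanded node,
  neighbour) lexicographically before \<open>(s, u, t)\<close> have been treated.
\<close>

definition bfs_inv :: "nat \<Rightarrow> nat \<Rightarrow> nat \<Rightarrow> nat \<Rightarrow> state \<Rightarrow> bool" where
  "bfs_inv l s u t r \<longleftrightarrow>
     imat r ''ds'' (\<lambda>s' t'. if dist s' t' \<le> l then Suc (dist s' t')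
       else if \<exists>u'<n. relaxed l s u t s' u' t' then l + 2 else 0) \<and>
     rmat r ''sg0'' (\<lambda>s' t'. if dist s' t' \<le> l then real (num_paths G s' t')
       else \<Sum>u'<n. if relaxed l s u t s' u' t' then real (num_paths G s' u') else 0)"

lemma bfs_inv_set: "bfs_inv l s u t (set_imem x k v r) = bfs_inv l s u t r" if "x \<noteq> ''ds''"
  using that by (simp add: bfs_inv_def imat_def rmat_def)

lemma bfs_inv_stable:
  "bfs_inv l s u t r \<Longrightarrow> bfs_inv l s u t (set_imem ''u'' 0 k r)"
  "bfs_inv l s u t r \<Longrightarrow> bfs_inv l s u t (set_imem ''s'' 0 k r)"
  "bfs_inv l s u t r \<Longrightarrow> bfs_inv l s u t (set_imem ''l'' 0 k r)"
  by (simp_all add: bfs_inv_set)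

lemma arc_less: "(u, t) \<in> parcs G \<Longrightarrow> u < n \<and> t < n"
  using arc_in_verts pverts_eq by auto

lemma bfs_relax:
  assumes inv: "bfs_inv l s u t r" and input: "input_state r"
    and less: "s < n" "u < n" "t < n" and dist: "dist s u = l"
    and vars: "imem r ''l'' 0 = l" "imem r ''s'' 0 = s" "imem r ''u'' 0 = u" "imem r ''t'' 0 = t"
  shows "bfs_inv l s u (Suc t) (run relax_prog r)"
proof -
  have verts: "s \<in> pverts G" "u \<in> pverts G" "t \<in> pverts G" using less pverts_eq by auto
  have adj: "imem r ''adj'' (u * n + t) = (if (u, t) \<in> parcs G then 1 else 0)" and size: "size_of r = n"
    using input less by (auto simp: input_state_def imat_def)
  have ds: "imem r ''ds'' (s' * n + t') = (if dist s' t' \<le> l then Suc (dist s' t')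
       else if \<exists>u'<n. relaxed l s u t s' u' t' then l + 2 else 0)"
    and sg: "rmem r ''sg0'' (s' * n + t') = (if dist s' t' \<le> l then real (num_paths G s' t')
       else \<Sum>u'<n. if relaxed l s u t s' u' t' then real (num_paths G s' u') else 0)"
    if "s' < n" "t' < n" for s' t'
    using inv that by (auto simp: bfs_inv_def imat_def rmat_def)
  have relaxed_Suc: "relaxed l s u (Suc t) s' u' t' \<longleftrightarrow> relaxed l s u t s' u' t' \<or>
      s' = s \<and> u' = u \<and> t' = t \<and> (u, t) \<in> parcs G" for s' u' t'
    using dist by (auto simp: relaxed_def less_Suc_eq)
  have not_yet: "\<not> relaxed l s u t s u t" by (simp add: relaxed_def)
  show ?thesis
  proof (cases "(u, t) \<in> parcs G \<and> l < dist s t")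
    case False
    have "run relax_prog r = r"
    proof (cases "(u, t) \<in> parcs G")
      case True
      then have "imem r ''ds'' (s * n + t) = Suc (dist s t)" "dist s t \<le> l" using False ds less by auto
      then show ?thesis by (simp add: relax_prog_def vars size)
    qed (simp add: relax_prog_def vars size adj)
    moreover have "bfs_inv l s u (Suc t) r"
      unfolding bfs_inv_def imat_def rmat_def relaxed_Suc using False not_yet
      by (auto simp: ds sg intro!: sum.cong)
    ultimately show ?thesis by simp
  next
    case True
    let ?v = "rmem r ''sg0'' (s * n + t) + real (num_paths G s u)"
    \<comment> \<open>The target is either unreached or already marked for the next level, and both
      cases end with the same cell content. The count stored for \<open>u\<close> is final, because
      \<open>u\<close> lies on level \<open>l\<close>.\<close>
    have cell: "imem r ''ds'' (s * n + t) \<in> {0, l + 2}" using ds[of s t] less True by auto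
    have su: "rmem r ''sg0'' (s * n + u) = real (num_paths G s u)" using sg[of s u] less dist by simp
    have ds': "imem (run relax_prog r) ''ds'' = (imem r ''ds'')(s * n + t := l + 2)"
      and sg': "rmem (run relax_prog r) ''sg0'' = (rmem r ''sg0'')(s * n + t := ?v)"
      using cell True by (auto simp: relax_prog_def vars size adj su)
    have sum: "(\<Sum>u'<n. if relaxed l s u (Suc t) s u' t then real (num_paths G s u') else 0) =
        (\<Sum>u'<n. if relaxed l s u t s u' t then real (num_paths G s u') else 0) + real (num_paths G s u)"
    proof -
      have "(if relaxed l s u (Suc t) s u' t then real (num_paths G s u') else 0) =
          (if relaxed l s u t s u' t then real (num_paths G s u') else 0) +
          (if u' = u then real (num_paths G s u) else 0)" for u'
        using True not_yet by (auto simp: relaxed_Suc)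
      then show ?thesis using less by (simp add: sum.distrib)
    qed
    have "imat (run relax_prog r) ''ds'' (\<lambda>s' t'. if dist s' t' \<le> l then Suc (dist s' t')
        else if \<exists>u'<n. relaxed l s u (Suc t) s' u' t' then l + 2 else 0)"
      unfolding imat_def
    proof (intro allI impI)
      fix i j assume ij: "i < n" "j < n"
      show "imem (run relax_prog r) ''ds'' (i * n + j) = (if dist i j \<le> l then Suc (dist i j)
        else if \<exists>u'<n. relaxed l s u (Suc t) i u' j then l + 2 else 0)"
      proof (cases "i = s \<and> j = t")
        case c: True
        then show ?thesis using True less by (auto simp: ds' relaxed_Suc)
      next
        case c: False
        then show ?thesis using ij less by (auto simp: ds' index_eq_iff ds relaxed_Suc)
      qed
    qed
    moreover have "rmat (run relax_prog r) ''sg0'' (\<lambda>s' t'. if dist s' t' \<le> l then real (num_paths G s' t')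
        else \<Sum>u'<n. if relaxed l s u (Suc t) s' u' t' then real (num_paths G s' u') else 0)"
      unfolding rmat_def
    proof (intro allI impI)
      fix i j assume ij: "i < n" "j < n"
      show "rmem (run relax_prog r) ''sg0'' (i * n + j) = (if dist i j \<le> l then real (num_paths G i j)
        else \<Sum>u'<n. if relaxed l s u (Suc t) i u' j then real (num_paths G i u') else 0)"
      proof (cases "i = s \<and> j = t")
        case c: True
        then have eq: "i = s" "j = t" by auto
        show ?thesis unfolding eq using True less by (simp add: sg' sum sg[of s t])
      next
        case c: False
        then have "relaxed l s u (Suc t) i u' j = relaxed l s u t i u' j" for u' by (auto simp: relaxed_Suc)
        then show ?thesis using c ij less by (auto simp: sg' index_eq_iff sg)
      qed
    qed
    ultimately show ?thesis by (simp add: bfs_inv_def)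
  qed
qed

lemma well_formed_bfs: "well_formed bfs_prog" "well_formed (PFor ''t'' relax_prog)" "well_formed expand_prog"
  "well_formed (PFor ''u'' expand_prog)" "well_formed (PFor ''s'' (PFor ''u'' expand_prog))"
  by (simp_all add: bfs_prog_def expand_prog_def relax_prog_def)

lemma iwrites_bfs: "iwrites relax_prog = {''ds''}" "iwrites expand_prog = {''t'', ''ds''}"
    "rwrites relax_prog = {''sg0''}" "rwrites expand_prog = {''sg0''}"
  by (auto simp: expand_prog_def relax_prog_def)

lemma input_state_agree: "agree X Y r r' \<Longrightarrow> ''n'' \<notin> X \<Longrightarrow> ''adj'' \<notin> X \<Longrightarrow> input_state r' = input_state r"
  by (simp add: agree_def input_state_def imat_def)

text \<open>The constant 100 generously covers the test and the skipped branch. The loop over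
  \<open>t\<close> is charged only if \<open>u\<close> is on the current level, which is the source
  of the cubic bound.\<close>

lemma bfs_expand:
  assumes inv: "bfs_inv l s u 0 r" and input: "input_state r"
    and less: "s < n" "u < n"
    and vars: "imem r ''l'' 0 = l" "imem r ''s'' 0 = s" "imem r ''u'' 0 = u"
  shows "bfs_inv l s (Suc u) 0 (run expand_prog r) \<and>
    time expand_prog r \<le> 100 + (if dist s u = l then time_bound (PFor ''t'' relax_prog) n else 0)"
proof -
  have size: "size_of r = n" using input by (simp add: input_state_def)
  have ds: "imem r ''ds'' (s * n + u) = (if dist s u \<le> l then Suc (dist s u)
       else if \<exists>u'<n. relaxed l s u 0 s u' u then l + 2 else 0)"
    using inv less by (simp add: bfs_inv_def imat_def)
  \<comment> \<open>All other contents are at most \<open>l\<close>, or equal to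
    \<open>l + 2\<close>.\<close>
  then have guard: "imem r ''ds'' (s * n + u) = l + 1 \<longleftrightarrow> dist s u = l" by auto
  show ?thesis
  proof (cases "dist s u = l")
    case False
    have eq: "relaxed l s (Suc u) 0 s' u' t' = relaxed l s u 0 s' u' t'" for s' u' t'
      using False by (auto simp: relaxed_def less_Suc_eq)
    have "bfs_inv l s (Suc u) 0 r" using inv unfolding bfs_inv_def eq .
    then show ?thesis using False guard by (simp add: expand_prog_def vars size)
  next
    case True
    have "bfs_inv l s u n (run (PFor ''t'' relax_prog) r)"
    proof (rule for_invariant[OF well_formed_bfs(2) size, where I = "bfs_inv l s u"])
      fix t r' assume t: "t < n" "bfs_inv l s u t r'" "imem r' ''t'' 0 = t"
        and agree: "agree (insert ''t'' (iwrites relax_prog)) (rwrites relax_prog) r r'"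
      have "input_state r'" using input_state_agree[OF agree] input by (simp add: iwrites_bfs)
      moreover have "imem r' ''l'' 0 = l" "imem r' ''s'' 0 = s" "imem r' ''u'' 0 = u"
        using agree vars by (simp_all add: agree_def iwrites_bfs)
      ultimately show "bfs_inv l s u (Suc t) (run relax_prog r')"
        using bfs_relax t less True by blast
    qed (use inv in \<open>simp_all add: bfs_inv_set\<close>)
    moreover have eq: "relaxed l s (Suc u) 0 s' u' t' = relaxed l s u n s' u' t'" for s' u' t'
      using arc_less by (auto simp: relaxed_def less_Suc_eq)
    ultimately have "bfs_inv l s (Suc u) 0 (run (PFor ''t'' relax_prog) r)" unfolding bfs_inv_def eq by simp
    moreover have "time (PFor ''t'' relax_prog) r \<le> time_bound (PFor ''t'' relax_prog) n"
      using time_le_time_bound[OF well_formed_bfs(2), of r] size by simp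
    ultimately show ?thesis using True guard
      by (simp add: expand_prog_def vars size del: time.simps(6) run.simps(6) time_bound.simps(6))
  qed
qed

text \<open>No instruction separates two levels; the same memory is read differently. After all
  sources have been treated, the marked cells are exactly those at distance \<open>l + 1\<close>,
  and their partial sums are complete by \<open>avoiding_rec\<close>.\<close>

lemma bfs_level:
  assumes inv: "bfs_inv l n 0 0 r"
  shows "bfs_inv (Suc l) 0 0 0 r"
proof -
  have relaxed0: "\<not> relaxed (Suc l) 0 0 0 s' u' t'" for s' u' t' by (simp add: relaxed_def)
  have level: "(\<exists>u'<n. relaxed l n 0 0 i u' j) \<longleftrightarrow> dist i j = Suc l"
    if "i < n" "j < n" "l < dist i j" for i j
    using that dist_eq_Suc_iff[of i j l] pverts_eq arc_less by (auto simp: relaxed_def)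
  have count: "(\<Sum>u'<n. if relaxed l n 0 0 i u' j then real (num_paths G i u') else 0) =
      (if dist i j = Suc l then real (num_paths G i j) else 0)"
    if ij: "i < n" "j < n" "l < dist i j" for i j
  proof (cases "dist i j = Suc l")
    case True
    have V: "i \<in> pverts G" "j \<in> pverts G" "i \<noteq> j" using ij dist_self[of i] by (auto simp: pverts_eq)
    have "real (num_paths G i j) =
        (\<Sum>u<n. if (u, j) \<in> parcs G \<and> dist i j = Suc (dist i u) then real (num_paths G i u) else 0)"
      using avoiding_rec[OF V, of "{}"] pverts_eq
      by (simp add: num_paths_avoiding if_distrib[of real] cong: if_cong)
    also have "\<dots> = (\<Sum>u'<n. if relaxed l n 0 0 i u' j then real (num_paths G i u') else 0)"
      using True ij by (intro sum.cong) (auto simp: relaxed_def)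
    finally show ?thesis using True by simp
  next
    case False
    then show ?thesis using level[OF ij] by (auto intro!: sum.neutral)
  qed
  show ?thesis
    using inv level count unfolding bfs_inv_def imat_def rmat_def
    by (auto simp: relaxed0 le_Suc_eq not_le less_Suc_eq)
qed

lemma bfs_correct:
  assumes inv: "bfs_inv 0 0 0 0 r" and input: "input_state r"
  shows "bfs_inv n 0 0 0 (run bfs_prog r)"
    and "time bfs_prog r \<le> 9 + (\<Sum>l<n. 12 + (9 + (\<Sum>s<n. 12 + (9 + (\<Sum>u<n. 12 +
      (100 + (if dist s u = l then time_bound (PFor ''t'' relax_prog) n else 0)))))))"
proof -
  let ?K = "\<lambda>l s u. 100 + (if dist s u = l then time_bound (PFor ''t'' relax_prog) n else 0)"
  have size: "size_of r = n" using input by (simp add: input_state_def)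
  have outer: "bfs_inv (Suc l) 0 0 0 (run (PFor ''s'' (PFor ''u'' expand_prog)) r1) \<and>
      time (PFor ''s'' (PFor ''u'' expand_prog)) r1 \<le> 9 + (\<Sum>s<n. 12 + (9 + (\<Sum>u<n. 12 + ?K l s u)))"
    if l: "bfs_inv l 0 0 0 r1" "imem r1 ''l'' 0 = l" "input_state r1" for l r1
  proof -
    have size1: "size_of r1 = n" using l by (simp add: input_state_def)
    have mid: "bfs_inv l (Suc s) 0 0 (run (PFor ''u'' expand_prog) r2) \<and>
        time (PFor ''u'' expand_prog) r2 \<le> 9 + (\<Sum>u<n. 12 + ?K l s u)"
      if s: "s < n" "bfs_inv l s 0 0 r2" "imem r2 ''s'' 0 = s" "imem r2 ''l'' 0 = l" "input_state r2" for s r2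
    proof -
      have size2: "size_of r2 = n" using s by (simp add: input_state_def)
      have step: "bfs_inv l s (Suc u) 0 (run expand_prog r3) \<and> time expand_prog r3 \<le> ?K l s u"
        if u: "u < n" "bfs_inv l s u 0 r3" "imem r3 ''u'' 0 = u"
          and agree: "agree (insert ''u'' (iwrites expand_prog)) (rwrites expand_prog) r2 r3" for u r3
      proof -
        have "input_state r3" using input_state_agree[OF agree] s by (simp add: iwrites_bfs)
        moreover have "imem r3 ''l'' 0 = l" "imem r3 ''s'' 0 = s"
          using agree s by (simp_all add: agree_def iwrites_bfs)
        ultimately show ?thesis using bfs_expand[OF u(2) _ s(1) u(1)] u(3) by simp
      qed
      have "bfs_inv l s n 0 (run (PFor ''u'' expand_prog) r2)"
        "time (PFor ''u'' expand_prog) r2 \<le> 9 + (\<Sum>u<n. 12 + ?K l s u)"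
        using for_invariant_time[OF well_formed_bfs(4) size2, where I = "\<lambda>u. bfs_inv l s u 0", OF bfs_inv_stable(1) s(2) step]
        by blast+
      \<comment> \<open>A lexicographic carry: having passed all nodes for source \<open>s\<close>
        means standing before the first node of source \<open>s + 1\<close>.\<close>
      moreover have "relaxed l s n 0 s' u' t' = relaxed l (Suc s) 0 0 s' u' t'" for s' u' t'
        using arc_less by (auto simp: relaxed_def less_Suc_eq)
      then have "relaxed l s n 0 = relaxed l (Suc s) 0 0" by blast
      then have "bfs_inv l s n 0 r = bfs_inv l (Suc s) 0 0 r" for r by (simp only: bfs_inv_def)
      ultimately show ?thesis by blast
    qed
    have step: "bfs_inv l (Suc s) 0 0 (run (PFor ''u'' expand_prog) r2) \<and>
        time (PFor ''u'' expand_prog) r2 \<le> 9 + (\<Sum>u<n. 12 + ?K l s u)"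
      if u: "s < n" "bfs_inv l s 0 0 r2" "imem r2 ''s'' 0 = s"
        and agree: "agree (insert ''s'' (iwrites (PFor ''u'' expand_prog))) (rwrites (PFor ''u'' expand_prog)) r1 r2"
      for s r2
    proof -
      have "input_state r2" using input_state_agree[OF agree] l by (simp add: iwrites_bfs)
      moreover have "imem r2 ''l'' 0 = l"
        using agree l by (simp add: agree_def iwrites_bfs)
      ultimately show ?thesis using mid u by blast
    qed
    have "bfs_inv l n 0 0 (run (PFor ''s'' (PFor ''u'' expand_prog)) r1)"
      "time (PFor ''s'' (PFor ''u'' expand_prog)) r1 \<le> 9 + (\<Sum>s<n. 12 + (9 + (\<Sum>u<n. 12 + ?K l s u)))"
      using for_invariant_time[OF well_formed_bfs(5) size1, where I = "\<lambda>s. bfs_inv l s 0 0", OF bfs_inv_stable(2) l(1) step]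
      by blast+
    then show ?thesis using bfs_level by blast
  qed
  have step: "bfs_inv (Suc l) 0 0 0 (run (PFor ''s'' (PFor ''u'' expand_prog)) r1) \<and>
      time (PFor ''s'' (PFor ''u'' expand_prog)) r1 \<le> 9 + (\<Sum>s<n. 12 + (9 + (\<Sum>u<n. 12 + ?K l s u)))"
    if u: "l < n" "bfs_inv l 0 0 0 r1" "imem r1 ''l'' 0 = l"
      and agree: "agree (insert ''l'' (iwrites (PFor ''s'' (PFor ''u'' expand_prog))))
        (rwrites (PFor ''s'' (PFor ''u'' expand_prog))) r r1"
    for l r1
  proof -
    have "input_state r1" using input_state_agree[OF agree] input by (simp add: iwrites_bfs)
    then show ?thesis using outer u by blast
  qed
  show "bfs_inv n 0 0 0 (run bfs_prog r)"
    and "time bfs_prog r \<le> 9 + (\<Sum>l<n. 12 + (9 + (\<Sum>s<n. 12 + (9 + (\<Sum>u<n. 12 + ?K l s u)))))"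
    unfolding bfs_prog_def
    using for_invariant_time[OF well_formed_bfs(1)[unfolded bfs_prog_def] size,
        where I = "\<lambda>l. bfs_inv l 0 0 0", OF bfs_inv_stable(3) inv step]
    by blast+
qed

end


section \<open>Maintaining the gains of all nodes\<close>

declare run.simps(6) [simp del] time.simps(6) [simp del]

text \<open>
  Memory layout: \<open>sg0\<close>, \<open>dd0\<close> hold the matrices \<open>avoiding C\<close> and \<open>weight C\<close> for \<open>C = {}\<close>, and \<open>sg\<close>, \<open>dd\<close>
  those for the current set, whose characteristic vector, value and cost are \<open>in\<close>, \<open>val\<close>, \<open>spent\<close>.
  The best set met so far is \<open>out\<close>, of value \<open>best\<close>, and \<open>v\<close> is the node to be added next. The
  updates work on copies of the rows and columns of \<open>v\<close>, which they overwrite.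
\<close>

definition dependency_prog :: prog where
  "dependency_prog = PFor ''s'' (PFor ''y'' (PFor ''t''
     (PIf (BAnd (BNot (BEq (var ''s'') (var ''t''))) (BAligned ''s'' ''y'' ''t''))
       (PRAssign ''ee'' (idx ''s'' ''y'') (RAdd (RCell ''ee'' (idx ''s'' ''y''))
         (RDiv (RCell ''sg0'' (idx ''y'' ''t'')) (RCell ''sg0'' (idx ''s'' ''t'')))))
       PSkip)))"

definition weight_prog :: prog where
  "weight_prog = PFor ''x'' (PFor ''y'' (PFor ''s''
     (PIf (BAligned ''s'' ''x'' ''y'')
       (PRAssign ''dd0'' (idx ''x'' ''y'') (RAdd (RCell ''dd0'' (idx ''x'' ''y''))
         (RMul (RCell ''sg0'' (idx ''s'' ''x'')) (RCell ''ee'' (idx ''s'' ''y'')))))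
       PSkip)))"

definition reset_prog :: prog where
  "reset_prog = PSeq (PFor ''x'' (PIAssign ''in'' (var ''x'') (ILit 0)))
    (PSeq (PFor ''x'' (PFor ''y'' (PRAssign ''sg'' (idx ''x'' ''y'') (RCell ''sg0'' (idx ''x'' ''y'')))))
    (PSeq (PFor ''x'' (PFor ''y'' (PRAssign ''dd'' (idx ''x'' ''y'') (RCell ''dd0'' (idx ''x'' ''y'')))))
    (PSeq (PRAssign ''val'' (ILit 0) (RLit 0)) (PRAssign ''spent'' (ILit 0) (RLit 0)))))"

abbreviation rvar :: "name \<Rightarrow> rexp" where
  "rvar x \<equiv> RCell x (ILit 0)"

definition BFits :: "name \<Rightarrow> bexp" where
  "BFits x = BNot (RLess (rvar ''budget'') (RAdd (rvar ''spent'') (RCell ''cost'' (var x))))"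

definition BAddable :: "name \<Rightarrow> bexp" where
  "BAddable x = BAnd (ILess (ICell ''in'' (var x)) (ILit 1)) (BFits x)"

definition copy_prog :: prog where
  "copy_prog = PFor ''x''
    (PSeq (PRAssign ''nrow'' (var ''x'') (RCell ''sg'' (idx ''v'' ''x'')))
    (PSeq (PRAssign ''ncol'' (var ''x'') (RCell ''sg'' (idx ''x'' ''v'')))
    (PSeq (PRAssign ''drow'' (var ''x'') (RCell ''dd'' (idx ''v'' ''x'')))
      (PRAssign ''dcol'' (var ''x'') (RCell ''dd'' (idx ''x'' ''v''))))))"

definition update_sg_prog :: prog where
  "update_sg_prog = PFor ''x'' (PFor ''y'' (PIf (BAligned ''x'' ''v'' ''y'')
     (PRAssign ''sg'' (idx ''x'' ''y'') (RSub (RCell ''sg'' (idx ''x'' ''y''))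
       (RMul (RCell ''ncol'' (var ''x'')) (RCell ''nrow'' (var ''y'')))))
     PSkip))"

definition update_dd_prog :: prog where
  "update_dd_prog = PFor ''x'' (PFor ''y'' (PSeq
     (PIf (BAligned ''v'' ''x'' ''y'')
       (PRAssign ''dd'' (idx ''x'' ''y'') (RSub (RCell ''dd'' (idx ''x'' ''y''))
         (RMul (RCell ''nrow'' (var ''x'')) (RCell ''drow'' (var ''y'')))))
       PSkip)
     (PIf (BAnd (BNot (BEq (var ''x'') (var ''v''))) (BAligned ''x'' ''y'' ''v''))
       (PRAssign ''dd'' (idx ''x'' ''y'') (RSub (RCell ''dd'' (idx ''x'' ''y''))
         (RMul (RCell ''ncol'' (var ''y'')) (RCell ''dcol'' (var ''x'')))))
       PSkip)))"

definition add_prog :: prog where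
  "add_prog = PIf (BAddable ''v'')
    (PSeq (PRAssign ''val'' (ILit 0) (RAdd (rvar ''val'') (RCell ''dd'' (idx ''v'' ''v''))))
    (PSeq (PRAssign ''spent'' (ILit 0) (RAdd (rvar ''spent'') (RCell ''cost'' (var ''v''))))
    (PSeq (PIAssign ''in'' (var ''v'') (ILit 1))
    (PSeq copy_prog (PSeq update_sg_prog update_dd_prog)))))
    PSkip"

text \<open>For a node \<open>w\<close> already in the set the diagonal entry is 0, so the same code
  records the current set itself.\<close>

definition record_prog :: prog where
  "record_prog = PIf (RLess (rvar ''best'') (RAdd (rvar ''val'') (RCell ''dd'' (idx ''w'' ''w''))))
    (PSeq (PRAssign ''best'' (ILit 0) (RAdd (rvar ''val'') (RCell ''dd'' (idx ''w'' ''w''))))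
    (PSeq (PFor ''x'' (PIAssign ''out'' (var ''x'') (ICell ''in'' (var ''x''))))
      (PIAssign ''out'' (var ''w'') (ILit 1))))
    PSkip"

text \<open>No flag records whether a node has been selected yet: an unaddable \<open>v\<close> is simply replaced.\<close>

definition select_prog :: prog where
  "select_prog = PIf (BAnd (ILess (ICell ''in'' (var ''w'')) (ILit 1)) (BOr (BNot (BAddable ''v''))
      (RLess (RMul (RCell ''dd'' (idx ''v'' ''v'')) (RCell ''cost'' (var ''w'')))
        (RMul (RCell ''dd'' (idx ''w'' ''w'')) (RCell ''cost'' (var ''v''))))))
    (PIAssign ''v'' (ILit 0) (var ''w'')) PSkip"

definition scan_prog :: prog where
  "scan_prog = PFor ''w'' (PIf (BOr (ILess (ILit 0) (ICell ''in'' (var ''w''))) (BFits ''w''))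
     (PSeq record_prog select_prog) PSkip)"

definition greedy_prog :: prog where
  "greedy_prog = PFor ''i'' (PSeq scan_prog add_prog)"

text \<open>\<open>add_prog\<close> ignores a node that is present or does not fit. Triples with
  repetitions or of excessive cost therefore also start a run on a feasible set.\<close>

definition seeded_prog :: prog where
  "seeded_prog = PSeq reset_prog
    (PSeq (PIAssign ''v'' (ILit 0) (var ''p'')) (PSeq add_prog
    (PSeq (PIAssign ''v'' (ILit 0) (var ''q'')) (PSeq add_prog
    (PSeq (PIAssign ''v'' (ILit 0) (var ''r'')) (PSeq add_prog greedy_prog))))))"

definition preprocess_prog :: prog where
  "preprocess_prog = PSeq dependency_prog weight_prog"

definition single_prog :: prog where
  "single_prog = PSeq preprocess_prog (PSeq reset_prog greedy_prog)"

definition triple_prog :: prog where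
  "triple_prog = PSeq preprocess_prog (PFor ''p'' (PFor ''q'' (PFor ''r'' seeded_prog)))"

lemmas loop_prog_defs = dependency_prog_def weight_prog_def reset_prog_def BFits_def BAddable_def copy_prog_def
  update_sg_prog_def update_dd_prog_def add_prog_def record_prog_def select_prog_def scan_prog_def
  greedy_prog_def seeded_prog_def preprocess_prog_def single_prog_def triple_prog_def

lemma well_formed_progs:
  "well_formed init_prog" "well_formed single_prog" "well_formed triple_prog"
  by (simp_all add: loop_prog_defs init_prog_def)

context numbered_instance
begin

sublocale submodular "{..<n}" "gbc G" c b
  using submodular_gbc by (simp add: pverts_eq)

lemma gain_eq: "v < n \<Longrightarrow> gain C v = weight C v v"
  using gbc_insert[of v C] by (simp add: gain_def pverts_eq)

definition distances :: "state \<Rightarrow> bool" where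
  "distances s \<longleftrightarrow> size_of s = n \<and> imat s ''ds'' (\<lambda>i j. Suc (dist i j)) \<and>
     rmat s ''sg0'' (\<lambda>i j. real (num_paths G i j))"

lemma distances_agree:
  "agree X Y s t \<Longrightarrow> {''n'', ''ds''} \<inter> X = {} \<Longrightarrow> ''sg0'' \<notin> Y \<Longrightarrow> distances s \<Longrightarrow> distances t"
  by (simp add: agree_def distances_def imat_def rmat_def)

text \<open>With the shift of \<open>ds\<close>, both sides of the comparison exceed the true
  distances by 2. The test itself is one inequality; the triangle inequality supplies the
  other.\<close>

lemma bval_BAligned:
  assumes "distances s" "imem s x 0 < n" "imem s y 0 < n" "imem s z 0 < n"
  shows "bval (BAligned x y z) s \<longleftrightarrow>
    dist (imem s x 0) (imem s y 0) + dist (imem s y 0) (imem s z 0) = dist (imem s x 0) (imem s z 0)"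
  using assms dist_triangle[of "imem s x 0" "imem s y 0" "imem s z 0"]
  by (auto simp: BAligned_def distances_def imat_def pverts_eq)

lemma run_dependency_prog:
  assumes s: "distances s" "rmem s ''ee'' = (\<lambda>_. 0)"
  shows "rmat (run dependency_prog s) ''ee'' dependency"
  unfolding rmat_def
proof (intro allI impI)
  fix i j assume "i < n" "j < n"
  then show "rmem (run dependency_prog s) ''ee'' (i * n + j) = dependency i j"
    unfolding dependency_prog_def
  proof (rule for_for_update[rotated 3])
    let ?p = "PIf (BAnd (BNot (BEq (var ''s'') (var ''t''))) (BAligned ''s'' ''y'' ''t''))
       (PRAssign ''ee'' (idx ''s'' ''y'') (RAdd (RCell ''ee'' (idx ''s'' ''y''))
         (RDiv (RCell ''sg0'' (idx ''y'' ''t'')) (RCell ''sg0'' (idx ''s'' ''t'')))))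
       PSkip"
    fix i j t
    assume ij: "i < n" "j < n" and vars: "imem t ''s'' 0 = i" "imem t ''y'' 0 = j"
      and agree: "agree (insert ''s'' (insert ''y'' (iwrites (PFor ''t'' ?p)))) (rwrites (PFor ''t'' ?p)) s t"
      and cell: "rmem t ''ee'' (i * n + j) = rmem s ''ee'' (i * n + j)"
    have t: "distances t" using distances_agree[OF agree] s by simp
    let ?g = "\<lambda>k. if i \<noteq> k \<and> dist i j + dist j k = dist i k
      then real (num_paths G j k) / real (num_paths G i k) else 0"
    have "rmem (run (PFor ''t'' ?p) t) ''ee'' = (rmem t ''ee'')(i * n + j := rmem t ''ee'' (i * n + j) + (\<Sum>k<n. ?g k))"
    proof (rule for_accumulate)
      show "size_of t = n" using t by (simp add: distances_def)
      fix k r assume k: "k < n" "imem r ''t'' 0 = k" and agree': "agree (insert ''t'' (iwrites ?p)) (rwrites ?p) t r"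
      have r: "distances r" using distances_agree[OF agree'] t by simp
      have rv: "imem r ''s'' 0 = i" "imem r ''y'' 0 = j" using agree' vars by (simp_all add: agree_def)
      have "size_of r = n" "rmem r ''sg0'' (j * n + k) = real (num_paths G j k)"
        "rmem r ''sg0'' (i * n + k) = real (num_paths G i k)"
        using r ij k by (auto simp: distances_def rmat_def)
      then show "rmem (run ?p r) ''ee'' = (rmem r ''ee'')(i * n + j := rmem r ''ee'' (i * n + j) + ?g k)"
        using bval_BAligned[OF r, of "''s''" "''y''" "''t''"] rv k ij by auto
    qed simp
    then show "rmem (run (PFor ''t'' ?p) t) ''ee'' = (rmem t ''ee'')(i * n + j := dependency i j)"
      using cell s by (simp add: dependency_def pverts_eq)
  qed (use s in \<open>simp_all add: distances_def\<close>)
qed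

lemma run_weight_prog:
  assumes s: "distances s" "rmem s ''dd0'' = (\<lambda>_. 0)" "rmat s ''ee'' dependency"
  shows "rmat (run weight_prog s) ''dd0'' (weight {})"
  unfolding rmat_def
proof (intro allI impI)
  fix i j assume "i < n" "j < n"
  then show "rmem (run weight_prog s) ''dd0'' (i * n + j) = weight {} i j"
    unfolding weight_prog_def
  proof (rule for_for_update[rotated 3])
    let ?p = "PIf (BAligned ''s'' ''x'' ''y'')
       (PRAssign ''dd0'' (idx ''x'' ''y'') (RAdd (RCell ''dd0'' (idx ''x'' ''y''))
         (RMul (RCell ''sg0'' (idx ''s'' ''x'')) (RCell ''ee'' (idx ''s'' ''y'')))))
       PSkip"
    fix i j t
    assume ij: "i < n" "j < n" and vars: "imem t ''x'' 0 = i" "imem t ''y'' 0 = j"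
      and agree: "agree (insert ''x'' (insert ''y'' (iwrites (PFor ''s'' ?p)))) (rwrites (PFor ''s'' ?p)) s t"
      and cell: "rmem t ''dd0'' (i * n + j) = rmem s ''dd0'' (i * n + j)"
    have t: "distances t" "rmat t ''ee'' dependency"
      using distances_agree[OF agree] agree s by (simp_all add: agree_def rmat_def)
    let ?g = "\<lambda>k. if dist k i + dist i j = dist k j then real (num_paths G k i) * dependency k j else 0"
    have "rmem (run (PFor ''s'' ?p) t) ''dd0'' = (rmem t ''dd0'')(i * n + j := rmem t ''dd0'' (i * n + j) + (\<Sum>k<n. ?g k))"
    proof (rule for_accumulate)
      show "size_of t = n" using t by (simp add: distances_def)
      fix k r assume k: "k < n" "imem r ''s'' 0 = k" and agree': "agree (insert ''s'' (iwrites ?p)) (rwrites ?p) t r"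
      have r: "distances r" using distances_agree[OF agree'] t by simp
      have rv: "imem r ''x'' 0 = i" "imem r ''y'' 0 = j" "rmem r ''ee'' = rmem t ''ee''"
        using agree' vars by (simp_all add: agree_def)
      have "size_of r = n" "rmem r ''sg0'' (k * n + i) = real (num_paths G k i)"
        "rmem r ''ee'' (k * n + j) = dependency k j"
        using r ij k rv t by (auto simp: distances_def rmat_def)
      then show "rmem (run ?p r) ''dd0'' = (rmem r ''dd0'')(i * n + j := rmem r ''dd0'' (i * n + j) + ?g k)"
        using bval_BAligned[OF r, of "''s''" "''x''" "''y''"] rv k ij by auto
    qed simp
    then show "rmem (run (PFor ''s'' ?p) t) ''dd0'' = (rmem t ''dd0'')(i * n + j := weight {} i j)"
      using cell s weight_empty[of i j] ij by (simp add: pverts_eq)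
  qed (use s in \<open>simp_all add: distances_def\<close>)
qed

section \<open>Machine states that represent a chosen set\<close>

definition base :: "state \<Rightarrow> bool" where
  "base s \<longleftrightarrow> distances s \<and> rmat s ''dd0'' (weight {}) \<and> (\<forall>i<n. rmem s ''cost'' i = c i) \<and>
     rmem s ''budget'' 0 = b"

lemma base_agree:
  "agree X Y s t \<Longrightarrow> {''n'', ''ds''} \<inter> X = {} \<Longrightarrow> {''sg0'', ''dd0'', ''cost'', ''budget''} \<inter> Y = {} \<Longrightarrow>
    base s \<Longrightarrow> base t"
  using distances_agree[of X Y s t] by (simp add: base_def) (simp add: agree_def rmat_def)

definition rep :: "nat set \<Rightarrow> state \<Rightarrow> bool" where
  "rep C s \<longleftrightarrow> C \<subseteq> {..<n} \<and> sum c C \<le> b \<and> (\<forall>i<n. imem s ''in'' i = (if i \<in> C then 1 else 0)) \<and>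
     rmat s ''sg'' (\<lambda>i j. real (avoiding C i j)) \<and> rmat s ''dd'' (weight C) \<and>
     rmem s ''val'' 0 = gbc G C \<and> rmem s ''spent'' 0 = sum c C"

lemma rep_agree:
  "agree X Y s t \<Longrightarrow> ''in'' \<notin> X \<Longrightarrow> {''sg'', ''dd'', ''val'', ''spent''} \<inter> Y = {} \<Longrightarrow> rep C s \<Longrightarrow> rep C t"
  by (simp add: agree_def rep_def rmat_def)

lemma run_reset_prog:
  assumes "base s"
  shows "rep {} (run reset_prog s)"
proof -
  let ?p1 = "PFor ''x'' (PIAssign ''in'' (var ''x'') (ILit 0))"
  let ?p2 = "PFor ''x'' (PFor ''y'' (PRAssign ''sg'' (idx ''x'' ''y'') (RCell ''sg0'' (idx ''x'' ''y''))))"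
  let ?p3 = "PFor ''x'' (PFor ''y'' (PRAssign ''dd'' (idx ''x'' ''y'') (RCell ''dd0'' (idx ''x'' ''y''))))"
  define s1 where "s1 = run ?p1 s"
  define s2 where "s2 = run ?p2 s1"
  define s3 where "s3 = run ?p3 s2"
  have size: "size_of s = n" using assms by (simp add: base_def distances_def)
  have in0: "imem s1 ''in'' i = 0" if "i < n" for i
    unfolding s1_def using that by (rule for_fill_imem[rotated 4]) (simp_all add: size)
  have b1: "base s1" using base_agree[OF agree_run[of ?p1 s] _ _ assms] by (simp add: s1_def)
  have size1: "size_of s1 = n" using b1 by (simp add: base_def distances_def)
  have sg2: "rmem s2 ''sg'' (i * n + j) = rmem s1 ''sg0'' (i * n + j)" if "i < n" "j < n" for i j
    unfolding s2_def using that
    by (rule for_for_update[rotated 3]) (auto simp: size1 agree_def)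
  have b2: "base s2" using base_agree[OF agree_run[of ?p2 s1] _ _ b1] by (simp add: s2_def)
  have size2: "size_of s2 = n" using b2 by (simp add: base_def distances_def)
  have dd3: "rmem s3 ''dd'' (i * n + j) = rmem s2 ''dd0'' (i * n + j)" if "i < n" "j < n" for i j
    unfolding s3_def using that
    by (rule for_for_update[rotated 3]) (auto simp: size2 agree_def)
  have frame: "imem s3 ''in'' = imem s1 ''in''" "rmem s3 ''sg'' = rmem s2 ''sg''"
    by (simp_all add: s3_def s2_def imem_run rmem_run)
  have "rmat s3 ''sg'' (\<lambda>i j. real (avoiding {} i j))"
    using sg2 b1 frame by (simp add: rmat_def base_def distances_def num_paths_avoiding)
  moreover have "rmat s3 ''dd'' (weight {})"
    using dd3 b2 by (simp add: rmat_def base_def)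
  moreover have "run reset_prog s = set_rmem ''spent'' 0 0 (set_rmem ''val'' 0 0 s3)"
    by (simp add: reset_prog_def s1_def s2_def s3_def)
  ultimately show ?thesis
    using in0 frame budget_nonneg by (simp add: rep_def rmat_def gbc_empty)
qed

definition add_item :: "nat set \<Rightarrow> nat \<Rightarrow> nat set" where
  "add_item C v = (if addable C v then insert v C else C)"

lemma bval_BAddable:
  assumes "base s" "rep C s" "imem s x 0 < n"
  shows "bval (BAddable x) s \<longleftrightarrow> addable C (imem s x 0)"
  using assms by (auto simp: BAddable_def BFits_def base_def rep_def addable_def not_less)

lemma run_add_prog:
  assumes base: "base s" and rep: "rep C s" and v: "imem s ''v'' 0 < n"
  shows "rep (add_item C (imem s ''v'' 0)) (run add_prog s)"
proof (cases "addable C (imem s ''v'' 0)")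
  case False
  then show ?thesis using bval_BAddable[OF base rep v] rep by (simp add: add_prog_def add_item_def)
next
  case True
  define v where "v = imem s ''v'' 0"
  have vn: "v < n" "v \<notin> C" using assms True by (auto simp: v_def addable_def)
  have V: "v \<in> pverts G" using vn pverts_eq by simp
  define s1 where "s1 = set_imem ''in'' v 1
    (set_rmem ''spent'' 0 (sum c C + c v) (set_rmem ''val'' 0 (gbc G C + weight C v v) s))"
  define s2 where "s2 = run copy_prog s1"
  define s3 where "s3 = run update_sg_prog s2"
  define s4 where "s4 = run update_dd_prog s3"
  have run: "run add_prog s = s4"
    using bval_BAddable[OF base rep v] True base rep vn
    by (simp add: add_prog_def s1_def s2_def s3_def s4_def v_def[symmetric] base_def rep_def distances_def rmat_def)
  have b1: "base s1" using base by (simp add: s1_def base_def distances_def imat_def rmat_def)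
  have size1: "size_of s1 = n" using b1 by (simp add: base_def distances_def)
  have copies: "rmem s2 ''nrow'' i = real (avoiding C v i)" "rmem s2 ''ncol'' i = real (avoiding C i v)"
    "rmem s2 ''drow'' i = weight C v i" "rmem s2 ''dcol'' i = weight C i v" if "i < n" for i
  proof -
    have v1: "imem s1 ''v'' 0 = v" by (simp add: s1_def v_def)
    have m1: "rmat s1 ''sg'' (\<lambda>i j. real (avoiding C i j))" "rmat s1 ''dd'' (weight C)"
      using rep by (simp_all add: s1_def rep_def rmat_def)
    show "rmem s2 ''nrow'' i = real (avoiding C v i)"
      unfolding s2_def copy_prog_def using that
      by (rule for_fill_rmem[rotated 3]) (use m1 vn in \<open>auto simp: size1 v1 agree_def rmat_def\<close>)
    show "rmem s2 ''ncol'' i = real (avoiding C i v)"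
      unfolding s2_def copy_prog_def using that
      by (rule for_fill_rmem[rotated 3]) (use m1 vn in \<open>auto simp: size1 v1 agree_def rmat_def\<close>)
    show "rmem s2 ''drow'' i = weight C v i"
      unfolding s2_def copy_prog_def using that
      by (rule for_fill_rmem[rotated 3]) (use m1 vn in \<open>auto simp: size1 v1 agree_def rmat_def\<close>)
    show "rmem s2 ''dcol'' i = weight C i v"
      unfolding s2_def copy_prog_def using that
      by (rule for_fill_rmem[rotated 3]) (use m1 vn in \<open>auto simp: size1 v1 agree_def rmat_def\<close>)
  qed
  have b2: "base s2" using base_agree[OF agree_run[of copy_prog s1] _ _ b1] by (simp add: s2_def copy_prog_def)
  have v2: "imem s2 ''v'' 0 = v" by (simp add: s2_def s1_def imem_run copy_prog_def v_def)
  have m2: "rmat s2 ''sg'' (\<lambda>i j. real (avoiding C i j))" "rmat s2 ''dd'' (weight C)"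
    using rep by (simp_all add: s2_def s1_def rep_def rmat_def rmem_run copy_prog_def)
  have d2: "distances s2" and size2: "size_of s2 = n" using b2 by (simp_all add: base_def distances_def)
  have sg3: "rmem s3 ''sg'' (i * n + j) = real (avoiding (insert v C) i j)" if "i < n" "j < n" for i j
    unfolding s3_def update_sg_prog_def using that
  proof (rule for_for_update[rotated 3])
    let ?p = "PIf (BAligned ''x'' ''v'' ''y'')
      (PRAssign ''sg'' (idx ''x'' ''y'') (RSub (RCell ''sg'' (idx ''x'' ''y''))
       (RMul (RCell ''ncol'' (var ''x'')) (RCell ''nrow'' (var ''y''))))) PSkip"
    fix i j t
    assume ij: "i < n" "j < n" and vars: "imem t ''x'' 0 = i" "imem t ''y'' 0 = j"
      and agree: "agree (insert ''x'' (insert ''y'' (iwrites ?p))) (rwrites ?p) s2 t"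
      and cell: "rmem t ''sg'' (i * n + j) = rmem s2 ''sg'' (i * n + j)"
    have t: "distances t" using distances_agree[OF agree] d2 by simp
    have tv: "imem t ''v'' 0 = v" "size_of t = n" "rmem t ''nrow'' = rmem s2 ''nrow''" "rmem t ''ncol'' = rmem s2 ''ncol''"
      using agree v2 size2 by (simp_all add: agree_def)
    have "real (avoiding (insert v C) i j) = real (avoiding C i j) -
      (if dist i v + dist v j = dist i j then real (avoiding C i v) * real (avoiding C v j) else 0)"
      using avoiding_insert[of i j v C] ij vn by (simp add: pverts_eq)
    moreover have "rmem t ''sg'' (i * n + j) = real (avoiding C i j)" using cell m2 ij by (simp add: rmat_def)
    ultimately show "rmem (run ?p t) ''sg'' = (rmem t ''sg'')(i * n + j := real (avoiding (insert v C) i j))"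
      using bval_BAligned[OF t, of "''x''" "''v''" "''y''"] vars ij vn by (auto simp: tv copies)
  qed (simp_all add: size2)
  have b3: "base s3" using base_agree[OF agree_run[of update_sg_prog s2] _ _ b2] by (simp add: s3_def update_sg_prog_def)
  have frame3: "imem s3 ''v'' = imem s2 ''v''" "rmem s3 ''nrow'' = rmem s2 ''nrow''" "rmem s3 ''ncol'' = rmem s2 ''ncol''"
    "rmem s3 ''drow'' = rmem s2 ''drow''" "rmem s3 ''dcol'' = rmem s2 ''dcol''" "rmem s3 ''dd'' = rmem s2 ''dd''"
    by (simp_all add: s3_def imem_run rmem_run update_sg_prog_def)
  have d3: "distances s3" and size3: "size_of s3 = n" using b3 by (simp_all add: base_def distances_def)
  have dd4: "rmem s4 ''dd'' (i * n + j) = weight (insert v C) i j" if "i < n" "j < n" for i j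
    unfolding s4_def update_dd_prog_def using that
  proof (rule for_for_update[rotated 3])
    let ?p = "PSeq (PIf (BAligned ''v'' ''x'' ''y'')
       (PRAssign ''dd'' (idx ''x'' ''y'') (RSub (RCell ''dd'' (idx ''x'' ''y''))
         (RMul (RCell ''nrow'' (var ''x'')) (RCell ''drow'' (var ''y'')))))
       PSkip)
     (PIf (BAnd (BNot (BEq (var ''x'') (var ''v''))) (BAligned ''x'' ''y'' ''v''))
       (PRAssign ''dd'' (idx ''x'' ''y'') (RSub (RCell ''dd'' (idx ''x'' ''y''))
         (RMul (RCell ''ncol'' (var ''y'')) (RCell ''dcol'' (var ''x'')))))
       PSkip)"
    fix i j t
    assume ij: "i < n" "j < n" and vars: "imem t ''x'' 0 = i" "imem t ''y'' 0 = j"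
      and agree: "agree (insert ''x'' (insert ''y'' (iwrites ?p))) (rwrites ?p) s3 t"
      and cell: "rmem t ''dd'' (i * n + j) = rmem s3 ''dd'' (i * n + j)"
    have t: "distances t" using distances_agree[OF agree] d3 by simp
    have tv: "imem t ''v'' 0 = v" "size_of t = n" "rmem t ''nrow'' = rmem s2 ''nrow''" "rmem t ''ncol'' = rmem s2 ''ncol''"
      "rmem t ''drow'' = rmem s2 ''drow''" "rmem t ''dcol'' = rmem s2 ''dcol''"
      using agree v2 size3 frame3 by (simp_all add: agree_def)
    \<comment> \<open>The state after the first correction. The second test does not read
      \<open>dd\<close>, so it has the same outcome whether or not that correction was made.\<close>
    let ?t1 = "set_rmem ''dd'' (i * n + j) (rmem t ''dd'' (i * n + j) - real (avoiding C v i) * weight C v j) t"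
    have t1: "distances ?t1" using t by (simp add: distances_def imat_def rmat_def)
    have W: "weight (insert v C) i j = weight C i j
      - (if dist v i + dist i j = dist v j then real (avoiding C v i) * weight C v j else 0)
      - (if i \<noteq> v \<and> dist i j + dist j v = dist i v then real (avoiding C j v) * weight C i v else 0)"
      using weight_insert[of v C i j] ij vn by (simp add: pverts_eq)
    have cell': "rmem t ''dd'' (i * n + j) = weight C i j" using cell m2 ij frame3 by (simp add: rmat_def)
    have g1: "bval (BAligned ''v'' ''x'' ''y'') t \<longleftrightarrow> dist v i + dist i j = dist v j"
      using bval_BAligned[OF t, of "''v''" "''x''" "''y''"] vars ij vn tv by simp
    have g2: "bval (BAligned ''x'' ''y'' ''v'') t \<longleftrightarrow> dist i j + dist j v = dist i v"
      "bval (BAligned ''x'' ''y'' ''v'') ?t1 \<longleftrightarrow> dist i j + dist j v = dist i v"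
      using bval_BAligned[OF t, of "''x''" "''y''" "''v''"] bval_BAligned[OF t1, of "''x''" "''y''" "''v''"]
        vars ij vn tv by simp_all
    show "rmem (run ?p t) ''dd'' = (rmem t ''dd'')(i * n + j := weight (insert v C) i j)"
      unfolding W using g1 g2 cell' copies[OF ij(1)] copies[OF ij(2)] by (auto simp: vars tv)
  qed (simp_all add: size3)
  have frame4: "imem s4 ''in'' = imem s1 ''in''" "rmem s4 ''sg'' = rmem s3 ''sg''"
    "rmem s4 ''val'' = rmem s1 ''val''" "rmem s4 ''spent'' = rmem s1 ''spent''"
    by (simp_all add: s4_def s3_def s2_def imem_run rmem_run update_dd_prog_def update_sg_prog_def copy_prog_def)
  have finC: "finite C" using rep finite_subset by (auto simp: rep_def)
  have "rep (insert v C) s4"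
    using rep True vn finC sg3 dd4 gbc_insert[OF V, of C]
    by (simp add: rep_def rmat_def frame4) (auto simp: s1_def addable_def v_def)
  then show ?thesis using True by (simp add: run add_item_def v_def)
qed

end


section \<open>The greedy run and its seeds\<close>

text \<open>The strict second hypothesis excludes \<open>cv = 0\<close>, the case in which
  cross-multiplied comparison is not transitive.\<close>

lemma density_trans:
  fixes gx gv gw cx cv cw :: real
  assumes "gx * cv \<le> gv * cx" "gv * cw < gw * cv" "0 \<le> cx" "0 \<le> cv" "0 \<le> cw" "0 \<le> gv"
  shows "gx * cw \<le> gw * cx"
proof -
  have "cv \<noteq> 0" using assms(2,5,6) by (auto simp: mult_less_0_iff)
  then have cv: "0 < cv" using assms(4) by simp
  have "(gx * cv) * cw \<le> (gv * cx) * cw" using assms by (intro mult_right_mono)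
  also have "\<dots> = (gv * cw) * cx" by simp
  also have "\<dots> \<le> (gw * cv) * cx" using assms by (intro mult_right_mono) auto
  finally have "cv * (gx * cw) \<le> cv * (gw * cx)" by (simp add: mult_ac)
  then show ?thesis using cv by simp
qed

context numbered_instance
begin

definition found :: "state \<Rightarrow> bool" where
  "found s \<longleftrightarrow> gbc G (output_set n s) = rmem s ''best'' 0 \<and> feasible G c b (output_set n s)"

text \<open>The bound on \<open>v\<close> makes its initial content 0 a valid node, so the selection
  can test it before any node has been chosen.\<close>

definition good :: "state \<Rightarrow> bool" where
  "good s \<longleftrightarrow> base s \<and> found s \<and> imem s ''v'' 0 < n"

abbreviation best :: "state \<Rightarrow> real" where
  "best s \<equiv> rmem s ''best'' 0"

lemma found_agree:
  "agree X Y s t \<Longrightarrow> ''out'' \<notin> X \<Longrightarrow> ''best'' \<notin> Y \<Longrightarrow> found s \<Longrightarrow> found t"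
  by (simp add: agree_def found_def output_set_def)

lemma candidate_feasible:
  assumes "rep C s" "candidate C w"
  shows "feasible G c b (insert w C)"
proof -
  have "finite C" using assms finite_subset by (auto simp: rep_def)
  then show ?thesis using assms
    by (auto simp: feasible_def candidate_def rep_def addable_def pverts_eq insert_absorb)
qed

lemma run_record_prog:
  assumes base: "base s" and rep: "rep C s" and found: "found s"
    and w: "imem s ''w'' 0 = w" "w < n" and cand: "candidate C w"
  shows "found (run record_prog s)" "best s \<le> best (run record_prog s)"
    "gbc G (insert w C) \<le> best (run record_prog s)"
proof -
  let ?new = "gbc G (insert w C)"
  have size: "size_of s = n" using base by (simp add: base_def distances_def)
  have new: "rmem s ''val'' 0 + rmem s ''dd'' (w * n + w) = ?new"
    using rep w gbc_insert[of w C] by (simp add: rep_def rmat_def pverts_eq)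
  show "found (run record_prog s)" "best s \<le> best (run record_prog s)" "?new \<le> best (run record_prog s)"
  proof (atomize (full), cases "best s < ?new")
    case False
    then have "run record_prog s = s" by (simp add: record_prog_def w size new)
    then show "found (run record_prog s) \<and> best s \<le> best (run record_prog s) \<and> ?new \<le> best (run record_prog s)"
      using False found by simp
  next
    case True
    let ?copy = "PFor ''x'' (PIAssign ''out'' (var ''x'') (ICell ''in'' (var ''x'')))"
    define s1 where "s1 = set_rmem ''best'' 0 ?new s"
    define s2 where "s2 = run ?copy s1"
    have size1: "size_of s1 = n" using size by (simp add: s1_def)
    have out: "imem s2 ''out'' i = imem s1 ''in'' i" if "i < n" for i
      unfolding s2_def using that
      by (rule for_fill_imem[rotated 4]) (auto simp: size1 agree_def)
    have frame: "imem s2 ''w'' = imem s1 ''w''" "rmem s2 = rmem s1"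
      by (simp_all add: s2_def imem_run rmem_run ext)
    have run: "run record_prog s = set_imem ''out'' w 1 s2"
      using True by (simp add: record_prog_def w size new s1_def[symmetric] s2_def[symmetric])
        (simp add: frame s1_def w)
    have "output_set n (run record_prog s) = insert w C"
      using rep w out unfolding run by (auto simp: output_set_def rep_def s1_def)
    then show "found (run record_prog s) \<and> best s \<le> best (run record_prog s) \<and> ?new \<le> best (run record_prog s)"
      using True candidate_feasible[OF rep cand] by (simp add: found_def run frame s1_def)
  qed
qed

lemma record_frame:
  "iwrites record_prog = {''x'', ''out''}" "rwrites record_prog = {''best''}"
  "iwrites select_prog = {''v''}" "rwrites select_prog = {}"
  by (auto simp: record_prog_def select_prog_def)

lemma run_scan_prog:
  assumes good: "good s" and rep: "rep C s"
  defines "t \<equiv> run scan_prog s"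
  shows "good t" "rep C t" "best s \<le> best t"
    "\<And>x. candidate C x \<Longrightarrow> gbc G (insert x C) \<le> best t"
    "greedy_step C (add_item C (imem t ''v'' 0))"
proof -
  let ?b = "PIf (BOr (ILess (ILit 0) (ICell ''in'' (var ''w''))) (BFits ''w'')) (PSeq record_prog select_prog) PSkip"
  \<comment> \<open>Nothing is claimed about the density of \<open>v\<close> until an addable node
    has been scanned. If there is none, \<open>v\<close> is not addable either, and
    \<open>add_item\<close> leaves the set alone, as \<open>greedy_step\<close> demands.\<close>
  define I where "I k t \<longleftrightarrow> imem t ''v'' 0 < n \<and> found t \<and> best s \<le> best t \<and>
    (\<forall>x<k. candidate C x \<longrightarrow> gbc G (insert x C) \<le> best t) \<and>
    (\<forall>x<k. addable C x \<longrightarrow> addable C (imem t ''v'' 0) \<and>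
      gain C x * c (imem t ''v'' 0) \<le> gain C (imem t ''v'' 0) * c x)" for k and t :: state
  have base: "base s" using good by (simp add: good_def)
  have CV: "C \<subseteq> {..<n}" using rep by (simp add: rep_def)
  have I: "I n t"
    unfolding t_def scan_prog_def
  proof (rule for_invariant)
    show "well_formed (PFor ''w'' ?b)" by (simp add: record_frame) (simp add: record_prog_def select_prog_def)
    show "size_of s = n" using base by (simp add: base_def distances_def)
    show "I i (set_imem ''w'' 0 k t)" if "I i t" for i k t
      using that by (simp add: I_def found_def output_set_def)
    show "I 0 s" using good by (simp add: I_def good_def)
    fix w r assume w: "w < n" "imem r ''w'' 0 = w" and r: "I w r"
      and agree: "agree (insert ''w'' (iwrites ?b)) (rwrites ?b) s r"
    have base_r: "base r" using base_agree[OF agree _ _ base] by (simp add: record_frame)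
    have rep_r: "rep C r" using rep_agree[OF agree _ _ rep] by (simp add: record_frame)
    have guard: "bval (BOr (ILess (ILit 0) (ICell ''in'' (var ''w''))) (BFits ''w'')) r \<longleftrightarrow> candidate C w"
      using base_r rep_r w by (auto simp: BFits_def base_def rep_def candidate_def addable_def not_less)
    show "I (Suc w) (run ?b r)"
    proof (cases "candidate C w")
      case False
      then have "\<not> addable C w" by (simp add: candidate_def)
      then have "I (Suc w) r" using r False by (auto simp: I_def less_Suc_eq)
      then show ?thesis using False guard by simp
    next
      case True
      define r1 where "r1 = run record_prog r"
      have run: "run ?b r = run select_prog r1" using True guard by (simp add: r1_def)
      have found: "found r" using r by (simp add: I_def)
      note rec = run_record_prog[OF base_r rep_r found w(2,1) True, folded r1_def]
      note fr = agree_run[of record_prog r, folded r1_def]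
      have base1: "base r1" using base_agree[OF fr _ _ base_r] by (simp add: record_frame)
      have rep1: "rep C r1" using rep_agree[OF fr _ _ rep_r] by (simp add: record_frame)
      define v where "v = imem r ''v'' 0"
      have v: "imem r1 ''v'' 0 = v" "imem r1 ''w'' 0 = w" "v < n"
        using fr r w by (simp_all add: agree_def record_frame I_def v_def)
      have old: "addable C v \<and> gain C x * c v \<le> gain C v * c x" if "x < w" "addable C x" for x
        using r that by (simp add: I_def v_def)
      have size1: "size_of r1 = n" using base1 by (simp add: base_def distances_def)
      have mem: "imem r1 ''in'' w = (if w \<in> C then 1 else 0)" "rmem r1 ''cost'' v = c v" "rmem r1 ''cost'' w = c w"
        "rmem r1 ''dd'' (v * n + v) = gain C v" "rmem r1 ''dd'' (w * n + w) = gain C w"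
        using rep1 base1 v w by (auto simp: rep_def base_def rmat_def gain_eq)
      have sel: "bval (BAnd (ILess (ICell ''in'' (var ''w'')) (ILit 1)) (BOr (BNot (BAddable ''v''))
          (RLess (RMul (RCell ''dd'' (idx ''v'' ''v'')) (RCell ''cost'' (var ''w'')))
            (RMul (RCell ''dd'' (idx ''w'' ''w'')) (RCell ''cost'' (var ''v'')))))) r1 \<longleftrightarrow>
          w \<notin> C \<and> (\<not> addable C v \<or> gain C v * c w < gain C w * c v)"
        using bval_BAddable[OF base1 rep1, of "''v''"] v mem size1 by simp
      have gv: "0 \<le> gain C v" "0 \<le> c v" "0 \<le> c w" using gain_nonneg[OF CV] c_nonneg v w by auto
      have cands: "\<forall>x<Suc w. candidate C x \<longrightarrow> gbc G (insert x C) \<le> best r1"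
        using r rec by (auto simp: I_def less_Suc_eq intro: order_trans)
      have best: "best s \<le> best r1" using r rec by (simp add: I_def)
      show ?thesis
      proof (cases "w \<notin> C \<and> (\<not> addable C v \<or> gain C v * c w < gain C w * c v)")
        case switch: True
        have "run select_prog r1 = set_imem ''v'' 0 w r1"
          unfolding select_prog_def using switch v by (simp only: run.simps sel if_True) simp
        then have "run ?b r = set_imem ''v'' 0 w r1" by (simp only: run)
        moreover have "addable C w" using True switch by (simp add: candidate_def)
        moreover have "gain C x * c w \<le> gain C w * c x" if "x < Suc w" "addable C x" for x
        proof (cases "x = w")
          case False
          then have "addable C v" "gain C x * c v \<le> gain C v * c x" using old[of x] that by auto
          moreover have "0 \<le> c x" using that c_nonneg by (simp add: addable_def)
          ultimately show ?thesis using switch gv density_trans by blast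
        qed simp
        ultimately show ?thesis
          using rec(1) w cands best by (simp add: I_def found_def output_set_def)
      next
        case keep: False
        have "run select_prog r1 = r1"
          unfolding select_prog_def using keep by (simp only: run.simps sel if_False)
        then have "run ?b r = r1" by (simp only: run)
        moreover have "addable C v \<and> gain C x * c v \<le> gain C v * c x" if "x < Suc w" "addable C x" for x
        proof (cases "x = w")
          case True
          then show ?thesis using keep that by (auto simp: addable_def)
        next
          case False
          then show ?thesis using old[of x] that by auto
        qed
        ultimately show ?thesis
          using rec(1) v cands best by (simp add: I_def)
      qed
    qed
  qed
  have fr: "agree (iwrites scan_prog) (rwrites scan_prog) s t" unfolding t_def by (rule agree_run)
  show "good t" using I base_agree[OF fr _ _ base]
    by (simp add: good_def I_def scan_prog_def record_frame)
  show "rep C t" using rep_agree[OF fr _ _ rep] by (simp add: scan_prog_def record_frame)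
  show "best s \<le> best t" using I by (simp add: I_def)
  show "gbc G (insert x C) \<le> best t" if "candidate C x" for x
    using I that CV by (auto simp: I_def candidate_def addable_def)
  show "greedy_step C (add_item C (imem t ''v'' 0))"
  proof (cases "\<exists>x. addable C x")
    case True
    then obtain x where "addable C x" "x < n" by (auto simp: addable_def)
    then have "addable C (imem t ''v'' 0)" using I by (auto simp: I_def)
    moreover have "gain C x * c (imem t ''v'' 0) \<le> gain C (imem t ''v'' 0) * c x" if "addable C x" for x
      using I that by (auto simp: I_def addable_def)
    ultimately have "densest C (imem t ''v'' 0)" by (simp add: densest_def)
    then show ?thesis by (auto simp: greedy_step_def add_item_def densest_def)
  next
    case False
    then show ?thesis by (simp add: greedy_step_def add_item_def)
  qed
qed

lemma add_frame:
  "iwrites add_prog = {''in'', ''x'', ''y''}"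
  "rwrites add_prog = {''val'', ''spent'', ''nrow'', ''ncol'', ''drow'', ''dcol'', ''sg'', ''dd''}"
  by (auto simp: loop_prog_defs)

lemma good_agree:
  assumes "agree X Y s t" "{''n'', ''ds'', ''out'', ''v''} \<inter> X = {}"
    "{''sg0'', ''dd0'', ''cost'', ''budget'', ''best''} \<inter> Y = {}" "good s"
  shows "good t" "best t = best s"
  using assms base_agree[OF assms(1)] found_agree[OF assms(1)] by (auto simp: good_def agree_def)

lemma good_add_prog: "good s \<Longrightarrow> good (run add_prog s) \<and> best (run add_prog s) = best s"
  using good_agree[OF agree_run[of add_prog s]] by (simp add: add_frame)

lemma greedy_run_mono: "greedy_run Gs k M \<Longrightarrow> M \<le> M' \<Longrightarrow> greedy_run Gs k M'"
  unfolding greedy_run_def by (meson order_trans)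

lemma run_greedy_prog:
  assumes good: "good s" and rep: "rep C s"
  shows "good (run greedy_prog s) \<and> best s \<le> best (run greedy_prog s) \<and>
    (\<exists>Gs. Gs 0 = C \<and> greedy_run Gs n (best (run greedy_prog s)))"
proof -
  define I where "I i t \<longleftrightarrow> good t \<and> best s \<le> best t \<and>
    (\<exists>Gs. Gs 0 = C \<and> greedy_run Gs i (best t) \<and> rep (Gs i) t)" for i t
  have "I n (run greedy_prog s)"
    unfolding greedy_prog_def
  proof (rule for_invariant)
    show "well_formed (PFor ''i'' (PSeq scan_prog add_prog))" by (simp add: loop_prog_defs)
    show "size_of s = n" using good by (simp add: good_def base_def distances_def)
    show "I i (set_imem ''i'' 0 k t)" if "I i t" for i k t
    proof -
      have agree: "agree {''i''} {} t (set_imem ''i'' 0 k t)" by (simp add: agree_set_imem)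
      show ?thesis using that good_agree[OF agree] rep_agree[OF agree] by (auto simp: I_def)
    qed
    show "I 0 s" using good rep by (auto simp: I_def greedy_run_def intro!: exI[of _ "\<lambda>_. C"])
    fix i t assume "I i t"
    then obtain Gs where t: "good t" "best s \<le> best t"
      and Gs: "Gs 0 = C" "greedy_run Gs i (best t)" "rep (Gs i) t" by (auto simp: I_def)
    define t1 where "t1 = run scan_prog t"
    define t2 where "t2 = run add_prog t1"
    note scan = run_scan_prog[OF t(1) Gs(3), folded t1_def]
    let ?D = "add_item (Gs i) (imem t1 ''v'' 0)"
    have rep2: "rep ?D t2"
      unfolding t2_def using run_add_prog[OF _ scan(2)] scan(1) by (simp add: good_def)
    have good2: "good t2" "best t2 = best t1"
      using good_add_prog[OF scan(1)] by (simp_all add: t2_def)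
    \<comment> \<open>The trace is extended by function update; since \<open>best\<close> never
      decreases, the bounds recorded for earlier sets persist.\<close>
    have "greedy_run (Gs(Suc i := ?D)) (Suc i) (best t2)"
      using greedy_run_mono[OF Gs(2) scan(3)] scan(4,5) by (auto simp: greedy_run_def less_Suc_eq good2)
    then have "I (Suc i) t2"
      using good2 rep2 t scan(3) Gs(1)
      by (auto simp: I_def intro!: exI[of _ "Gs(Suc i := ?D)"])
    then show "I (Suc i) (run (PSeq scan_prog add_prog) t)" by (simp add: t1_def t2_def)
  qed
  then show ?thesis by (auto simp: I_def)
qed

section \<open>Runs from all triples of seeds\<close>

definition covered :: "nat \<Rightarrow> nat \<Rightarrow> nat \<Rightarrow> real \<Rightarrow> bool" where
  "covered p q r M \<longleftrightarrow> (\<exists>Gs. Gs 0 = add_item (add_item (add_item {} p) q) r \<and> greedy_run Gs n M)"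

lemma covered_mono: "covered p q r M \<Longrightarrow> M \<le> M' \<Longrightarrow> covered p q r M'"
  unfolding covered_def using greedy_run_mono by blast

lemma reset_frame:
  "iwrites reset_prog = {''in'', ''x'', ''y''}" "rwrites reset_prog = {''sg'', ''dd'', ''val'', ''spent''}"
  by (auto simp: reset_prog_def)

lemma good_reset_prog: "good s \<Longrightarrow> good (run reset_prog s) \<and> best (run reset_prog s) = best s"
  using good_agree[OF agree_run[of reset_prog s]] by (simp add: reset_frame)

lemma good_set_v: "good s \<Longrightarrow> k < n \<Longrightarrow> good (set_imem ''v'' 0 k s) \<and> best (set_imem ''v'' 0 k s) = best s"
  by (auto simp: good_def base_def distances_def imat_def rmat_def found_def output_set_def)

lemma run_single_loop:
  assumes good: "good s"
  shows "good (run (PSeq reset_prog greedy_prog) s) \<and>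
    (\<exists>Gs. Gs 0 = {} \<and> greedy_run Gs n (best (run (PSeq reset_prog greedy_prog) s)))"
proof -
  have "rep {} (run reset_prog s)" using good by (simp add: good_def run_reset_prog)
  then show ?thesis using run_greedy_prog good_reset_prog[OF good] by simp
qed

lemma add_at:
  assumes "good s" "rep C s" "imem s x 0 = k" "k < n" "x \<notin> {''v'', ''in'', ''x'', ''y''}"
  defines "t \<equiv> run add_prog (run (PIAssign ''v'' (ILit 0) (var x)) s)"
  shows "good t" "best t = best s" "rep (add_item C k) t" "\<And>y. y \<notin> {''v'', ''in'', ''x'', ''y''} \<Longrightarrow> imem t y = imem s y"
proof -
  define s1 where "s1 = set_imem ''v'' 0 k s"
  have t: "t = run add_prog s1" using assms by (simp add: s1_def)
  have s1: "good s1" "best s1 = best s" using good_set_v assms by (simp_all add: s1_def)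
  have "agree {''v''} {} s s1" by (simp add: s1_def agree_set_imem)
  from rep_agree[OF this _ _ assms(2)] have rep1: "rep C s1" by simp
  show "good t" "best t = best s" using good_add_prog[OF s1(1)] s1 t by simp_all
  have "rep (add_item C (imem s1 ''v'' 0)) (run add_prog s1)"
    using run_add_prog[OF _ rep1] s1 by (simp add: good_def)
  then show "rep (add_item C k) t" by (simp add: t) (simp add: s1_def)
  show "imem t y = imem s y" if "y \<notin> {''v'', ''in'', ''x'', ''y''}" for y
    using that by (simp add: t imem_run add_frame) (simp add: s1_def)
qed

lemma run_seeded_prog:
  assumes good: "good s" and vars: "imem s ''p'' 0 = p" "imem s ''q'' 0 = q" "imem s ''r'' 0 = r"
    and less: "p < n" "q < n" "r < n"
  shows "good (run seeded_prog s) \<and> best s \<le> best (run seeded_prog s) \<and> covered p q r (best (run seeded_prog s))"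
proof -
  define s0 where "s0 = run reset_prog s"
  define s1 where "s1 = run add_prog (run (PIAssign ''v'' (ILit 0) (var ''p'')) s0)"
  define s2 where "s2 = run add_prog (run (PIAssign ''v'' (ILit 0) (var ''q'')) s1)"
  define s3 where "s3 = run add_prog (run (PIAssign ''v'' (ILit 0) (var ''r'')) s2)"
  have run: "run seeded_prog s = run greedy_prog s3"
    by (simp add: seeded_prog_def s0_def s1_def s2_def s3_def)
  have v0: "imem s0 ''p'' 0 = p" "imem s0 ''q'' 0 = q" "imem s0 ''r'' 0 = r"
    using vars by (simp_all add: s0_def imem_run reset_frame)
  have g0: "good s0" "best s0 = best s" "rep {} s0"
    using good_reset_prog[OF good] good by (simp_all add: s0_def good_def run_reset_prog)
  note a1 = add_at[OF g0(1,3) v0(1) less(1), folded s1_def, simplified]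
  have v1: "imem s1 ''q'' 0 = q" "imem s1 ''r'' 0 = r" using a1(4) v0 by simp_all
  note a2 = add_at[OF a1(1,3) v1(1) less(2), folded s2_def, simplified]
  have v2: "imem s2 ''r'' 0 = r" using a2(4) v1 by simp
  note a3 = add_at[OF a2(1,3) v2 less(3), folded s3_def, simplified]
  show ?thesis
    using run_greedy_prog[OF a3(1,3)] a1(2) a2(2) a3(2) g0(2) by (auto simp: run covered_def)
qed

text \<open>What one iteration establishes about \<open>best\<close> has to survive the later ones.
  They can only increase \<open>best\<close>, hence the monotonicity required of
  \<open>Q\<close>.\<close>

lemma for_cover:
  assumes wf: "well_formed (PFor x p)" and x: "x \<notin> {''n'', ''ds'', ''out'', ''v''}" and good: "good s"
    and mono: "\<And>i M M'. Q i M \<Longrightarrow> M \<le> M' \<Longrightarrow> Q i M'"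
    and body: "\<And>i t. i < n \<Longrightarrow> good t \<Longrightarrow> imem t x 0 = i \<Longrightarrow>
      agree (insert x (iwrites p)) (rwrites p) s t \<Longrightarrow>
      good (run p t) \<and> best t \<le> best (run p t) \<and> Q i (best (run p t))"
  shows "good (run (PFor x p) s) \<and> best s \<le> best (run (PFor x p) s) \<and> (\<forall>i<n. Q i (best (run (PFor x p) s)))"
proof (rule for_invariant[OF wf, where I = "\<lambda>k t. good t \<and> best s \<le> best t \<and> (\<forall>i<k. Q i (best t))"])
  show "size_of s = n" using good by (simp add: good_def base_def distances_def)
  fix i k t assume t: "good t \<and> best s \<le> best t \<and> (\<forall>j<i. Q j (best t))"
  have "agree {x} {} t (set_imem x 0 k t)" by (simp add: agree_set_imem)
  from good_agree[OF this] t x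
  show "good (set_imem x 0 k t) \<and> best s \<le> best (set_imem x 0 k t) \<and> (\<forall>j<i. Q j (best (set_imem x 0 k t)))"
    by auto
next
  fix i t assume i: "i < n" and t: "good t \<and> best s \<le> best t \<and> (\<forall>j<i. Q j (best t))" "imem t x 0 = i"
    and agree: "agree (insert x (iwrites p)) (rwrites p) s t"
  have b: "good (run p t)" "best t \<le> best (run p t)" "Q i (best (run p t))"
    using body[OF i _ t(2) agree] t(1) by auto
  then show "good (run p t) \<and> best s \<le> best (run p t) \<and> (\<forall>j<Suc i. Q j (best (run p t)))"
    using t(1) mono[OF _ b(2)] by (auto simp: less_Suc_eq)
qed (use good in auto)

lemma seeded_frame: "''p'' \<notin> iwrites seeded_prog" "''q'' \<notin> iwrites seeded_prog" "''r'' \<notin> iwrites seeded_prog"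
  "well_formed seeded_prog"
  by (simp_all add: loop_prog_defs)

lemma run_triple_loop:
  assumes good: "good s"
  defines "t \<equiv> run (PFor ''p'' (PFor ''q'' (PFor ''r'' seeded_prog))) s"
  shows "good t \<and> (\<forall>p<n. \<forall>q<n. \<forall>r<n. covered p q r (best t))"
proof -
  have inner: "good (run (PFor ''r'' seeded_prog) s) \<and> best s \<le> best (run (PFor ''r'' seeded_prog) s) \<and>
      (\<forall>r<n. covered p q r (best (run (PFor ''r'' seeded_prog) s)))"
    if "good s" "imem s ''p'' 0 = p" "imem s ''q'' 0 = q" "p < n" "q < n" for p q s
  proof (rule for_cover)
    fix r t assume t: "r < n" "good t" "imem t ''r'' 0 = r"
      "agree (insert ''r'' (iwrites seeded_prog)) (rwrites seeded_prog) s t"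
    have "imem t ''p'' 0 = p" "imem t ''q'' 0 = q" using t(4) that seeded_frame by (simp_all add: agree_def)
    then show "good (run seeded_prog t) \<and> best t \<le> best (run seeded_prog t) \<and> covered p q r (best (run seeded_prog t))"
      using run_seeded_prog t that by blast
  qed (use that covered_mono seeded_frame in auto)
  have middle: "good (run (PFor ''q'' (PFor ''r'' seeded_prog)) s) \<and>
      best s \<le> best (run (PFor ''q'' (PFor ''r'' seeded_prog)) s) \<and>
      (\<forall>q<n. \<forall>r<n. covered p q r (best (run (PFor ''q'' (PFor ''r'' seeded_prog)) s)))"
    if "good s" "imem s ''p'' 0 = p" "p < n" for p s
  proof (rule for_cover)
    fix q t assume t: "q < n" "good t" "imem t ''q'' 0 = q"
      "agree (insert ''q'' (iwrites (PFor ''r'' seeded_prog))) (rwrites (PFor ''r'' seeded_prog)) s t"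
    have "imem t ''p'' 0 = p" using t(4) that seeded_frame by (simp add: agree_def)
    then show "good (run (PFor ''r'' seeded_prog) t) \<and> best t \<le> best (run (PFor ''r'' seeded_prog) t) \<and>
        (\<forall>r<n. covered p q r (best (run (PFor ''r'' seeded_prog) t)))"
      using inner t that by blast
  qed (use that seeded_frame in \<open>simp | blast intro: covered_mono\<close>)+
  have "good t \<and> best s \<le> best t \<and> (\<forall>p<n. \<forall>q<n. \<forall>r<n. covered p q r (best t))"
    unfolding t_def
  proof (rule for_cover)
    fix p t assume t: "p < n" "good t" "imem t ''p'' 0 = p"
    then show "good (run (PFor ''q'' (PFor ''r'' seeded_prog)) t) \<and>
        best t \<le> best (run (PFor ''q'' (PFor ''r'' seeded_prog)) t) \<and>
        (\<forall>q<n. \<forall>r<n. covered p q r (best (run (PFor ''q'' (PFor ''r'' seeded_prog)) t)))"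
      using middle by blast
  qed (use good seeded_frame in \<open>simp | blast intro: covered_mono\<close>)+
  then show ?thesis by blast
qed

end


section \<open>Running times and the two algorithms\<close>

primrec depth :: "prog \<Rightarrow> nat" where
  "depth PSkip = 0"
| "depth (PIAssign a e f) = 0"
| "depth (PRAssign a e f) = 0"
| "depth (PSeq p q) = max (depth p) (depth q)"
| "depth (PIf g p q) = max (depth p) (depth q)"
| "depth (PFor x p) = Suc (depth p)"

text \<open>One constant serves all exponents \<open>d\<close> from the depth upwards, so that parts
  of different depth can be compared with a common power in the induction.\<close>

lemma time_bound_poly: "\<exists>K. \<forall>n\<ge>1. \<forall>d\<ge>depth p. time_bound p n \<le> K * n ^ d"
proof (induction p)
  case (PSeq p q)
  then obtain K L where "\<forall>n\<ge>1. \<forall>d\<ge>depth p. time_bound p n \<le> K * n ^ d"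
    "\<forall>n\<ge>1. \<forall>d\<ge>depth q. time_bound q n \<le> L * n ^ d" by blast
  then have "\<forall>n\<ge>1. \<forall>d\<ge>depth (PSeq p q). time_bound (PSeq p q) n \<le> (K + L) * n ^ d"
    by (auto simp: distrib_right intro!: add_mono)
  then show ?case ..
next
  case (PIf g p q)
  then obtain K L where KL: "\<forall>n\<ge>1. \<forall>d\<ge>depth p. time_bound p n \<le> K * n ^ d"
    "\<forall>n\<ge>1. \<forall>d\<ge>depth q. time_bound q n \<le> L * n ^ d" by blast
  have "time_bound (PIf g p q) n \<le> (bcost g + 1 + K + L) * n ^ d" if "1 \<le> n" "depth (PIf g p q) \<le> d" for n d
  proof -
    have "(bcost g + 1) * 1 \<le> (bcost g + 1) * n ^ d" using that by (intro mult_le_mono2) simp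
    moreover have "time_bound p n \<le> K * n ^ d" "time_bound q n \<le> L * n ^ d" using KL that by auto
    ultimately show ?thesis by (simp add: distrib_right)
  qed
  then show ?case by blast
next
  case (PFor x p)
  then obtain K where K: "\<forall>n\<ge>1. \<forall>d\<ge>depth p. time_bound p n \<le> K * n ^ d" by blast
  \<comment> \<open>21 is 9 for entering and leaving the loop plus 12 for the overhead of an
    iteration.\<close>
  have "time_bound (PFor x p) n \<le> (21 + K) * n ^ d" if n: "1 \<le> n" and deg: "depth (PFor x p) \<le> d" for n d
  proof -
    obtain d' where d: "d = Suc d'" "depth p \<le> d'" using deg by (cases d) auto
    have pos: "1 \<le> n ^ d'" "1 \<le> n ^ d" using n by simp_all
    have 1: "9 \<le> 9 * n ^ d" and 2: "n * 12 \<le> 12 * n ^ d" using pos by (simp_all add: d)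
    have "n * time_bound p n \<le> n * (K * n ^ d')" using K n d by (intro mult_le_mono2) auto
    then have 3: "n * time_bound p n \<le> K * n ^ d" by (simp add: d mult_ac)
    have "time_bound (PFor x p) n = 9 + (n * 12 + n * time_bound p n)" by (simp add: distrib_left)
    also have "\<dots> \<le> 9 * n ^ d + (12 * n ^ d + K * n ^ d)" by (intro add_mono 1 2 3)
    finally show ?thesis by (simp add: distrib_right)
  qed
  then show ?case by blast
next
  case PSkip
  then show ?case by (intro exI[of _ 1]) simp
next
  case (PIAssign a e f)
  have "icost e + icost f + 1 \<le> (icost e + icost f + 1) * n ^ d" if "1 \<le> n" for n d :: nat
    using that mult_le_mono2[of 1 "n ^ d" "icost e + icost f + 1"] by simp
  then show ?case by (intro exI[of _ "icost e + icost f + 1"]) simp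
next
  case (PRAssign a e f)
  have "icost e + rcost f + 1 \<le> (icost e + rcost f + 1) * n ^ d" if "1 \<le> n" for n d :: nat
    using that mult_le_mono2[of 1 "n ^ d" "icost e + rcost f + 1"] by simp
  then show ?case by (intro exI[of _ "icost e + rcost f + 1"]) simp
qed

lemma bigo_poly:
  fixes T :: "nat \<Rightarrow> nat"
  assumes "\<And>n. 1 \<le> n \<Longrightarrow> T n \<le> K * n ^ d"
  shows "(\<lambda>n. real (T n)) \<in> O(\<lambda>n. real n ^ d)"
proof (rule bigoI)
  show "\<forall>\<^sub>F n in sequentially. norm (real (T n)) \<le> real K * norm (real n ^ d)"
    using eventually_ge_at_top[of 1]
  proof eventually_elim
    case (elim n)
    then have "real (T n) \<le> real (K * n ^ d)" using assms by (simp only: of_nat_le_iff)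
    then show ?case by simp
  qed
qed

text \<open>The coefficients collect loop overheads: 21 = 12 + 9 per level and per source, 112 = 12
  + 100 per tested node. The loop over \<open>t\<close> is charged once for each pair of source and
  node, hence the factor \<open>n ^ 2\<close>.\<close>

definition bfs_bound :: "nat \<Rightarrow> nat" where
  "bfs_bound n = 9 + 21 * n + 21 * n ^ 2 + 112 * n ^ 3 + n ^ 2 * time_bound (PFor ''t'' relax_prog) n"

definition total_bound :: "prog \<Rightarrow> nat \<Rightarrow> nat" where
  "total_bound p n = time_bound init_prog n + (bfs_bound n + time_bound p n)"

text \<open>The search stays outside \<open>p\<close>, whose time is bounded through
  \<open>depth\<close>; its own four nested loops have depth 4.\<close>

definition full_prog :: "prog \<Rightarrow> prog" where
  "full_prog p = PSeq init_prog (PSeq bfs_prog p)"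

lemma total_bound_bigo:
  assumes "depth p \<le> d" "3 \<le> d"
  shows "(\<lambda>n. real (total_bound p n)) \<in> O(\<lambda>n. real n ^ d)"
proof -
  obtain K1 where K1: "\<forall>n\<ge>1. \<forall>d\<ge>depth init_prog. time_bound init_prog n \<le> K1 * n ^ d"
    using time_bound_poly by blast
  obtain K2 where K2: "\<forall>n\<ge>1. \<forall>d\<ge>depth p. time_bound p n \<le> K2 * n ^ d"
    using time_bound_poly by blast
  obtain K3 where K3: "\<forall>n\<ge>1. \<forall>d\<ge>depth (PFor ''t'' relax_prog). time_bound (PFor ''t'' relax_prog) n \<le> K3 * n ^ d"
    using time_bound_poly by blast
  have "total_bound p n \<le> (K1 + (163 + K3) + K2) * n ^ d" if n: "1 \<le> n" for n
  proof -
    have pow: "n ^ k \<le> n ^ d" if "k \<le> 3" for k using n that assms by (intro power_increasing) auto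
    have "time_bound init_prog n \<le> K1 * n ^ d" using K1 n assms by (simp add: init_prog_def)
    moreover have "time_bound p n \<le> K2 * n ^ d" using K2 n assms by simp
    \<comment> \<open>163 = 9 + 21 + 21 + 112, every power of \<open>n\<close> being raised to
      \<open>n ^ d\<close>.\<close>
    moreover have "bfs_bound n \<le> (163 + K3) * n ^ d"
    proof -
      have "depth (PFor ''t'' relax_prog) \<le> 1" by (simp add: relax_prog_def)
      then have "n ^ 2 * time_bound (PFor ''t'' relax_prog) n \<le> n ^ 2 * (K3 * n ^ 1)"
        using K3 n by (intro mult_le_mono2) blast
      also have "\<dots> = K3 * n ^ 3" by (simp add: eval_nat_numeral)
      also have "\<dots> \<le> K3 * n ^ d" using pow by (intro mult_le_mono2) simp
      finally show ?thesis
        using pow[of 0] pow[of 1] pow[of 2] pow[of 3] unfolding bfs_bound_def by (simp add: distrib_right)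
    qed
    ultimately show ?thesis by (simp add: total_bound_def distrib_right)
  qed
  then show ?thesis by (rule bigo_poly)
qed

text \<open>With the sum over levels moved innermost, each pair \<open>s\<close>, \<open>u\<close>
  contributes \<open>B\<close> at most once.\<close>

lemma bfs_sum_le:
  fixes D :: "nat \<Rightarrow> nat \<Rightarrow> nat"
  shows "9 + (\<Sum>l<n. 12 + (9 + (\<Sum>s<n. 12 + (9 + (\<Sum>u<n. 12 + (100 + (if D s u = l then B else 0)))))))
    \<le> 9 + 21 * n + 21 * n ^ 2 + 112 * n ^ 3 + n ^ 2 * B"
proof -
  have "(\<Sum>l<n. \<Sum>s<n. \<Sum>u<n. if D s u = l then B else 0) = (\<Sum>s<n. \<Sum>u<n. \<Sum>l<n. if D s u = l then B else 0)"
    by (subst sum.swap) (intro sum.cong refl sum.swap)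
  also have "\<dots> \<le> (\<Sum>s<n. \<Sum>u<n. B)"
    by (intro sum_mono) (simp add: sum.delta')
  also have "\<dots> = n ^ 2 * B" by (simp add: power2_eq_square)
  finally have "(\<Sum>l<n. \<Sum>s<n. \<Sum>u<n. if D s u = l then B else 0) \<le> n ^ 2 * B" .
  then show ?thesis
    by (simp add: sum.distrib power2_eq_square power3_eq_cube algebra_simps)
qed

context numbered_instance
begin

abbreviation start :: state where
  "start \<equiv> encode n G c b"

lemma input_state_encode: "input_state start"
  using n_pos index_less by (auto simp: encode_def input_state_def imat_def)

lemma init_frame: "iwrites init_prog = {''s'', ''ds''}" "rwrites init_prog = {''sg0''}"
  by (auto simp: init_prog_def)

lemma run_init_prog: "bfs_inv 0 0 0 0 (run init_prog start)"
proof -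
  define I where "I k r \<longleftrightarrow> imat r ''ds'' (\<lambda>i j. if i = j \<and> i < k then 1 else 0) \<and>
    rmat r ''sg0'' (\<lambda>i j. if i = j \<and> i < k then 1 else 0)" for k and r :: state
  have size: "size_of start = n" using input_state_encode by (simp add: input_state_def)
  have "I n (run init_prog start)"
    unfolding init_prog_def
  proof (rule for_invariant)
    let ?p = "PSeq (PIAssign ''ds'' (idx ''s'' ''s'') (ILit 1)) (PRAssign ''sg0'' (idx ''s'' ''s'') (RLit 1))"
    show "I 0 start" by (simp add: I_def imat_def rmat_def encode_def)
    fix k t assume k: "k < n" "I k t" "imem t ''s'' 0 = k"
      and agree: "agree (insert ''s'' (iwrites ?p)) (rwrites ?p) start t"
    have "size_of t = n" using agree size by (simp add: agree_def)
    then show "I (Suc k) (run ?p t)"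
      using k by (auto simp: I_def imat_def rmat_def index_eq_iff less_Suc_eq)
  qed (simp_all add: size I_def imat_def rmat_def)
  moreover have "dist i j = 0 \<longleftrightarrow> i = j" "num_paths G i i = 1" if "i < n" "j < n" for i j
    using that dist_eq_0_iff[of i j] avoiding_self[of i "{}"] by (simp_all add: num_paths_avoiding pverts_eq)
  ultimately show ?thesis
    by (auto simp: I_def bfs_inv_def imat_def rmat_def relaxed_def)
qed

lemma bfs_frame: "iwrites bfs_prog = {''l'', ''s'', ''u'', ''t'', ''ds''}" "rwrites bfs_prog = {''sg0''}"
  by (auto simp: bfs_prog_def iwrites_bfs)

text \<open>All distances are below \<open>n\<close>, so at level \<open>n\<close> no cell is in the
  partially filled state of the invariant.\<close>

lemma distances_bfs:
  assumes "bfs_inv n 0 0 0 r" "size_of r = n"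
  shows "distances r"
proof -
  have "dist i j \<le> n" if "i < n" "j < n" for i j
    using dist_less_card[of i j] that by (simp add: pverts_eq)
  then show ?thesis using assms by (simp add: distances_def bfs_inv_def imat_def rmat_def)
qed

lemma run_search:
  defines "r \<equiv> run bfs_prog (run init_prog start)"
  shows "good (run preprocess_prog r)" "best (run preprocess_prog r) = 0" "size_of r = n"
proof -
  let ?e = "run init_prog start"
  have input: "input_state ?e"
    using input_state_agree[OF agree_run[of init_prog start]] input_state_encode by (simp add: init_frame)
  have frame: "imem r a = imem start a" if "a \<notin> {''l'', ''s'', ''u'', ''t'', ''ds''}" for a
    using that by (simp add: r_def imem_run init_frame bfs_frame)
  have rframe: "rmem r a = rmem start a" if "a \<noteq> ''sg0''" for a
    using that by (simp add: r_def rmem_run init_frame bfs_frame)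
  show size: "size_of r = n" using frame[of "''n''"] input_state_encode by (simp add: input_state_def)
  have d: "distances r"
    using distances_bfs bfs_correct(1)[OF run_init_prog input] size by (simp add: r_def)
  define r1 where "r1 = run dependency_prog r"
  define r2 where "r2 = run weight_prog r1"
  have ee: "rmat r1 ''ee'' dependency"
    unfolding r1_def using run_dependency_prog[OF d] rframe[of "''ee''"] by (simp add: encode_def)
  have d1: "distances r1"
    using distances_agree[OF agree_run[of dependency_prog r] _ _ d] by (simp add: r1_def dependency_prog_def)
  have rframe1: "rmem r1 a = rmem start a" if "a \<noteq> ''sg0''" "a \<noteq> ''ee''" for a
    using that rframe by (simp add: r1_def rmem_run dependency_prog_def)
  have dd: "rmat r2 ''dd0'' (weight {})"
    unfolding r2_def using run_weight_prog[OF d1 _ ee] rframe1[of "''dd0''"] by (simp add: encode_def)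
  have d2: "distances r2"
    using distances_agree[OF agree_run[of weight_prog r1] _ _ d1] by (simp add: r2_def weight_prog_def)
  have rframe2: "rmem r2 a = rmem start a" if "a \<notin> {''sg0'', ''ee'', ''dd0''}" for a
    using that rframe1 by (simp add: r2_def rmem_run weight_prog_def)
  have frame2: "imem r2 ''out'' = imem start ''out''" "imem r2 ''v'' = imem start ''v''"
    using frame by (simp_all add: r2_def r1_def imem_run weight_prog_def dependency_prog_def)
  have run: "run preprocess_prog r = r2" by (simp add: preprocess_prog_def r2_def r1_def)
  have "output_set n r2 = {}" by (simp add: output_set_def frame2 encode_def)
  then have "found r2"
    using rframe2[of "''best''"] budget_nonneg by (simp add: found_def gbc_empty feasible_def encode_def)
  moreover have "base r2"
    using d2 dd rframe2[of "''cost''"] rframe2[of "''budget''"] by (simp add: base_def encode_def)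
  ultimately show "good (run preprocess_prog r)"
    using n_pos by (simp add: run good_def frame2 encode_def)
  show "best (run preprocess_prog r) = 0"
    using rframe2[of "''best''"] by (simp add: run encode_def)
qed

lemma exec_full_prog:
  assumes "well_formed p"
  obtains t where "exec (compile (full_prog p)) start t (run p (run bfs_prog (run init_prog start)))"
    "t \<le> total_bound p n"
proof
  let ?e = "run init_prog start"
  let ?r = "run bfs_prog ?e"
  have wf: "well_formed (full_prog p)"
    using assms well_formed_progs(1) well_formed_bfs(1) by (simp add: full_prog_def)
  show "exec (compile (full_prog p)) start (time (full_prog p) start) (run p ?r)"
    using exec_compile[OF wf, of start] by (simp add: full_prog_def)
  have input: "input_state ?e"
    using input_state_agree[OF agree_run[of init_prog start]] input_state_encode by (simp add: init_frame)
  have "time bfs_prog ?e \<le> bfs_bound n"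
    unfolding bfs_bound_def by (rule order_trans[OF bfs_correct(2)[OF run_init_prog input] bfs_sum_le])
  moreover have "time init_prog start \<le> time_bound init_prog n"
    using time_le_time_bound[OF well_formed_progs(1), of start] input_state_encode by (simp add: input_state_def)
  moreover have "time p ?r \<le> time_bound p n"
    using time_le_time_bound[OF assms, of ?r] run_search(3) by simp
  ultimately show "time (full_prog p) start \<le> total_bound p n"
    by (simp add: full_prog_def total_bound_def)
qed

lemma opt_attained:
  obtains S where "S \<subseteq> {..<n}" "sum c S \<le> b" "gbc G S = opt G c b"
proof -
  let ?F = "{C. feasible G c b C}"
  have "?F \<subseteq> Pow {..<n}" by (auto simp: feasible_def pverts_eq)
  then have "finite ?F" by (rule finite_subset) simp
  moreover have "{} \<in> ?F" using budget_nonneg by (simp add: feasible_def)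
  ultimately have "opt G c b \<in> gbc G ` ?F" unfolding opt_def by (intro Max_in) auto
  then show thesis using that by (auto simp: feasible_def pverts_eq)
qed

lemma run_single_prog:
  defines "t \<equiv> run single_prog (run bfs_prog (run init_prog start))"
  shows "feasible G c b (output_set n t)" "opt G c b \<le> 2 * gbc G (output_set n t)"
proof -
  let ?r = "run preprocess_prog (run bfs_prog (run init_prog start))"
  have t: "t = run (PSeq reset_prog greedy_prog) ?r" by (simp add: t_def single_prog_def)
  obtain Gs where good: "good t" and Gs: "Gs 0 = {}" "greedy_run Gs n (best t)"
    using run_single_loop[OF run_search(1)] by (auto simp: t simp del: run.simps)
  have found: "found t" using good by (simp add: good_def)
  then show "feasible G c b (output_set n t)" by (simp add: found_def)
  obtain S where S: "S \<subseteq> {..<n}" "sum c S \<le> b" "gbc G S = opt G c b" by (rule opt_attained)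
  have "gbc G {} \<le> gbc G (output_set n t)" using found by (intro mono) (auto simp: found_def feasible_def pverts_eq)
  then have "0 \<le> best t" using found by (simp add: gbc_empty found_def)
  then have "gbc G S \<le> 2 * best t"
    using greedy_max_half[of Gs "best t" S] Gs S by simp
  then show "opt G c b \<le> 2 * gbc G (output_set n t)" using found S by (simp add: found_def)
qed

text \<open>Costs are nonnegative, so every subset of a feasible set fits: no addition is refused,
  and a repeated item changes nothing.\<close>

lemma add_items_eq:
  assumes S: "S \<subseteq> {..<n}" "sum c S \<le> b" and pqr: "p \<in> S" "q \<in> S" "r \<in> S"
  shows "add_item (add_item (add_item {} p) q) r = {p, q, r}"
proof -
  have add: "add_item C x = insert x C" if "C \<subseteq> S" "x \<in> S" for C x
  proof (cases "x \<in> C")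
    case True
    then show ?thesis by (auto simp: add_item_def)
  next
    case False
    have fin: "finite S" "finite C" using S that finite_subset by (blast, meson finite_lessThan finite_subset)
    have "sum c (insert x C) \<le> sum c S"
      using that S fin c_nonneg by (intro sum_mono2) auto
    then have "addable C x" using False fin S that by (auto simp: addable_def)
    then show ?thesis by (simp add: add_item_def)
  qed
  show ?thesis using pqr by (simp add: add insert_commute)
qed

lemma run_triple_prog:
  defines "t \<equiv> run triple_prog (run bfs_prog (run init_prog start))"
  shows "feasible G c b (output_set n t)" "(1 - 1 / exp 1) * opt G c b \<le> gbc G (output_set n t)"
proof -
  let ?r = "run preprocess_prog (run bfs_prog (run init_prog start))"
  have t: "t = run (PFor ''p'' (PFor ''q'' (PFor ''r'' seeded_prog))) ?r" by (simp add: t_def triple_prog_def)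
  have good: "good t" and cov: "\<And>p q r. p < n \<Longrightarrow> q < n \<Longrightarrow> r < n \<Longrightarrow> covered p q r (best t)"
    using run_triple_loop[OF run_search(1)] by (auto simp: t)
  have found: "found t" using good by (simp add: good_def)
  then show "feasible G c b (output_set n t)" by (simp add: found_def)
  obtain S where S: "S \<subseteq> {..<n}" "sum c S \<le> b" "gbc G S = opt G c b" by (rule opt_attained)
  have best: "best t = gbc G (output_set n t)" using found by (simp add: found_def)
  show "(1 - 1 / exp 1) * opt G c b \<le> gbc G (output_set n t)"
  \<comment> \<open>Seeds can be chosen only in a nonempty optimal set; an empty one has value
    0.\<close>
  proof (cases "S = {}")
    case True
    have "gbc G {} \<le> gbc G (output_set n t)" using found by (intro mono) (auto simp: found_def feasible_def pverts_eq)
    then show ?thesis using True S gbc_empty by simp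
  next
    case False
    obtain p q r where pqr: "p \<in> S" "q \<in> S" "r \<in> S"
      and seed: "\<And>A x. x \<in> S \<Longrightarrow> {p, q, r} \<subseteq> A \<Longrightarrow> A \<subseteq> {..<n} \<Longrightarrow> 3 * gain A x \<le> gbc G {p, q, r}"
      using seed_exists[OF S(1) False] by blast
    have "covered p q r (best t)" using cov pqr S by auto
    then obtain Gs where Gs: "Gs 0 = {p, q, r}" "greedy_run Gs (card {..<n}) (best t)"
      using add_items_eq[OF S(1,2) pqr] by (auto simp: covered_def)
    have "(1 - 1 / exp 1) * gbc G S \<le> best t"
      by (rule greedy_seeded[OF Gs(2,1) S(1,2) pqr seed])
    then show ?thesis using S best by simp
  qed
qed

lemma opt_nonneg: "0 \<le> opt G c b"
proof -
  obtain S where "S \<subseteq> {..<n}" "gbc G S = opt G c b" by (rule opt_attained)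
  then show ?thesis using mono[of "{}" S] gbc_empty by simp
qed

end

lemma depth_single: "depth single_prog \<le> 3"
  by (simp add: loop_prog_defs)

text \<open>Three loops over seeds surround a greedy run of depth 3: \<open>n\<close> steps, each
  scanning \<open>n\<close> nodes and possibly copying a set of \<open>n\<close> entries per
  node.\<close>

lemma depth_triple: "depth triple_prog \<le> 6"
  by (simp add: loop_prog_defs)

lemma full_prog_algorithm:
  assumes wf: "well_formed p" and depth: "depth p \<le> d" "3 \<le> d"
    and correct: "\<And>n G c b. numbered_instance G c b n \<Longrightarrow>
      feasible G c b (output_set n (run p (run bfs_prog (run init_prog (encode n G c b))))) \<and>
      \<alpha> * opt G c b \<le> gbc G (output_set n (run p (run bfs_prog (run init_prog (encode n G c b)))))"
  shows "\<exists>P T. approximation_algorithm P \<alpha> \<and> runs_in_time P T \<and> T \<in> O(\<lambda>n. real n ^ d)"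
proof (intro exI conjI)
  let ?P = "compile (full_prog p)"
  have exec: "\<exists>t s. exec ?P (encode n G c b) t s \<and> t \<le> total_bound p n \<and>
      feasible G c b (output_set n s) \<and> \<alpha> * opt G c b \<le> gbc G (output_set n s)"
    if "mbc_instance G c b" "pverts G = {..<n}" for n G c b
  proof -
    have num: "numbered_instance G c b n"
      using that by (simp add: numbered_instance_def numbered_instance_axioms_def)
    show ?thesis
      using numbered_instance.exec_full_prog[OF num wf] correct[OF num] by metis
  qed
  show "approximation_algorithm ?P \<alpha>"
    unfolding approximation_algorithm_def using exec by blast
  show "runs_in_time ?P (\<lambda>n. real (total_bound p n))"
    unfolding runs_in_time_def using exec by (metis of_nat_le_iff)
  show "(\<lambda>n. real (total_bound p n)) \<in> O(\<lambda>n. real n ^ d)"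
    by (rule total_bound_bigo[OF depth])
qed

theorem theorem1:
  shows "(\<exists>P T. approximation_algorithm P (1 - 1 / sqrt (exp 1)) \<and>
                runs_in_time P T \<and> T \<in> O(\<lambda>n. real n ^ 3)) \<and>
         (\<exists>P T. approximation_algorithm P (1 - 1 / exp 1) \<and>
                runs_in_time P T \<and> T \<in> O(\<lambda>n. real n ^ 6))"
proof
  have "sqrt (exp 1) \<le> sqrt (2 ^ 2)" using exp_le by (intro real_sqrt_le_mono) simp
  then have "sqrt (exp 1) \<le> 2" by simp
  then have half: "1 - 1 / sqrt (exp 1) \<le> (1 / 2 :: real)" by (simp add: field_simps)
  show "\<exists>P T. approximation_algorithm P (1 - 1 / sqrt (exp 1)) \<and>
      runs_in_time P T \<and> T \<in> O(\<lambda>n. real n ^ 3)"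
  proof (rule full_prog_algorithm[OF well_formed_progs(2) depth_single])
    fix n G c b assume num: "numbered_instance G c b n"
    let ?C = "output_set n (run single_prog (run bfs_prog (run init_prog (encode n G c b))))"
    have "(1 - 1 / sqrt (exp 1)) * opt G c b \<le> 1 / 2 * opt G c b"
      using half numbered_instance.opt_nonneg[OF num] by (intro mult_right_mono)
    also have "\<dots> \<le> gbc G ?C"
      using numbered_instance.run_single_prog(2)[OF num] by simp
    finally show "feasible G c b ?C \<and> (1 - 1 / sqrt (exp 1)) * opt G c b \<le> gbc G ?C"
      using numbered_instance.run_single_prog(1)[OF num] by simp
  qed simp
  show "\<exists>P T. approximation_algorithm P (1 - 1 / exp 1) \<and>
      runs_in_time P T \<and> T \<in> O(\<lambda>n. real n ^ 6)"
    using numbered_instance.run_triple_prog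
    by (intro full_prog_algorithm[OF well_formed_progs(3) depth_triple]) auto
qed

end
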